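(* For each integer $k \ge 0$ let $\mathcal{P}_k$ be the set of polyhedral graphs (two polyhedral graphs being regarded as the same if they are isotopic in the $2$-sphere) that have exactly $k$ rigid vertices. Then: (1) for $k \le 3$, $\mathcal{P}_k$ is the empty set; (2) $\mathcal{P}_4$ has only one element, the tetrahedron; (3) $\mathcal{P}_5$ has only two elements, the $4$-gonal pyramid and the $3$-gonal bipyramid; (4) for every integer $k \ge 6$, $\mathcal{P}_k$ is infinite.
   Context: A polyhedral graph is a planar graph given by the $1$-skeleton of a strictly-convex Euclidean (3-dimensional) polyhedron; equivalently (Steinitz) it is a 3-connected planar graph with no loops and no multiple edges. Polyhedral graphs are regarded as (unlabelled) graphs embedded in the $2$-sphere, and two polyhedral graphs are the same if there is an isotopy of the sphere between them. The faces of the graph are the connected regions of its complement in the sphere (the faces of the polyhedron). The non-triangular degree of a vertex $v$ is the number of non-triangular faces adjacent to (i.e. incident with) $v$. A vertex is (combinatorially) rigid if its non-triangular degree is at most $3$. The tetrahedron, the $4$-gonal pyramid (pyramid over a quadrilateral) and the $3$-gonal bipyramid (bipyramid over a triangle) are identified with their $1$-skeleton graphs. *)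

theory Defs
  imports "HOL-Analysis.Analysis"
begin

abbreviation S2 :: "(real^3) set" where
  "S2 \<equiv> sphere 0 1"

text \<open>Unlabelled graphs drawn on the unit sphere: the edges are given as closed arcs, that is, as
  point sets containing their end points.\<close>

datatype sgraph = SGraph (verts: "(real^3) set") (edges: "(real^3) set set")

text \<open>There is an ambient isotopy of the sphere, starting at the identity, that carries the vertices
  and edges of the first graph onto those of the second.\<close>

definition isotopic :: "sgraph \<Rightarrow> sgraph \<Rightarrow> bool" where
  "isotopic G G' \<longleftrightarrow>
     (\<exists>h :: real \<Rightarrow> real^3 \<Rightarrow> real^3.
        continuous_on ({0..1} \<times> S2) (\<lambda>(t, x). h t x) \<and>
        (\<forall>t\<in>{0..1}. \<exists>g. homeomorphism S2 S2 (h t) g) \<and>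
        (\<forall>x\<in>S2. h 0 x = x) \<and>
        h 1 ` verts G = verts G' \<and>
        (\<lambda>e. h 1 ` e) ` edges G = edges G')"

definition isotopy_rel :: "(sgraph \<times> sgraph) set" where
  "isotopy_rel = {(G, G'). isotopic G G'}"

definition isotopy_class :: "sgraph \<Rightarrow> sgraph set" where
  "isotopy_class G = isotopy_rel `` {G}"

text \<open>The 1-skeleton of \<open>P\<close>, drawn on the unit sphere by radial projection from the point \<open>c\<close>;
  recall that \<open>sgn x\<close> is \<open>x\<close> divided by its norm.\<close>

definition skeleton_graph :: "real^3 \<Rightarrow> (real^3) set \<Rightarrow> sgraph" where
  "skeleton_graph c P =
     SGraph ((\<lambda>x. sgn (x - c)) ` {v. v extreme_point_of P})
            ((\<lambda>e. (\<lambda>x. sgn (x - c)) ` e) ` {e. e edge_of P})"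

text \<open>The existence of an interior point makes \<open>P\<close> three-dimensional.\<close>

definition polyhedral_graph :: "sgraph \<Rightarrow> bool" where
  "polyhedral_graph G \<longleftrightarrow>
     (\<exists>P c. polytope P \<and> c \<in> interior P \<and> isotopic (skeleton_graph c P) G)"

definition faces :: "sgraph \<Rightarrow> (real^3) set set" where
  "faces G = components (S2 - (verts G \<union> \<Union>(edges G)))"

text \<open>A face is an open region of the sphere, so its incident vertices and edges are
  those contained in its closure.\<close>

definition triangular :: "sgraph \<Rightarrow> (real^3) set \<Rightarrow> bool" where
  "triangular G F \<longleftrightarrow> card {e \<in> edges G. e \<subseteq> closure F} = 3"

definition nontriangular_degree :: "sgraph \<Rightarrow> real^3 \<Rightarrow> nat" where
  "nontriangular_degree G v =
     card {F \<in> faces G. v \<in> closure F \<and> \<not> triangular G F}"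

definition rigid_vertices :: "sgraph \<Rightarrow> (real^3) set" where
  "rigid_vertices G = {v \<in> verts G. nontriangular_degree G v \<le> 3}"

definition polyhedral_classes :: "nat \<Rightarrow> sgraph set set" where
  "polyhedral_classes k =
     {G. polyhedral_graph G \<and> card (rigid_vertices G) = k} // isotopy_rel"

text \<open>The origin is an interior point of each of the following three polyhedra.\<close>

definition tetrahedron :: sgraph where
  "tetrahedron = skeleton_graph 0 (convex hull
     {vector [1, 1, 1], vector [1, -1, -1], vector [-1, 1, -1], vector [-1, -1, 1]})"

definition quadrilateral_pyramid :: sgraph where
  "quadrilateral_pyramid = skeleton_graph 0 (convex hull
     {vector [1, 0, -1], vector [0, 1, -1], vector [-1, 0, -1], vector [0, -1, -1],
      vector [0, 0, 1]})"

definition triangular_bipyramid :: sgraph where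
  "triangular_bipyramid = skeleton_graph 0 (convex hull
     {vector [1, 0, 0], vector [-1, 1, 0], vector [-1, -1, 0],
      vector [0, 0, 1], vector [0, 0, -1]})"

end

theory Submission
  imports Defs
begin

text \<open>Let \<open>d\<close>, \<open>t\<close> and \<open>deg = d + t\<close> count the non-triangular facets, the triangular facets and all facets at a
vertex of the polytope. Euler's formula turns into
\<open>\<Sum>\<^sub>v (12 - 3 d - 2 t) = 24 + 3 \<Sum>\<^sub>F (|F| - 4)\<close>, with \<open>F\<close> ranging over the non-triangular facets. A non-rigid vertex
contributes at most 0 on the left and a rigid one at most 6, so there are at least four rigid vertices. With four of
them nothing may be lost; with five the total loss is at most 6. If there were also non-rigid vertices, then every rigid
vertex with a non-rigid neighbour would lose at least 2, and since no two vertices separate a polytope there would be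
at least three such vertices. Hence there are exactly three of them and the other two rigid vertices lose nothing;
this isolates those two, which is absurd. So polytopes with four or five rigid vertices have no other vertices.

A polytope with four or five vertices is determined, up to the choice of the centre and up to a linear map of the rays
through its vertices, by the signs of the affine relation between the vertices. Moving the centre is an isotopy, and so
is a linear map of positive determinant; the three special polytopes have reflections, which repair a negative one.

For \<open>k \<ge> 6\<close>, towers of \<open>m\<close>-gonal prismatic layers, with or without an apex, have exactly \<open>2 m + 1\<close> or \<open>2 m\<close> rigid vertices,
however many layers there are.\<close>

section \<open>Facets, edges and vertices of polytopes\<close>

text \<open>Euler's formula enters only as the inequality V - E + F \<ge> 2. It comes from a sweep
  by a generic linear functional that charges every edge and facet to its highest vertex, so
  convexity replaces plane topology. Read as an upper bound for the sum of |F| - 2, the same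
  inequality certifies that an explicit list of tower facets is complete. Up to a common factor, 12,
  3, 2 are the only weights for which triangles cancel and a vertex with d = 4, t = 0 has charge 0.
  A rigid vertex with a non-rigid neighbour loses 2 because the loss 2 t of non-rigid vertices is
  handed on to the rigid corners of their triangles; then each of the two facets along the
  connecting edge costs 1. Affine relations have arbitrary real coefficients. Seen from a suitably
  weighted centre, the vectors to the vertices can be rescaled so that only the signs remain; equal
  signs then give a linear map between two polytopes. An isotopy preserves orientation, hence the
  care about determinants. Pyramid and bipyramid are told apart by their non-adjacent pairs of
  vertices, the infinitely many classes by their numbers of vertices.\<close>

lemma facet_of_subset_eq:
  fixes S :: "'a::euclidean_space set"
  assumes "F facet_of S" "G facet_of S" "F \<subseteq> G"
  shows "F = G"
proof (rule ccontr)
  assume "F \<noteq> G"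
  have "F face_of G"
    using assms face_of_face facet_of_imp_face_of by metis
  moreover have "convex G"
    using assms facet_of_imp_face_of face_of_imp_convex by blast
  ultimately have "aff_dim F < aff_dim G"
    using \<open>F \<noteq> G\<close> face_of_aff_dim_lt by blast
  then show False
    using assms by (simp add: facet_of_def)
qed

text \<open>On \<open>F\<close> the left side vanishes while both terms on the right are
  nonpositive, so each of them vanishes. A positive coefficient then puts \<open>F\<close> inside
  \<open>G\<close> or \<open>H\<close>; if both are 0, the functional of \<open>F\<close> is
  constant on \<open>S\<close> and \<open>F = S\<close>.\<close>

lemma facet_supporting_not_nonneg_combination:
  fixes S :: "'a::euclidean_space set"
  assumes F: "F facet_of S" "S \<subseteq> {x. a1 \<bullet> x \<le> b1}" "F = S \<inter> {x. a1 \<bullet> x = b1}"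
    and G: "G facet_of S" "S \<subseteq> {x. a2 \<bullet> x \<le> b2}" "G = S \<inter> {x. a2 \<bullet> x = b2}"
    and H: "H facet_of S" "S \<subseteq> {x. a3 \<bullet> x \<le> b3}" "H = S \<inter> {x. a3 \<bullet> x = b3}"
    and ne: "F \<noteq> G" "F \<noteq> H"
    and c: "\<alpha> > 0" "\<beta> \<ge> 0" "\<gamma> \<ge> 0"
    and eq: "\<And>x. x \<in> S \<Longrightarrow> \<alpha> * (a1 \<bullet> x - b1) = \<beta> * (a2 \<bullet> x - b2) + \<gamma> * (a3 \<bullet> x - b3)"
  shows False
proof -
  have z: "\<beta> * (a2 \<bullet> x - b2) = 0 \<and> \<gamma> * (a3 \<bullet> x - b3) = 0" if "x \<in> F" for x
  proof -
    have "x \<in> S" "a1 \<bullet> x = b1"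
      using that F by auto
    then have "\<beta> * (a2 \<bullet> x - b2) + \<gamma> * (a3 \<bullet> x - b3) = 0"
      using eq[of x] by simp
    moreover have "\<beta> * (a2 \<bullet> x - b2) \<le> 0" "\<gamma> * (a3 \<bullet> x - b3) \<le> 0"
      using \<open>x \<in> S\<close> G(2) H(2) c by (auto simp: mult_nonneg_nonpos)
    ultimately show ?thesis by linarith
  qed
  consider "\<beta> > 0" | "\<gamma> > 0" | "\<beta> = 0" "\<gamma> = 0"
    using c by linarith
  then show False
  proof cases
    case 1
    then have "F \<subseteq> G" using z F(3) G(3) by auto
    then show False using facet_of_subset_eq F(1) G(1) ne by blast
  next
    case 2
    then have "F \<subseteq> H" using z F(3) H(3) by auto
    then show False using facet_of_subset_eq F(1) H(1) ne by blast
  next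
    case 3
    then have "F = S" using eq F(3) c by auto
    then show False using F(1) by simp
  qed
qed

lemma exists_nonzero_orthogonal_pair:
  fixes u v :: "real^3"
  obtains a :: "real^3" where "a \<noteq> 0" "a \<bullet> u = 0" "a \<bullet> v = 0"
proof -
  have "dim {u, v} \<le> card {u, v}"
    by (rule dim_le_card) (auto intro: span_base)
  also have "\<dots> \<le> 2"
    by (simp add: card_insert_if)
  finally have "dim {u, v} < DIM(real^3)"
    by simp
  then obtain a where "a \<noteq> 0" "\<And>y. y \<in> span {u, v} \<Longrightarrow> orthogonal a y"
    using orthogonal_to_subspace_exists by metis
  then show thesis
    using that[of a] by (auto simp: orthogonal_def span_base)
qed

text \<open>The three functionals vanish on \<open>T\<close>, and \<open>S\<close> has only two
  dimensions beyond \<open>T\<close>, so they are dependent on \<open>S\<close>. Up to a global sign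
  at most one coefficient of the dependence is negative: either one functional is a nonnegative
  combination of the other two, or all coefficients are nonnegative and one functional vanishes on
  all of \<open>S\<close>.\<close>

lemma no_three_facets_at_ridge:
  fixes S :: "'a::euclidean_space set"
  assumes S: "polyhedron S" and T: "T face_of S" "T \<noteq> {}" and dim: "aff_dim T = aff_dim S - 2"
    and F: "F1 facet_of S" "F2 facet_of S" "F3 facet_of S"
    and sub: "T \<subseteq> F1" "T \<subseteq> F2" "T \<subseteq> F3"
    and ne: "F1 \<noteq> F2" "F1 \<noteq> F3" "F2 \<noteq> F3"
  shows False
proof -
  obtain a1 b1 where f1: "S \<subseteq> {x. a1 \<bullet> x \<le> b1}" "F1 = S \<inter> {x. a1 \<bullet> x = b1}"
    using facet_of_polyhedron[OF S F(1)] by metis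
  obtain a2 b2 where f2: "S \<subseteq> {x. a2 \<bullet> x \<le> b2}" "F2 = S \<inter> {x. a2 \<bullet> x = b2}"
    using facet_of_polyhedron[OF S F(2)] by metis
  obtain a3 b3 where f3: "S \<subseteq> {x. a3 \<bullet> x \<le> b3}" "F3 = S \<inter> {x. a3 \<bullet> x = b3}"
    using facet_of_polyhedron[OF S F(3)] by metis
  have TS: "T \<subseteq> S" using T face_of_imp_subset by blast
  have "\<not> S \<subseteq> affine hull T"
    using aff_dim_subset[of S "affine hull T"] dim by auto
  then obtain x1 where x1: "x1 \<in> S" "x1 \<notin> affine hull T" by blast
  have d1: "aff_dim (insert x1 T) = aff_dim S - 1"
    using x1 dim by (simp add: aff_dim_insert)
  have "\<not> S \<subseteq> affine hull (insert x1 T)"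
    using aff_dim_subset[of S "affine hull (insert x1 T)"] d1 by auto
  then obtain x2 where x2: "x2 \<in> S" "x2 \<notin> affine hull (insert x1 T)" by blast
  define X where "X = insert x2 (insert x1 T)"
  have d2: "aff_dim X = aff_dim S"
    using x2 d1 by (simp add: aff_dim_insert X_def)
  have XS: "X \<subseteq> S" using x1 x2 TS by (auto simp: X_def)
  have hull: "S \<subseteq> affine hull X"
  proof -
    have "affine hull X = affine hull S"
      by (rule affine_dim_equal) (use XS d2 in \<open>auto simp: hull_mono X_def\<close>)
    then show ?thesis by (simp add: hull_subset)
  qed
  define f where "f x = (vector [a1 \<bullet> x - b1, a2 \<bullet> x - b2, a3 \<bullet> x - b3] :: real^3)" for x
  \<comment> \<open>\<open>c\<close> annihilates the values of the three functionals at
    \<open>x1\<close> and \<open>x2\<close>. Together with \<open>T\<close> these two points span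
    \<open>S\<close> affinely, so the dependence extends to \<open>S\<close>.\<close>
  obtain c :: "real^3" where c: "c \<noteq> 0" "c \<bullet> f x1 = 0" "c \<bullet> f x2 = 0"
    using exists_nonzero_orthogonal_pair by metis
  define \<alpha> \<beta> \<gamma> where "\<alpha> = c$1" "\<beta> = c$2" "\<gamma> = c$3"
  have cf: "c \<bullet> f x = \<alpha> * (a1 \<bullet> x - b1) + \<beta> * (a2 \<bullet> x - b2) + \<gamma> * (a3 \<bullet> x - b3)" for x
    by (simp add: f_def \<alpha>_\<beta>_\<gamma>_def inner_vec_def sum_3)
  have "c \<bullet> f x = 0" if "x \<in> X" for x
  proof -
    have "c \<bullet> f x = 0" if "x \<in> T" for x
    proof -
      have "a1 \<bullet> x = b1" "a2 \<bullet> x = b2" "a3 \<bullet> x = b3"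
        using that sub f1(2) f2(2) f3(2) by blast+
      then show ?thesis unfolding cf by simp
    qed
    then show ?thesis using that c by (auto simp: X_def)
  qed
  moreover have "affine {x. c \<bullet> f x = 0}"
  proof -
    have "{x. c \<bullet> f x = 0} = {x. (\<alpha> *\<^sub>R a1 + \<beta> *\<^sub>R a2 + \<gamma> *\<^sub>R a3) \<bullet> x = \<alpha> * b1 + \<beta> * b2 + \<gamma> * b3}"
      unfolding cf by (auto simp: algebra_simps)
    then show ?thesis by (simp add: affine_hyperplane)
  qed
  ultimately have "affine hull X \<subseteq> {x. c \<bullet> f x = 0}"
    by (intro hull_minimal) auto
  then have eq: "\<alpha> * (a1 \<bullet> x - b1) + \<beta> * (a2 \<bullet> x - b2) + \<gamma> * (a3 \<bullet> x - b3) = 0" if "x \<in> S" for x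
    using that hull cf by auto
  have nz: "\<alpha> \<noteq> 0 \<or> \<beta> \<noteq> 0 \<or> \<gamma> \<noteq> 0"
    using c(1) by (auto simp: vec_eq_iff forall_3 \<alpha>_\<beta>_\<gamma>_def)
  note A = facet_supporting_not_nonneg_combination
  have s: "\<bar>x\<bar> = x \<or> \<bar>x\<bar> = - x" for x :: real by linarith
  have K: False if "\<alpha>' \<noteq> 0 \<or> \<beta>' \<noteq> 0 \<or> \<gamma>' \<noteq> 0"
     and eq: "\<And>x. x \<in> S \<Longrightarrow> \<alpha>' * (a1 \<bullet> x - b1) + \<beta>' * (a2 \<bullet> x - b2) + \<gamma>' * (a3 \<bullet> x - b3) = 0"
     and sg: "(\<alpha>' \<ge> 0 \<and> \<beta>' \<ge> 0) \<or> (\<alpha>' \<ge> 0 \<and> \<gamma>' \<ge> 0) \<or> (\<beta>' \<ge> 0 \<and> \<gamma>' \<ge> 0)" for \<alpha>' \<beta>' \<gamma>'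
  proof -
    consider "\<alpha>' < 0" "\<beta>' \<ge> 0" "\<gamma>' \<ge> 0" | "\<beta>' < 0" "\<alpha>' \<ge> 0" "\<gamma>' \<ge> 0" | "\<gamma>' < 0" "\<alpha>' \<ge> 0" "\<beta>' \<ge> 0" 
      | "\<alpha>' \<ge> 0" "\<beta>' \<ge> 0" "\<gamma>' \<ge> 0"
      using sg by linarith
    then show False
    proof cases
      case 1
      have "- \<alpha>' * (a1 \<bullet> x - b1) = \<beta>' * (a2 \<bullet> x - b2) + \<gamma>' * (a3 \<bullet> x - b3)" if "x \<in> S" for x
        using eq[OF that] by linarith
      then show False
        using A[OF F(1) f1 F(2) f2 F(3) f3 ne(1) ne(2), of "-\<alpha>'" \<beta>' \<gamma>'] 1 by simp
    next
      case 2
      have "- \<beta>' * (a2 \<bullet> x - b2) = \<alpha>' * (a1 \<bullet> x - b1) + \<gamma>' * (a3 \<bullet> x - b3)" if "x \<in> S" for x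
        using eq[OF that] by linarith
      then show False
        using A[OF F(2) f2 F(1) f1 F(3) f3 ne(1)[symmetric] ne(3), of "-\<beta>'" \<alpha>' \<gamma>'] 2 by simp
    next
      case 3
      have "- \<gamma>' * (a3 \<bullet> x - b3) = \<alpha>' * (a1 \<bullet> x - b1) + \<beta>' * (a2 \<bullet> x - b2)" if "x \<in> S" for x
        using eq[OF that] by linarith
      then show False
        using A[OF F(3) f3 F(1) f1 F(2) f2 ne(2,3)[symmetric], of "-\<gamma>'" \<alpha>' \<beta>'] 3 by simp
    next
      case 4
      have "\<alpha>' * (a1 \<bullet> x - b1) = 0 \<and> \<beta>' * (a2 \<bullet> x - b2) = 0 \<and> \<gamma>' * (a3 \<bullet> x - b3) = 0" if "x \<in> S" for x
      proof -
        have "\<alpha>' * (a1 \<bullet> x - b1) \<le> 0" "\<beta>' * (a2 \<bullet> x - b2) \<le> 0" "\<gamma>' * (a3 \<bullet> x - b3) \<le> 0"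
          using that 4 f1 f2 f3 by (auto simp: mult_nonneg_nonpos)
        then show ?thesis using eq[OF that] by linarith
      qed
      then have "S \<subseteq> {x. a1 \<bullet> x = b1} \<or> S \<subseteq> {x. a2 \<bullet> x = b2} \<or> S \<subseteq> {x. a3 \<bullet> x = b3}"
        using that(1) unfolding mult_eq_0_iff by (simp add: subset_iff) blast
      then have "F1 = S \<or> F2 = S \<or> F3 = S"
        using f1(2) f2(2) f3(2) by blast
      then show False using F by auto
    qed
  qed
  show False
  proof (cases "(\<alpha> \<ge> 0 \<and> \<beta> \<ge> 0) \<or> (\<alpha> \<ge> 0 \<and> \<gamma> \<ge> 0) \<or> (\<beta> \<ge> 0 \<and> \<gamma> \<ge> 0)")
    case True
    then show False using K[of \<alpha> \<beta> \<gamma>] nz eq by blast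
  next
    case False
    moreover have "- \<alpha> * (a1 \<bullet> x - b1) + - \<beta> * (a2 \<bullet> x - b2) + - \<gamma> * (a3 \<bullet> x - b3) = 0" if "x \<in> S" for x
      using eq[OF that] by linarith
    ultimately show False using K[of "-\<alpha>" "-\<beta>" "-\<gamma>"] nz by auto
  qed
qed

text \<open>\<open>T\<close> is the intersection of the facets containing it and smaller than any of
  them, so there are at least two; the previous lemma excludes a third. This single count serves for
  edges of \<open>P\<close>, for vertices of its facets and for vertices of plane sections.\<close>

lemma card_facets_at_ridge:
  fixes S :: "'a::euclidean_space set"
  assumes S: "polyhedron S" and T: "T face_of S" "T \<noteq> {}" and dim: "aff_dim T = aff_dim S - 2"
  shows "card {F. F facet_of S \<and> T \<subseteq> F} = 2"
proof -
  let ?A = "{F. F facet_of S \<and> T \<subseteq> F}"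
  have TS: "T \<noteq> S" using dim by auto
  have T_eq: "T = \<Inter>?A" using face_of_polyhedron[OF S T TS] .
  obtain F where F: "F facet_of S" "T \<subseteq> F"
    using face_of_polyhedron_subset_facet[OF S T TS] by blast
  have "T \<noteq> F" using F dim by (auto simp: facet_of_def)
  then obtain G where G: "G facet_of S" "T \<subseteq> G" "G \<noteq> F"
    using T_eq F by blast
  have "?A = {F, G}"
    using no_three_facets_at_ridge[OF S T dim] F G by blast
  then show ?thesis using G by simp
qed

text \<open>The face is the intersection of all faces through \<open>x\<close>; if \<open>x\<close>
  were in its relative frontier, there would be a smaller one.\<close>

lemma polytope_point_in_rel_interior_face:
  fixes S :: "'a::euclidean_space set"
  assumes S: "polytope S" and x: "x \<in> S"
  obtains F where "F face_of S" "x \<in> rel_interior F"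
proof -
  let ?A = "{F. F face_of S \<and> x \<in> F}"
  define F where "F = \<Inter>?A"
  have "S \<in> ?A"
    using S x face_of_refl polytope_imp_convex by blast
  then have F: "F face_of S"
    unfolding F_def by (intro face_of_Inter) auto
  have xF: "x \<in> F" by (auto simp: F_def)
  have "x \<notin> rel_frontier F"
  proof
    assume "x \<in> rel_frontier F"
    moreover have "polyhedron F"
      using F S face_of_polytope_polytope polytope_imp_polyhedron by blast
    ultimately obtain G where G: "G face_of F" "G \<noteq> F" "x \<in> G"
      using rel_frontier_of_polyhedron_alt by blast
    then have "G \<in> ?A" using F face_of_trans by blast
    then have "F \<subseteq> G" by (auto simp: F_def)
    then show False using G face_of_imp_subset by blast
  qed
  then have "x \<in> rel_interior F"
    using xF closure_subset by (auto simp: rel_frontier_def)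
  then show thesis using that F by blast
qed

lemma rel_interior_both_directions:
  fixes S :: "'a::euclidean_space set"
  assumes x: "x \<in> rel_interior S" and y: "y \<in> affine hull S"
  obtains e where "e > 0" "x + e *\<^sub>R (y - x) \<in> S" "x - e *\<^sub>R (y - x) \<in> S"
proof -
  obtain d where d: "d > 0" "ball x d \<inter> affine hull S \<subseteq> S"
    using x by (auto simp: mem_rel_interior_ball)
  have xS: "x \<in> affine hull S"
    using x rel_interior_subset hull_subset by (metis subsetD)
  \<comment> \<open>The added 1 keeps the denominator positive when \<open>y = x\<close>.\<close>
  define e where "e = d / (2 * (norm (y - x) + 1))"
  have e: "e > 0" using d by (simp add: e_def add_nonneg_pos)
  have n: "norm (e *\<^sub>R (y - x)) < d"
  proof -
    have "norm (e *\<^sub>R (y - x)) = d * (norm (y - x) / (2 * (norm (y - x) + 1)))"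
      using e d by (simp add: e_def)
    also have "\<dots> < d * 1"
      using d by (intro mult_strict_left_mono) (auto simp: divide_simps add_nonneg_pos)
    finally show ?thesis by simp
  qed
  have "x + t *\<^sub>R (y - x) \<in> affine hull S" for t
  proof -
    have "(1 - t) *\<^sub>R x + t *\<^sub>R y \<in> affine hull S"
      using xS y affine_affine_hull by (simp add: mem_affine)
    then show ?thesis by (simp add: algebra_simps)
  qed
  from this[of e] this[of "-e"] have "x + e *\<^sub>R (y - x) \<in> affine hull S" "x - e *\<^sub>R (y - x) \<in> affine hull S"
    by auto
  then have "x + e *\<^sub>R (y - x) \<in> S" "x - e *\<^sub>R (y - x) \<in> S"
    using d(2) n by (auto simp: subset_iff dist_norm)
  then show thesis using that e by blast
qed

lemma in_open_segment_symmetric: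
  fixes x z :: "'a::euclidean_space"
  assumes "z \<noteq> 0"
  shows "x \<in> open_segment (x + z) (x - z)"
proof -
  have "(x + z) + (x - z) = 2 *\<^sub>R x"
    by (simp add: scaleR_2)
  then have "midpoint (x + z) (x - z) = x"
    by (simp add: midpoint_def)
  moreover have "x + z \<noteq> x - z"
  proof
    assume "x + z = x - z"
    then have "(x + z) - (x - z) = 0" by simp
    then have "z + z = 0" by simp
    then show False using assms by (simp flip: scaleR_2)
  qed
  ultimately show ?thesis
    using midpoint_in_open_segment[of "x + z" "x - z"] by simp
qed

text \<open>If the smallest face around \<open>x\<close> had dimension 2 or more, the hyperplane
  would cut its affine hull in at least a line, along which \<open>x\<close> could move both ways
  inside the slice.\<close>

lemma extreme_point_of_slice:
  fixes S :: "'a::euclidean_space set"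
  assumes S: "polytope S" and x: "x extreme_point_of (S \<inter> {y. c \<bullet> y = b})"
  obtains F where "F face_of S" "x \<in> rel_interior F" "aff_dim F \<le> 1"
proof -
  have xS: "x \<in> S" "c \<bullet> x = b" using x by (auto simp: extreme_point_of_def)
  obtain F where F: "F face_of S" "x \<in> rel_interior F"
    using polytope_point_in_rel_interior_face[OF S xS(1)] .
  have "aff_dim F \<le> 1"
  proof (rule ccontr)
    assume "\<not> aff_dim F \<le> 1"
    then have "aff_dim (affine hull F \<inter> {y. c \<bullet> y = b}) \<ge> 1"
      using F(2) rel_interior_subset xS(2) hull_subset[of F affine]
      by (subst aff_dim_affine_Int_hyperplane) auto
    then have "\<not> affine hull F \<inter> {y. c \<bullet> y = b} \<subseteq> {x}"
      using aff_dim_subset[of "affine hull F \<inter> {y. c \<bullet> y = b}" "{x}"] by auto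
    then obtain y where y: "y \<in> affine hull F" "c \<bullet> y = b" "y \<noteq> x" by blast
    obtain e where e: "e > 0" "x + e *\<^sub>R (y - x) \<in> F" "x - e *\<^sub>R (y - x) \<in> F"
      using rel_interior_both_directions[OF F(2) y(1)] .
    let ?p = "x + e *\<^sub>R (y - x)" and ?q = "x - e *\<^sub>R (y - x)"
    have "?p \<in> S \<inter> {y. c \<bullet> y = b}" "?q \<in> S \<inter> {y. c \<bullet> y = b}"
      using e F(1) face_of_imp_subset xS y by (auto simp: inner_add_right inner_diff_right)
    moreover have "x \<in> open_segment ?p ?q"
      by (rule in_open_segment_symmetric) (use e y in simp)
    ultimately show False using x unfolding extreme_point_of_def by blast
  qed
  then show thesis using that F by blast
qed

lemma polytope_eq_hull_vertices:
  fixes S :: "'a::euclidean_space set"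
  assumes "polytope S"
  shows "S = convex hull {x. x extreme_point_of S}"
  using Krein_Milman_Minkowski polytope_imp_compact polytope_imp_convex assms by blast

lemma polytope_vertex_greater:
  fixes S :: "'a::euclidean_space set"
  assumes S: "polytope S" and w: "w \<in> S" "r < a \<bullet> w"
  obtains u where "u extreme_point_of S" "r < a \<bullet> u"
proof -
  have "\<not> {v. v extreme_point_of S} \<subseteq> {x. a \<bullet> x \<le> r}"
  proof
    assume "{v. v extreme_point_of S} \<subseteq> {x. a \<bullet> x \<le> r}"
    then have "convex hull {v. v extreme_point_of S} \<subseteq> {x. a \<bullet> x \<le> r}"
      by (intro hull_minimal) (auto simp: convex_halfspace_le)
    then show False
      using polytope_eq_hull_vertices[OF S] w by auto
  qed
  then obtain u where "u extreme_point_of S" "\<not> a \<bullet> u \<le> r" by blast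
  then show thesis using that by simp
qed

lemma polytope_edge_segment:
  fixes S :: "'a::euclidean_space set"
  assumes S: "polytope S" and e: "e edge_of S"
  obtains u v where "u \<noteq> v" "e = closed_segment u v" "{x. x extreme_point_of S \<and> x \<in> e} = {u, v}"
proof -
  have f: "e face_of S" "aff_dim e = 1" using e by (auto simp: edge_of_def)
  have p: "polytope e" using f S face_of_polytope_polytope by blast
  have "e \<noteq> {}" using f by auto
  moreover have "collinear e" using f by (simp add: collinear_aff_dim)
  ultimately obtain u v where uv: "e = closed_segment u v"
    using compact_convex_collinear_segment polytope_imp_compact polytope_imp_convex p by metis
  have "u \<noteq> v" using uv f by auto
  moreover have "{x. x extreme_point_of S \<and> x \<in> e} = {u, v}"
    using extreme_point_of_face[OF f(1)] extreme_point_of_segment uv by auto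
  ultimately show thesis using that uv by blast
qed

text \<open>The step of the simplex method. A hyperplane separating \<open>v\<close> from the other
  vertices cuts \<open>S\<close> in the vertex figure at \<open>v\<close>, whose vertices lie on
  edges through \<open>v\<close>; one of them improves the objective, and so does the far end of its
  edge.\<close>

lemma polytope_improving_edge:
  fixes S :: "'a::euclidean_space set"
  assumes S: "polytope S" and v: "v extreme_point_of S" and w: "w \<in> S" "a \<bullet> v < a \<bullet> w"
  obtains e u where "e edge_of S" "v \<in> e" "u \<in> e" "u extreme_point_of S" "a \<bullet> v < a \<bullet> u"
proof -
  let ?V = "{v. v extreme_point_of S}"
  have fin: "finite ?V"
    using S finite_polyhedron_extreme_points polytope_imp_polyhedron by blast
  have SV: "S = convex hull ?V" using polytope_eq_hull_vertices[OF S] .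
  obtain w where w: "w extreme_point_of S" "a \<bullet> v < a \<bullet> w"
    using polytope_vertex_greater[OF S w] .
  have "convex hull (?V - {v}) \<subseteq> S - {v}"
  proof (rule hull_minimal)
    show "convex (S - {v})"
      using v extreme_point_of_stillconvex S polytope_imp_convex by blast
  qed (auto simp: extreme_point_of_def)
  then have "v \<notin> convex hull (?V - {v})" by blast
  moreover have "closed (convex hull (?V - {v}))"
    using fin by (simp add: finite_imp_compact_convex_hull compact_imp_closed)
  ultimately obtain c b where c: "c \<bullet> v < b" "\<And>x. x \<in> convex hull (?V - {v}) \<Longrightarrow> b < c \<bullet> x"
    using separating_hyperplane_closed_point[of "convex hull (?V - {v})" v] by auto
  have cV: "b < c \<bullet> x" if "x extreme_point_of S" "x \<noteq> v" for x
    using that c(2) hull_inc[of x "?V - {v}"] by auto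
  have "w \<noteq> v" using w by auto
  then have cw: "b < c \<bullet> w" using cV w by blast
  \<comment> \<open>Parameter at which the segment from \<open>v\<close> to \<open>w\<close> crosses
    the hyperplane. The crossing point \<open>q\<close> already beats \<open>v\<close>, so some
    vertex of the section does.\<close>
  define s where "s = (b - c \<bullet> v) / (c \<bullet> w - c \<bullet> v)"
  have s: "0 < s" "s < 1" using cw c by (auto simp: s_def divide_simps)
  define q where "q = v + s *\<^sub>R (w - v)"
  define Q where "Q = S \<inter> {x. c \<bullet> x = b}"
  have "q \<in> Q"
  proof -
    have "c \<bullet> q = b"
      using cw c(1) by (simp add: q_def s_def inner_add_right inner_diff_right divide_simps)
    moreover have "(1 - s) *\<^sub>R v + s *\<^sub>R w \<in> S"
      using S v w s polytope_imp_convex by (intro convexD_alt) (auto simp: extreme_point_of_def)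
    then have "q \<in> S" by (simp add: q_def algebra_simps)
    ultimately show ?thesis by (simp add: Q_def)
  qed
  moreover have "a \<bullet> v < a \<bullet> q"
    using w s by (simp add: q_def inner_add_right inner_diff_right)
  moreover have "polytope Q"
    unfolding Q_def using S by (intro polytope_Int_polyhedron polyhedron_hyperplane)
  ultimately obtain x where x: "x extreme_point_of Q" "a \<bullet> v < a \<bullet> x"
    using polytope_vertex_greater by metis
  obtain F where F: "F face_of S" "x \<in> rel_interior F" "aff_dim F \<le> 1"
    using extreme_point_of_slice[OF S] x(1) Q_def by metis
  have xF: "x \<in> F" using F rel_interior_subset by blast
  have xH: "c \<bullet> x = b" using x(1) by (auto simp: Q_def extreme_point_of_def)
  have pF: "polytope F" using F S face_of_polytope_polytope by blast
  have "aff_dim F \<noteq> 0"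
  proof
    assume "aff_dim F = 0"
    then have "F = {x}" using xF by (auto simp: aff_dim_eq_0)
    then have "x extreme_point_of S" using F face_of_singleton by blast
    then show False using cV xH c(1) by (metis less_irrefl)
  qed
  moreover have "aff_dim F \<ge> 0" using xF aff_dim_geq[of F] aff_dim_empty[of F]
    by (metis empty_iff aff_dim_negative_iff not_less)
  ultimately have "F edge_of S" using F by (simp add: edge_of_def)
  \<comment> \<open>Otherwise all vertices of \<open>F\<close> would lie strictly beyond the
    hyperplane, and \<open>F\<close> could not contain \<open>x\<close>.\<close>
  moreover have vF: "v \<in> F"
  proof (rule ccontr)
    assume "v \<notin> F"
    then have "b < c \<bullet> u" if "u extreme_point_of F" for u
      using that extreme_point_of_face[OF F(1)] cV by blast
    moreover obtain u where "u extreme_point_of F" "(- c) \<bullet> u \<ge> - b"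
    proof -
      have "\<not> {u. u extreme_point_of F} \<subseteq> {y. c \<bullet> y > b}"
      proof
        assume "{u. u extreme_point_of F} \<subseteq> {y. c \<bullet> y > b}"
        then have "convex hull {u. u extreme_point_of F} \<subseteq> {y. c \<bullet> y > b}"
          by (intro hull_minimal) (auto simp: convex_halfspace_gt)
        then show False using polytope_eq_hull_vertices[OF pF] xF xH by auto
      qed
      then obtain u where "u extreme_point_of F" "\<not> b < c \<bullet> u" by blast
      then show ?thesis using that by simp
    qed
    ultimately show False by force
  qed
  moreover obtain u where "u extreme_point_of F" "a \<bullet> v < a \<bullet> u"
    using polytope_vertex_greater[OF pF xF] x(2) by metis
  ultimately show thesis
    using that extreme_point_of_face[OF F(1)] by blast
qed

section \<open>Three-dimensional polytopes and Euler's inequality\<close>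

lemma double_count:
  assumes "finite A" "finite B"
  shows "(\<Sum>a\<in>A. card {b\<in>B. R a b}) = (\<Sum>b\<in>B. card {a\<in>A. R a b})"
  using assms by (intro sum_multicount_gen) auto

text \<open>Functionals with a tie between two points of \<open>V\<close> fill finitely many
  hyperplanes, a null set. The open set \<open>W\<close> is there to keep finitely many strict
  inequalities during the perturbation.\<close>

lemma generic_functional:
  fixes V :: "'a::euclidean_space set"
  assumes V: "finite V" and W: "open W" "a \<in> W"
  obtains a' where "a' \<in> W" "inj_on ((\<bullet>) a') V"
proof -
  let ?D = "{(v, w) \<in> V \<times> V. v \<noteq> w}"
  let ?N = "\<Union>p\<in>?D. {x. (fst p - snd p) \<bullet> x = 0}"
  have "finite ?D" using V by (auto intro: finite_subset[of _ "V \<times> V"])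
  then have "negligible ?N"
    by (intro negligible_Union) (auto intro!: negligible_hyperplane)
  moreover have "\<not> negligible W"
    using W open_not_negligible by blast
  ultimately have "\<not> W \<subseteq> ?N"
    using negligible_subset by blast
  then obtain a' where a': "a' \<in> W" "a' \<notin> ?N" by blast
  have "inj_on ((\<bullet>) a') V"
  proof (rule inj_onI, rule ccontr)
    fix v w assume vw: "v \<in> V" "w \<in> V" "a' \<bullet> v = a' \<bullet> w" "v \<noteq> w"
    then have "(v - w) \<bullet> a' = 0" by (simp add: inner_diff_left inner_diff_right inner_commute)
    then show False using a'(2) vw by auto
  qed
  then show thesis using that a' by blast
qed

locale polytope3 =
  fixes P :: "(real^3) set"
  assumes polytope_P: "polytope P" and interior_P: "interior P \<noteq> {}"
begin

definition "V = {v. v extreme_point_of P}"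
definition "E = {e. e edge_of P}"
definition "Fc = {F. F facet_of P}"
definition "fsize F = card {v \<in> V. v \<in> F}"
definition "deg v = card {e \<in> E. v \<in> e}"
definition "d v = card {F \<in> Fc. v \<in> F \<and> fsize F \<noteq> 3}"
definition "t v = card {F \<in> Fc. v \<in> F \<and> fsize F = 3}"

lemma polyhedron_P: "polyhedron P"
  using polytope_P polytope_imp_polyhedron by blast

lemma convex_P: "convex P"
  using polytope_P polytope_imp_convex by blast

lemma P_hull: "P = convex hull V"
  using polytope_eq_hull_vertices polytope_P unfolding V_def by blast

lemma aff_dim_P: "aff_dim P = 3"
  using aff_dim_nonempty_interior[OF interior_P] by simp

lemma finite_V: "finite V"
  unfolding V_def using finite_polyhedron_extreme_points polyhedron_P by blast

lemma finite_E: "finite E"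
  by (rule finite_subset[OF _ finite_polytope_faces[OF polytope_P]]) (auto simp: E_def edge_of_def)

lemma finite_Fc: "finite Fc"
  unfolding Fc_def using finite_polytope_facets polytope_P by blast

lemma V_subset_P: "v \<in> V \<Longrightarrow> v \<in> P"
  by (auto simp: V_def extreme_point_of_def)

lemma edge_vertices:
  assumes "e \<in> E"
  obtains u v where "u \<noteq> v" "e = closed_segment u v" "{x \<in> V. x \<in> e} = {u, v}"
  using polytope_edge_segment[OF polytope_P] assms unfolding E_def V_def by auto

lemma card_edge_vertices: "e \<in> E \<Longrightarrow> card {v \<in> V. v \<in> e} = 2"
  by (erule edge_vertices) simp

lemma other_vertex:
  assumes "e \<in> E" "v \<in> V" "v \<in> e"
  obtains u where "u \<in> V" "u \<in> e" "u \<noteq> v" "e = closed_segment v u" "{x \<in> V. x \<in> e} = {v, u}"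
proof -
  obtain a b where ab: "a \<noteq> b" "e = closed_segment a b" "{x \<in> V. x \<in> e} = {a, b}"
    using edge_vertices[OF assms(1)] .
  then have "v = a \<or> v = b" using assms by blast
  moreover have "a \<in> V" "a \<in> e" "b \<in> V" "b \<in> e" using ab(3) by blast+
  ultimately show thesis
    using that[of b] that[of a] ab by (metis closed_segment_commute insert_commute)
qed

lemma edge_face: "e \<in> E \<Longrightarrow> e face_of P" "e \<in> E \<Longrightarrow> aff_dim e = 1"
  by (auto simp: E_def edge_of_def)

lemma facet_face: "F \<in> Fc \<Longrightarrow> F face_of P" "F \<in> Fc \<Longrightarrow> aff_dim F = 2"
  by (auto simp: Fc_def facet_of_def aff_dim_P)

lemma edge_ne: "e \<in> E \<Longrightarrow> e \<noteq> {}"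
  using edge_face(2) by fastforce

lemma facet_ne: "F \<in> Fc \<Longrightarrow> F \<noteq> {}"
  using facet_face(2) by fastforce

lemma facet_polytope: "F \<in> Fc \<Longrightarrow> polytope F"
  using facet_face face_of_polytope_polytope polytope_P by blast

lemma card_facets_edge: "e \<in> E \<Longrightarrow> card {F \<in> Fc. e \<subseteq> F} = 2"
  unfolding Fc_def mem_Collect_eq
  by (rule card_facets_at_ridge) (auto simp: polyhedron_P edge_face aff_dim_P dest: edge_face(2))

lemma edges_of_facet:
  assumes "F \<in> Fc"
  shows "e \<in> E \<and> e \<subseteq> F \<longleftrightarrow> e facet_of F"
  using face_of_face[OF facet_face(1)[OF assms], of e] facet_face(2)[OF assms]
  by (auto simp: E_def edge_of_def facet_of_def)

lemma vertices_of_facet: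
  assumes "F \<in> Fc"
  shows "v \<in> V \<and> v \<in> F \<longleftrightarrow> v extreme_point_of F"
  using extreme_point_of_face[OF facet_face(1)[OF assms]] by (auto simp: V_def)

lemma card_edges_vertex_facet:
  assumes "F \<in> Fc" "v \<in> V" "v \<in> F"
  shows "card {e \<in> E. v \<in> e \<and> e \<subseteq> F} = 2"
proof -
  have "{e \<in> E. v \<in> e \<and> e \<subseteq> F} = {e. e facet_of F \<and> {v} \<subseteq> e}"
    using edges_of_facet[OF assms(1)] by auto
  moreover have "card {e. e facet_of F \<and> {v} \<subseteq> e} = 2"
  proof (rule card_facets_at_ridge)
    show "polyhedron F" using facet_polytope assms polytope_imp_polyhedron by blast
    show "{v} face_of F" using vertices_of_facet assms face_of_singleton by blast
  qed (use facet_face(2)[OF assms(1)] in auto)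
  ultimately show ?thesis by simp
qed

text \<open>Incident pairs of an edge and a facet at \<open>v\<close> are counted twice: each edge
  lies in two facets, and each facet has two edges at \<open>v\<close>.\<close>

lemma deg_facets:
  assumes "v \<in> V"
  shows "deg v = card {F \<in> Fc. v \<in> F}"
proof -
  let ?A = "{e \<in> E. v \<in> e}" and ?B = "{F \<in> Fc. v \<in> F}"
  have "(\<Sum>e\<in>?A. card {F \<in> ?B. e \<subseteq> F}) = (\<Sum>F\<in>?B. card {e \<in> ?A. e \<subseteq> F})"
    using finite_E finite_Fc by (intro double_count) auto
  moreover have "card {F \<in> ?B. e \<subseteq> F} = 2" if "e \<in> ?A" for e
  proof -
    have "{F \<in> ?B. e \<subseteq> F} = {F \<in> Fc. e \<subseteq> F}" using that by auto
    then show ?thesis using card_facets_edge that by auto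
  qed
  moreover have "card {e \<in> ?A. e \<subseteq> F} = 2" if "F \<in> ?B" for F
    using card_edges_vertex_facet[of F v] that assms by (simp add: conj_assoc)
  ultimately show ?thesis by (simp add: deg_def)
qed

lemma fsize_edges:
  assumes "F \<in> Fc"
  shows "fsize F = card {e \<in> E. e \<subseteq> F}"
proof -
  let ?A = "{v \<in> V. v \<in> F}" and ?B = "{e \<in> E. e \<subseteq> F}"
  have "(\<Sum>v\<in>?A. card {e \<in> ?B. v \<in> e}) = (\<Sum>e\<in>?B. card {v \<in> ?A. v \<in> e})"
    using finite_E finite_V by (intro double_count) auto
  moreover have "card {e \<in> ?B. v \<in> e} = 2" if "v \<in> ?A" for v
  proof -
    have "{e \<in> ?B. v \<in> e} = {e \<in> E. v \<in> e \<and> e \<subseteq> F}" by auto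
    then show ?thesis using card_edges_vertex_facet[OF assms] that by auto
  qed
  moreover have "card {v \<in> ?A. v \<in> e} = 2" if "e \<in> ?B" for e
  proof -
    have "{v \<in> ?A. v \<in> e} = {v \<in> V. v \<in> e}" using that by auto
    then show ?thesis using card_edge_vertices that by auto
  qed
  ultimately show ?thesis by (simp add: fsize_def)
qed

lemma fsize_ge3:
  assumes "F \<in> Fc"
  shows "fsize F \<ge> 3"
proof -
  have eq: "F = convex hull {v \<in> V. v \<in> F}"
    using polytope_eq_hull_vertices[OF facet_polytope[OF assms]] vertices_of_facet[OF assms] by simp
  have "aff_dim F = aff_dim {v \<in> V. v \<in> F}"
    using eq aff_dim_convex_hull by metis
  also have "\<dots> \<le> int (card {v \<in> V. v \<in> F}) - 1"
    using finite_V by (intro aff_dim_le_card) auto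
  finally show ?thesis using facet_face(2)[OF assms] by (simp add: fsize_def)
qed

lemma improving_edge:
  assumes "v \<in> V" "w \<in> P" "a \<bullet> v < a \<bullet> w"
  obtains e u where "e \<in> E" "v \<in> e" "u \<in> e" "u \<in> V" "a \<bullet> v < a \<bullet> u"
  using polytope_improving_edge[OF polytope_P, of v w a] assms unfolding E_def V_def by auto

lemma not_constant_on_P:
  assumes "a \<noteq> 0"
  shows "\<exists>x\<in>P. a \<bullet> x \<noteq> r"
proof (rule ccontr)
  assume "\<not> ?thesis"
  then have "P \<subseteq> {x. a \<bullet> x = r}" by auto
  then have "aff_dim P \<le> aff_dim {x. a \<bullet> x = r}" by (rule aff_dim_subset)
  then show False using aff_dim_hyperplane[OF assms, of r] aff_dim_P by simp
qed

lemma exists_functional_constant: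
  fixes u v w :: "real^3"
  obtains a where "a \<noteq> 0" "a \<bullet> u = a \<bullet> w" "a \<bullet> v = a \<bullet> w"
proof -
  obtain a where "a \<noteq> 0" "a \<bullet> (u - w) = 0" "a \<bullet> (v - w) = 0"
    using exists_nonzero_orthogonal_pair .
  then show thesis using that by (simp add: inner_diff_right)
qed

text \<open>With at most two edges at \<open>v\<close>, some nonzero functional is constant on
  \<open>v\<close> and its neighbours. Neither it nor its negative can be improved along an edge, so
  \<open>v\<close> would be both a maximum and a minimum on \<open>P\<close>.\<close>

lemma deg_ge3:
  assumes v: "v \<in> V"
  shows "deg v \<ge> 3"
proof (rule ccontr)
  assume "\<not> deg v \<ge> 3"
  moreover have fin: "finite {e \<in> E. v \<in> e}" using finite_E by simp
  ultimately have "card {e \<in> E. v \<in> e} \<le> 2" by (simp add: deg_def)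
  then obtain e1 e2 where e12: "{e \<in> E. v \<in> e} \<subseteq> {e1, e2}"
  proof -
    consider "card {e \<in> E. v \<in> e} = 0" | "card {e \<in> E. v \<in> e} = 1" | "card {e \<in> E. v \<in> e} = 2"
      using \<open>card {e \<in> E. v \<in> e} \<le> 2\<close> by linarith
    then show thesis
      by cases (use that fin in \<open>auto simp: card_1_singleton_iff card_2_iff\<close>)
  qed
  define f where "f e = (SOME u. u \<in> V \<and> u \<in> e \<and> u \<noteq> v)" for e
  have f: "{x \<in> V. x \<in> e} = {v, f e}" if e: "e \<in> E" "v \<in> e" for e
  proof -
    obtain u where u: "u \<in> V" "u \<in> e" "u \<noteq> v" "{x \<in> V. x \<in> e} = {v, u}"
      by (rule other_vertex[OF e(1) v e(2)]) (use that in blast)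
    then have "f e \<in> V \<and> f e \<in> e \<and> f e \<noteq> v"
      unfolding f_def by (intro someI[where P = "\<lambda>u. u \<in> V \<and> u \<in> e \<and> u \<noteq> v"]) blast
    then show ?thesis using u(4) by blast
  qed
  obtain a where a: "a \<noteq> 0" "a \<bullet> f e1 = a \<bullet> v" "a \<bullet> f e2 = a \<bullet> v"
    using exists_functional_constant .
  have N: "a \<bullet> u = a \<bullet> v" if "e \<in> E" "v \<in> e" "u \<in> V" "u \<in> e" for e u
    using f[OF that(1,2)] that e12 a by auto
  obtain x where x: "x \<in> P" "a \<bullet> x \<noteq> a \<bullet> v"
    using not_constant_on_P[OF a(1)] by blast
  then consider "a \<bullet> v < a \<bullet> x" | "(- a) \<bullet> v < (- a) \<bullet> x" by force
  then show False
  proof cases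
    case 1
    then show False using improving_edge[OF v x(1) 1] N by (metis less_irrefl)
  next
    case 2
    then show False using improving_edge[OF v x(1) 2] N by (metis inner_minus_left less_irrefl)
  qed
qed

section \<open>The sweep of the polytope by a generic linear functional\<close>

definition "peak a X v \<longleftrightarrow> v \<in> X \<and> (\<forall>x\<in>X. a \<bullet> x \<le> a \<bullet> v)"

lemma exists_top:
  assumes X: "X face_of P" "X \<noteq> {}"
  obtains v where "v \<in> V" "peak a X v"
proof -
  have pX: "polytope X" using X face_of_polytope_polytope polytope_P by blast
  let ?K = "{v. v extreme_point_of X}"
  have K: "?K = {v \<in> V. v \<in> X}" using extreme_point_of_face[OF X(1)] by (auto simp: V_def)
  have "?K \<noteq> {}" using polytope_eq_hull_vertices[OF pX] X by force
  moreover have "finite ?K" using finite_V K by simp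
  ultimately have "Max ((\<bullet>) a ` ?K) \<in> (\<bullet>) a ` ?K" by (intro Max_in) auto
  then obtain v where "v \<in> ?K" "Max ((\<bullet>) a ` ?K) = a \<bullet> v" by blast
  then have v: "v \<in> ?K" "\<And>u. u \<in> ?K \<Longrightarrow> a \<bullet> u \<le> a \<bullet> v"
    using \<open>finite ?K\<close> Max_ge[of "(\<bullet>) a ` ?K"] by force+
  have "convex hull ?K \<subseteq> {x. a \<bullet> x \<le> a \<bullet> v}"
    using v by (intro hull_minimal) (auto simp: convex_halfspace_le)
  then have "peak a X v"
    using polytope_eq_hull_vertices[OF pX] v K by (auto simp: peak_def)
  then show thesis using that v K by blast
qed

text \<open>Genericity forbids ties between vertices. This is what allows every edge and every facet
  to be charged to exactly one vertex.\<close>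

lemma card_top:
  assumes X: "X face_of P" "X \<noteq> {}" and a: "inj_on ((\<bullet>) a) V"
  shows "card {v \<in> V. peak a X v} = 1"
proof -
  obtain v where v: "v \<in> V" "peak a X v" using exists_top[OF X] .
  have "u = v" if "u \<in> V" "peak a X u" for u
  proof -
    have "a \<bullet> u \<le> a \<bullet> v" "a \<bullet> v \<le> a \<bullet> u" using that v unfolding peak_def by blast+
    then have "a \<bullet> u = a \<bullet> v" by linarith
    then show ?thesis using inj_onD[OF a, of u v] that v by simp
  qed
  then have "{v \<in> V. peak a X v} = {v}" using v by blast
  then show ?thesis by simp
qed

lemma facets_edge_at:
  assumes "e \<in> E" "v \<in> e"
  shows "card {F \<in> Fc. v \<in> F \<and> e \<subseteq> F} = 2"
proof -
  have "{F \<in> Fc. v \<in> F \<and> e \<subseteq> F} = {F \<in> Fc. e \<subseteq> F}" using assms by auto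
  then show ?thesis using card_facets_edge assms by simp
qed

text \<open>A local maximum on a convex polygon is a global one, by the improving edge inside the
  facet; so it suffices that both edges of \<open>F\<close> at \<open>v\<close> fall away from
  \<open>v\<close>.\<close>

lemma peak_facet_iff:
  assumes F: "F \<in> Fc" "v \<in> V" "v \<in> F"
  shows "peak a F v \<longleftrightarrow> card {e \<in> E. v \<in> e \<and> e \<subseteq> F \<and> peak a e v} = 2"
proof -
  let ?A = "{e \<in> E. v \<in> e \<and> e \<subseteq> F}" and ?B = "{e \<in> E. v \<in> e \<and> e \<subseteq> F \<and> peak a e v}"
  have fin: "finite ?A" using finite_E by simp
  have BA: "?B \<subseteq> ?A" by auto
  have "card ?B = 2 \<longleftrightarrow> ?B = ?A"
    using card_subset_eq[OF fin BA] card_edges_vertex_facet[OF F] by auto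
  also have "\<dots> \<longleftrightarrow> peak a F v"
  proof
    assume eq: "?B = ?A"
    show "peak a F v"
    proof (rule ccontr)
      assume "\<not> peak a F v"
      then obtain w where w: "w \<in> F" "a \<bullet> v < a \<bullet> w"
        using F by (auto simp: peak_def not_le)
      have "v extreme_point_of F" using vertices_of_facet F by blast
      then obtain e u where e: "e edge_of F" "v \<in> e" "u \<in> e" "a \<bullet> v < a \<bullet> u"
        using polytope_improving_edge[OF facet_polytope[OF F(1)] _ w] by metis
      then have "e facet_of F" using facet_face(2)[OF F(1)] by (auto simp: edge_of_def facet_of_def)
      then have "e \<in> ?A" using edges_of_facet[OF F(1)] e by auto
      then have "peak a e v" using eq by blast
      then show False using e by (auto simp: peak_def)
    qed
  next
    assume "peak a F v"
    then show "?B = ?A" by (auto simp: peak_def)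
  qed
  finally show ?thesis by simp
qed

text \<open>The facets whose two edges at \<open>v\<close> go one up and one down, so that the level
  plane of \<open>v\<close> runs through them.\<close>

definition "mixed a v = {F \<in> Fc. v \<in> F \<and> card {e \<in> E. v \<in> e \<and> e \<subseteq> F \<and> peak a e v} = 1}"

text \<open>Double count of the edges with top \<open>v\<close> against the facets at
  \<open>v\<close>: such an edge lies in two facets, and a facet contains two such edges if
  \<open>v\<close> is its top, one if it is mixed, none otherwise. Hence \<open>v\<close>
  contributes \<open>2 - card (mixed a v)\<close> to twice the Euler characteristic.\<close>

lemma card_peaks_vertex:
  assumes v: "v \<in> V"
  shows "2 * card {e \<in> E. peak a e v} = 2 * card {F \<in> Fc. peak a F v} + card (mixed a v)"
proof -
  let ?A = "{e \<in> E. peak a e v}" and ?B = "{F \<in> Fc. v \<in> F}"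
  have pv: "v \<in> X" if "peak a X v" for X using that by (simp add: peak_def)
  have "(\<Sum>e\<in>?A. card {F \<in> ?B. e \<subseteq> F}) = (\<Sum>F\<in>?B. card {e \<in> ?A. e \<subseteq> F})"
    using finite_E finite_Fc by (intro double_count) auto
  moreover have "card {F \<in> ?B. e \<subseteq> F} = 2" if "e \<in> ?A" for e
    using facets_edge_at[of e v] that pv by (simp add: conj_assoc)
  moreover have "card {e \<in> ?A. e \<subseteq> F} = 2 * of_bool (peak a F v) + of_bool (F \<in> mixed a v)" if "F \<in> ?B" for F
  proof -
    let ?C = "{e \<in> E. v \<in> e \<and> e \<subseteq> F \<and> peak a e v}"
    have eq: "{e \<in> ?A. e \<subseteq> F} = ?C" using pv by auto
    have "card ?C \<le> card {e \<in> E. v \<in> e \<and> e \<subseteq> F}"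
      using finite_E by (intro card_mono) auto
    then have "card ?C \<le> 2" using card_edges_vertex_facet that v by auto
    moreover have "peak a F v \<longleftrightarrow> card ?C = 2" using peak_facet_iff that v by auto
    moreover have "F \<in> mixed a v \<longleftrightarrow> card ?C = 1" using that by (simp add: mixed_def)
    ultimately show ?thesis unfolding eq by (auto simp: of_bool_def)
  qed
  ultimately have "2 * card ?A = (\<Sum>F\<in>?B. 2 * of_bool (peak a F v) + of_bool (F \<in> mixed a v))"
    by simp
  also have "\<dots> = 2 * card (?B \<inter> {F. peak a F v}) + card (?B \<inter> mixed a v)"
    using finite_Fc by (simp add: sum.distrib flip: sum_distrib_left)
  also have "?B \<inter> {F. peak a F v} = {F \<in> Fc. peak a F v}" using pv by auto
  also have "?B \<inter> mixed a v = mixed a v" by (auto simp: mixed_def)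
  finally show ?thesis .
qed

lemma mixed_peak: "peak a P v \<Longrightarrow> v \<in> V \<Longrightarrow> mixed a v = {}"
proof -
  assume v: "peak a P v" "v \<in> V"
  have "card {e \<in> E. v \<in> e \<and> e \<subseteq> F \<and> peak a e v} = 2" if "F \<in> Fc" "v \<in> F" for F
  proof -
    have "F \<subseteq> P" using facet_face that face_of_imp_subset by blast
    then have "peak a F v" using v that by (auto simp: peak_def)
    then show ?thesis using peak_facet_iff that v by blast
  qed
  then show ?thesis by (auto simp: mixed_def)
qed

lemma mixed_bottom:
  assumes "peak (- a) P v" "v \<in> V" and a: "inj_on ((\<bullet>) a) V"
  shows "mixed a v = {}"
proof -
  have False if e: "e \<in> E" "v \<in> e" "peak a e v" for e
  proof -
    obtain u where u: "u \<in> V" "u \<in> e" "u \<noteq> v"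
      by (rule other_vertex[OF e(1) assms(2) e(2)]) (use that in blast)
    then have "a \<bullet> u \<le> a \<bullet> v" "a \<bullet> v \<le> a \<bullet> u"
      using that assms V_subset_P by (auto simp: peak_def)
    then show False using a u assms by (auto simp: inj_on_def)
  qed
  then have "{e \<in> E. v \<in> e \<and> e \<subseteq> F \<and> peak a e v} = {}" for F by blast
  then have "card {e \<in> E. v \<in> e \<and> e \<subseteq> F \<and> peak a e v} \<noteq> 1" for F
    by (metis card.empty zero_neq_one)
  then show ?thesis unfolding mixed_def by blast
qed

text \<open>The facets at \<open>v\<close> that are crossed by the horizontal plane through \<open>v\<close> meet this plane
  in the two edges at \<open>v\<close> of the polygon in which the plane cuts the polytope.\<close>

lemma card_mixed_le2:
  assumes v: "v \<in> V" and a: "inj_on ((\<bullet>) a) V" and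
    nt: "\<not> peak a P v" "\<not> peak (- a) P v"
  shows "card (mixed a v) \<le> 2"
proof -
  let ?H = "{x. a \<bullet> x = a \<bullet> v}"
  let ?Q = "P \<inter> ?H"
  have vP: "v \<in> P" using v V_subset_P by blast
  obtain x1 where x1: "x1 \<in> P" "a \<bullet> v < a \<bullet> x1" using nt vP by (auto simp: peak_def not_le)
  obtain x2 where x2: "x2 \<in> P" "a \<bullet> x2 < a \<bullet> v" using nt vP by (auto simp: peak_def not_le)
  have a0: "a \<noteq> 0" using x1 by auto
  have cross: "\<exists>x\<in>open_segment p q. a \<bullet> x = a \<bullet> v"
    if pq: "a \<bullet> p < a \<bullet> v" "a \<bullet> v < a \<bullet> q" for p q
  proof -
    define s where "s = (a \<bullet> v - a \<bullet> p) / (a \<bullet> q - a \<bullet> p)"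
    have s: "0 < s" "s < 1" using pq by (auto simp: s_def divide_simps)
    have "s * (a \<bullet> q - a \<bullet> p) = a \<bullet> v - a \<bullet> p" using pq by (simp add: s_def)
    then have "a \<bullet> ((1 - s) *\<^sub>R p + s *\<^sub>R q) = a \<bullet> v"
      by (simp add: inner_add_right algebra_simps)
    have "p \<noteq> q" using pq by auto
    then have "(1 - s) *\<^sub>R p + s *\<^sub>R q \<in> open_segment p q" using s in_segment(2) by blast
    then show ?thesis using \<open>a \<bullet> ((1 - s) *\<^sub>R p + s *\<^sub>R q) = a \<bullet> v\<close> by blast
  qed
  obtain z where z: "z \<in> interior P" using interior_P by blast
  \<comment> \<open>An interior point at the height of \<open>v\<close> makes the section
    two-dimensional. Unless \<open>z\<close> has this height, one is found between \<open>z\<close>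
    and a point of \<open>P\<close> on the other side.\<close>
  have "\<exists>y\<in>interior P. a \<bullet> y = a \<bullet> v"
  proof -
    have seg: "open_segment z x \<subseteq> interior P" if "x \<in> P" for x
      using in_interior_closure_convex_segment[OF convex_P z] that closure_subset by blast
    consider "a \<bullet> z = a \<bullet> v" | "a \<bullet> z < a \<bullet> v" | "a \<bullet> v < a \<bullet> z" by linarith
    then show ?thesis
    proof cases
      case 1 then show ?thesis using z by blast
    next
      case 2 then show ?thesis using cross[of z x1] x1 seg[of x1] by blast
    next
      case 3 then show ?thesis using cross[of x2 z] x2 seg[of x2] by (metis open_segment_commute subsetD)
    qed
  qed
  then have ne: "?H \<inter> interior P \<noteq> {}" by blast
  have "aff_dim (?H \<inter> interior P) = aff_dim ?H"
    using ne by (intro aff_dim_convex_Int_open) (auto simp: convex_hyperplane)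
  then have "2 \<le> aff_dim ?Q"
    using aff_dim_hyperplane[OF a0, of "a \<bullet> v"] aff_dim_subset[of "?H \<inter> interior P" ?Q] interior_subset[of P] by auto
  moreover have "aff_dim ?Q \<le> 2"
    using aff_dim_hyperplane[OF a0, of "a \<bullet> v"] aff_dim_subset[of ?Q ?H] by auto
  ultimately have dQ: "aff_dim ?Q = 2" by simp
  have pQ: "polyhedron ?Q" using polyhedron_P polyhedron_hyperplane by (intro polyhedron_Int)
  have "v extreme_point_of ?Q"
    using v by (auto simp: V_def extreme_point_of_def)
  then have two: "card {G. G facet_of ?Q \<and> {v} \<subseteq> G} = 2"
    by (intro card_facets_at_ridge[OF pQ]) (auto simp: face_of_singleton dQ)
  have K: "\<exists>x\<in>F. a \<bullet> x = a \<bullet> v \<and> x \<noteq> v" "F \<inter> ?H facet_of ?Q" if F: "F \<in> mixed a v" for F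
  proof -
    have F': "F \<in> Fc" "v \<in> F" using F by (auto simp: mixed_def)
    let ?C = "{e \<in> E. v \<in> e \<and> e \<subseteq> F \<and> peak a e v}" and ?D = "{e \<in> E. v \<in> e \<and> e \<subseteq> F}"
    have C: "card ?C = 1" using F by (simp add: mixed_def)
    have D: "card ?D = 2" using card_edges_vertex_facet F' v by blast
    have "?C \<noteq> {}" by (rule notI) (use C in \<open>simp only: card.empty\<close>)
    moreover have "?C \<noteq> ?D" by (rule notI) (use C D in \<open>simp only:\<close>)
    ultimately obtain e1 e2 where e1: "e1 \<in> E" "v \<in> e1" "e1 \<subseteq> F" "peak a e1 v"
      and e2: "e2 \<in> E" "v \<in> e2" "e2 \<subseteq> F" "\<not> peak a e2 v" by blast
    obtain u1 where u1: "u1 \<in> V" "u1 \<in> e1" "u1 \<noteq> v"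
      by (rule other_vertex[OF e1(1) v e1(2)]) (use that in blast)
    have l1: "a \<bullet> u1 < a \<bullet> v" using e1 u1 a v by (force simp: peak_def inj_on_def)
    obtain u2 where u2: "u2 \<in> e2" "a \<bullet> v < a \<bullet> u2" using e2 by (auto simp: peak_def not_le)
    obtain x where x: "x \<in> open_segment u1 u2" "a \<bullet> x = a \<bullet> v" using cross[OF l1 u2(2)] by blast
    have u12: "u1 \<in> F" "u2 \<in> F" using u1 u2 e1 e2 by auto
    have cF: "F face_of P" using facet_face F' by blast
    have FP: "F \<subseteq> P" using cF face_of_imp_subset by blast
    have xF: "x \<in> F"
      using u12 x open_closed_segment closed_segment_subset face_of_imp_convex[OF cF] by blast
    have xv: "x \<noteq> v"
      using v x(1) u12 FP by (auto simp: V_def extreme_point_of_def)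
    show "\<exists>x\<in>F. a \<bullet> x = a \<bullet> v \<and> x \<noteq> v" using xF x xv by blast
    have "aff_dim {v, x} \<le> aff_dim (F \<inter> ?H)"
      using xF x F' by (intro aff_dim_subset) auto
    then have "1 \<le> aff_dim (F \<inter> ?H)" using xv by (simp add: aff_dim_2)
    moreover have "aff_dim (F \<inter> ?H) \<le> 1"
    proof -
      have "aff_dim (affine hull F \<inter> ?H) = aff_dim F - 1"
      proof -
        have "\<not> affine hull F \<subseteq> ?H" using u12 l1 hull_inc[of u1 F affine] by auto
        moreover have "affine hull F \<inter> ?H \<noteq> {}" using F' hull_inc[of v F affine] by auto
        ultimately show ?thesis by (subst aff_dim_affine_Int_hyperplane) auto
      qed
      moreover have "aff_dim (F \<inter> ?H) \<le> aff_dim (affine hull F \<inter> ?H)"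
        using hull_subset[of F affine] by (intro aff_dim_subset) auto
      ultimately show ?thesis using facet_face F' by simp
    qed
    moreover have "F \<inter> ?H face_of ?Q" using cF by (intro face_of_slice convex_hyperplane)
    ultimately show "F \<inter> ?H facet_of ?Q" using dQ F' by (auto simp: facet_of_def)
  qed
  \<comment> \<open>Two mixed facets with the same trace would share \<open>v\<close> and
    \<open>x\<close>, hence an edge of \<open>P\<close> that is level; its other end would tie with
    \<open>v\<close>.\<close>
  have "inj_on (\<lambda>F. F \<inter> ?H) (mixed a v)"
  proof (rule inj_onI, rule ccontr)
    fix F G assume FG: "F \<in> mixed a v" "G \<in> mixed a v" "F \<inter> ?H = G \<inter> ?H" "F \<noteq> G"
    obtain x where x: "x \<in> F" "a \<bullet> x = a \<bullet> v" "x \<noteq> v" using K(1) FG by blast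
    have xG: "x \<in> G" using x FG by blast
    have FG': "F \<in> Fc" "v \<in> F" "G \<in> Fc" "v \<in> G" using FG by (auto simp: mixed_def)
    have f: "F \<inter> G face_of P" using FG' facet_face face_of_Int by blast
    have "F \<inter> G \<noteq> F" using FG' FG facet_of_subset_eq[of F P G] unfolding Fc_def by blast
    moreover have "F \<inter> G face_of F"
      using f facet_face FG' face_of_face by blast
    moreover have "convex F" using FG' facet_face face_of_imp_convex by blast
    ultimately have "aff_dim (F \<inter> G) < 2" using face_of_aff_dim_lt facet_face(2) FG' by metis
    moreover have "aff_dim {v, x} \<le> aff_dim (F \<inter> G)" using x xG FG' by (intro aff_dim_subset) auto
    ultimately have "aff_dim (F \<inter> G) = 1" using x by (simp add: aff_dim_2)
    then have e: "F \<inter> G \<in> E" using f by (simp add: E_def edge_of_def)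
    obtain u where u: "u \<in> V" "u \<noteq> v" "F \<inter> G = closed_segment v u"
      by (rule other_vertex[OF e v]) (use that FG' in blast)+
    then have "x \<in> closed_segment v u" using x xG by blast
    then obtain s where s: "x = (1 - s) *\<^sub>R v + s *\<^sub>R u" by (auto simp: in_segment)
    have "s \<noteq> 0" using s x by auto
    moreover have "s * (a \<bullet> u - a \<bullet> v) = 0"
      using x(2) s by (simp add: inner_add_right algebra_simps)
    ultimately have "a \<bullet> u = a \<bullet> v" by simp
    then show False using a u v by (auto simp: inj_on_def)
  qed
  moreover have "(\<lambda>F. F \<inter> ?H) ` mixed a v \<subseteq> {G. G facet_of ?Q \<and> {v} \<subseteq> G}"
    using K(2) by (auto simp: mixed_def)
  moreover have "finite {G. G facet_of ?Q \<and> {v} \<subseteq> G}"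
    by (rule card_ge_0_finite) (simp only: two zero_less_numeral)
  ultimately have "card (mixed a v) \<le> card {G. G facet_of ?Q \<and> {v} \<subseteq> G}"
    by (rule card_inj_on_le)
  then show ?thesis unfolding two .
qed

text \<open>Summing the contributions of \<open>card_peaks_vertex\<close>: the top and the bottom
  vertex have no mixed facets and give 2 each, every other vertex gives at least 0.\<close>

lemma euler_inequality: "int (card V) - int (card E) + int (card Fc) \<ge> 2"
proof -
  obtain a where a: "inj_on ((\<bullet>) a) V"
    using generic_functional[OF finite_V open_UNIV UNIV_I] by metis
  have Pne: "P face_of P" "P \<noteq> {}" using convex_P face_of_refl interior_P interior_subset by blast+
  obtain M where M: "M \<in> V" "peak a P M" using exists_top[OF Pne] .
  obtain m where m: "m \<in> V" "peak (- a) P m" using exists_top[OF Pne] .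
  have "M \<noteq> m"
  proof
    assume "M = m"
    then have "a \<bullet> x = a \<bullet> m" if "x \<in> P" for x
      using M m that by (auto simp: peak_def intro!: antisym)
    moreover have "a \<noteq> 0"
    proof
      assume "a = 0"
      then have "V = {m}" using a m by (auto simp: inj_on_def)
      then have "P = {m}" using P_hull by simp
      then show False using aff_dim_P by simp
    qed
    ultimately show False using not_constant_on_P by blast
  qed
  have E: "card E = (\<Sum>v\<in>V. card {e \<in> E. peak a e v})"
  proof -
    have "(\<Sum>v\<in>V. card {e \<in> E. peak a e v}) = (\<Sum>e\<in>E. card {v \<in> V. peak a e v})"
      by (rule double_count[OF finite_V finite_E])
    also have "\<dots> = (\<Sum>e\<in>E. 1)"
      using edge_face(1) edge_ne by (intro sum.cong refl card_top a) blast+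
    finally show ?thesis by simp
  qed
  have F: "card Fc = (\<Sum>v\<in>V. card {F \<in> Fc. peak a F v})"
  proof -
    have "(\<Sum>v\<in>V. card {F \<in> Fc. peak a F v}) = (\<Sum>F\<in>Fc. card {v \<in> V. peak a F v})"
      by (rule double_count[OF finite_V finite_Fc])
    also have "\<dots> = (\<Sum>F\<in>Fc. 1)"
      using facet_face(1) facet_ne by (intro sum.cong refl card_top a) blast+
    finally show ?thesis by simp
  qed
  let ?g = "\<lambda>v. 2 - int (card (mixed a v))"
  have "2 * (int (card V) - int (card E) + int (card Fc)) = (\<Sum>v\<in>V. ?g v)"
  proof -
    have "2 * (1 - int (card {e \<in> E. peak a e v}) + int (card {F \<in> Fc. peak a F v})) = ?g v" if "v \<in> V" for v
      using arg_cong[OF card_peaks_vertex[OF that, of a], of int] by simp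
    then have "(\<Sum>v\<in>V. ?g v) = (\<Sum>v\<in>V. 2 * (1 - int (card {e \<in> E. peak a e v}) + int (card {F \<in> Fc. peak a F v})))"
      by (intro sum.cong) auto
    also have "\<dots> = 2 * (int (card V) - int (card E) + int (card Fc))"
      unfolding E F by (simp add: sum.distrib sum_subtractf flip: sum_distrib_left)
    finally show ?thesis by simp
  qed
  moreover have "(\<Sum>v\<in>V. ?g v) \<ge> (\<Sum>v\<in>{M, m}. ?g v)"
  proof (rule sum_mono2)
    show "0 \<le> ?g v" if v: "v \<in> V - {M, m}" for v
    proof -
      have *: "peak b P v \<Longrightarrow> peak b P w \<Longrightarrow> w \<in> V \<Longrightarrow> b = a \<or> b = - a \<Longrightarrow> v = w" for b w
      proof -
        assume "peak b P v" "peak b P w" "w \<in> V" "b = a \<or> b = - a"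
        then have "b \<bullet> v \<le> b \<bullet> w" "b \<bullet> w \<le> b \<bullet> v" unfolding peak_def by blast+
        then have "a \<bullet> v = a \<bullet> w" using \<open>b = a \<or> b = - a\<close> by auto
        then show "v = w" using inj_onD[OF a, of v w] v \<open>w \<in> V\<close> by simp
      qed
      have "\<not> peak a P v" "\<not> peak (- a) P v"
        using *[of a M] *[of "- a" m] M m v by blast+
      then show ?thesis using card_mixed_le2[of v a] v a by simp
    qed
  qed (use finite_V M m in auto)
  moreover have "(\<Sum>v\<in>{M, m}. ?g v) = 4"
    using \<open>M \<noteq> m\<close> mixed_peak[of a M] mixed_bottom[of a m] M m a by simp
  ultimately have "4 \<le> 2 * (int (card V) - int (card E) + int (card Fc))"
    by metis
  then show ?thesis by simp
qed

end

section \<open>Counting rigid vertices\<close>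

context polytope3 begin

definition "R = {v \<in> V. d v \<le> 3}"

lemma finite_R: "finite R" and R_V: "R \<subseteq> V"
  using finite_V by (auto simp: R_def)

lemma deg_d_t: "v \<in> V \<Longrightarrow> deg v = d v + t v"
proof -
  assume "v \<in> V"
  have "{F \<in> Fc. v \<in> F} = {F \<in> Fc. v \<in> F \<and> fsize F \<noteq> 3} \<union> {F \<in> Fc. v \<in> F \<and> fsize F = 3}" by auto
  then show ?thesis
    unfolding deg_facets[OF \<open>v \<in> V\<close>] d_def t_def using finite_Fc by (simp add: card_Un_disjoint disjoint_iff)
qed

lemma sum_d: "(\<Sum>v\<in>V. d v) = (\<Sum>F | F \<in> Fc \<and> fsize F \<noteq> 3. fsize F)"
proof -
  have "(\<Sum>v\<in>V. card {F \<in> {F \<in> Fc. fsize F \<noteq> 3}. v \<in> F}) = (\<Sum>F\<in>{F \<in> Fc. fsize F \<noteq> 3}. card {v \<in> V. v \<in> F})"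
    using finite_V finite_Fc by (intro double_count) auto
  then show ?thesis by (simp add: d_def fsize_def conj_commute conj_left_commute cong: conj_cong)
qed

lemma sum_t: "(\<Sum>v\<in>V. t v) = 3 * card {F \<in> Fc. fsize F = 3}"
proof -
  have "(\<Sum>v\<in>V. card {F \<in> {F \<in> Fc. fsize F = 3}. v \<in> F}) = (\<Sum>F\<in>{F \<in> Fc. fsize F = 3}. card {v \<in> V. v \<in> F})"
    using finite_V finite_Fc by (intro double_count) auto
  also have "\<dots> = (\<Sum>F\<in>{F \<in> Fc. fsize F = 3}. 3)"
    by (rule sum.cong) (auto simp: fsize_def)
  finally show ?thesis by (simp add: t_def conj_commute conj_left_commute)
qed

lemma sum_fsize: "(\<Sum>F\<in>Fc. fsize F) = 2 * card E"
proof -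
  have "(\<Sum>e\<in>E. card {F \<in> Fc. e \<subseteq> F}) = (\<Sum>F\<in>Fc. card {e \<in> E. e \<subseteq> F})"
    by (rule double_count[OF finite_E finite_Fc])
  then show ?thesis using fsize_edges card_facets_edge by simp
qed

text \<open>This is 12 times Euler's inequality with the edges eliminated by
  \<open>sum_fsize\<close>. The weights are such that the number of triangles drops out and each
  other facet enters through its excess over 4.\<close>

lemma charge_inequality:
  "(\<Sum>v\<in>V. 12 - 3 * int (d v) - 2 * int (t v)) \<ge> 24 + 3 * (\<Sum>F | F \<in> Fc \<and> fsize F \<noteq> 3. int (fsize F) - 4)"
proof -
  let ?N = "{F \<in> Fc. fsize F \<noteq> 3}" and ?T = "{F \<in> Fc. fsize F = 3}"
  have split: "Fc = ?N \<union> ?T" "?N \<inter> ?T = {}" by auto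
  have cF: "card Fc = card ?N + card ?T"
    using finite_Fc card_Un_disjoint[of ?N ?T] split by simp
  have "2 * card E = (\<Sum>F\<in>?N. fsize F) + (\<Sum>F\<in>?T. fsize F)"
    using sum_fsize sum.union_disjoint[of ?N ?T fsize] split finite_Fc by simp
  also have "(\<Sum>F\<in>?T. fsize F) = 3 * card ?T" by simp
  finally have E: "2 * card E = (\<Sum>v\<in>V. d v) + 3 * card ?T" by (simp add: sum_d)
  have "(\<Sum>v\<in>V. 12 - 3 * int (d v) - 2 * int (t v)) = 12 * int (card V) - 3 * int (\<Sum>v\<in>V. d v) - 2 * int (\<Sum>v\<in>V. t v)"
    by (simp add: sum_subtractf flip: sum_distrib_left)
  moreover have "(\<Sum>F\<in>?N. int (fsize F) - 4) = int (\<Sum>v\<in>V. d v) - 4 * int (card ?N)"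
    by (simp add: sum_subtractf sum_d)
  ultimately show ?thesis
    using euler_inequality cF arg_cong[OF E, of int] sum_t by simp
qed

text \<open>Rigid vertices may carry a positive charge of at most 6; the cost of a vertex measures how
  far it stays below this bound (below 0 for the others), and by Euler's formula the total cost
  is bounded.\<close>

lemma cost_inequality:
  "(\<Sum>v\<in>R. int (d v) + 2 * (int (deg v) - 3)) + (\<Sum>v\<in>V - R. 3 * (int (d v) - 4) + 2 * int (t v))
   + 3 * (\<Sum>F | F \<in> Fc \<and> fsize F \<noteq> 3. int (fsize F) - 4) \<le> 6 * int (card R) - 24"
proof -
  have "(\<Sum>v\<in>V. 12 - 3 * int (d v) - 2 * int (t v)) =
    (\<Sum>v\<in>R. 12 - 3 * int (d v) - 2 * int (t v)) + (\<Sum>v\<in>V - R. 12 - 3 * int (d v) - 2 * int (t v))"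
    using sum.subset_diff[OF R_V finite_V] by (simp add: add.commute)
  \<comment> \<open>With \<open>deg = d + t\<close> the charge is \<open>12 - d - 2 deg\<close>,
    which is 6 minus the cost.\<close>
  also have "(\<Sum>v\<in>R. 12 - 3 * int (d v) - 2 * int (t v)) = (\<Sum>v\<in>R. 6 - (int (d v) + 2 * (int (deg v) - 3)))"
    using deg_d_t R_V by (intro sum.cong refl) auto
  also have "\<dots> = 6 * int (card R) - (\<Sum>v\<in>R. int (d v) + 2 * (int (deg v) - 3))"
    unfolding sum_subtractf by simp
  also have "(\<Sum>v\<in>V - R. 12 - 3 * int (d v) - 2 * int (t v)) = - (\<Sum>v\<in>V - R. 3 * (int (d v) - 4) + 2 * int (t v))"
    by (simp flip: sum_negf add: algebra_simps)
  finally show ?thesis using charge_inequality by linarith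
qed

lemma fsize_nontriangular: "F \<in> Fc \<Longrightarrow> fsize F \<noteq> 3 \<Longrightarrow> fsize F \<ge> 4"
  using fsize_ge3 by force

text \<open>Climb along edges that improve the generic \<open>a'\<close>. Since \<open>a'\<close>
  refines the order given by \<open>a\<close>, the climb never drops in \<open>a\<close>; it stays
  above level \<open>c\<close>, hence off \<open>S\<close>, and membership in \<open>A\<close> is
  passed on up to \<open>M\<close>.\<close>

lemma same_side_as_peak:
  assumes a': "inj_on ((\<bullet>) a') V" "\<And>v w. v \<in> V \<Longrightarrow> w \<in> V \<Longrightarrow> a \<bullet> v < a \<bullet> w \<Longrightarrow> a' \<bullet> v < a' \<bullet> w"
    and M: "M \<in> V" "peak a' P M"
    and S: "\<And>s. s \<in> S \<Longrightarrow> a \<bullet> s = c"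
    and AB: "\<And>e v u. e \<in> E \<Longrightarrow> v \<in> e \<Longrightarrow> u \<in> e \<Longrightarrow> v \<in> V - S \<Longrightarrow> u \<in> V - S \<Longrightarrow> v \<in> A \<longleftrightarrow> u \<in> A"
    and v: "v \<in> V" "a \<bullet> v > c"
  shows "v \<in> A \<longleftrightarrow> M \<in> A"
  using v
proof (induction "card {u \<in> V. a' \<bullet> v < a' \<bullet> u}" arbitrary: v rule: less_induct)
  case less
  show ?case
  proof (cases "v = M")
    case False
    have "a' \<bullet> v < a' \<bullet> M"
    proof -
      have "a' \<bullet> v \<le> a' \<bullet> M" using M less.prems V_subset_P by (auto simp: peak_def)
      moreover have "a' \<bullet> v \<noteq> a' \<bullet> M" using inj_onD[OF a'(1), of v M] False less.prems M by auto
      ultimately show ?thesis by simp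
    qed
    then obtain e u where e: "e \<in> E" "v \<in> e" "u \<in> e" "u \<in> V" "a' \<bullet> v < a' \<bullet> u"
      using improving_edge[of v M a'] less.prems M V_subset_P by metis
    have "\<not> a \<bullet> u < a \<bullet> v" using a'(2)[of u v] e less.prems by force
    then have cu: "a \<bullet> u > c" using less.prems by linarith
    have "v \<in> V - S" "u \<in> V - S" using S cu less.prems e by force+
    then have "v \<in> A \<longleftrightarrow> u \<in> A" using AB e by blast
    moreover have "{w \<in> V. a' \<bullet> u < a' \<bullet> w} \<subset> {w \<in> V. a' \<bullet> v < a' \<bullet> w}"
      using e by fastforce
    then have "card {w \<in> V. a' \<bullet> u < a' \<bullet> w} < card {w \<in> V. a' \<bullet> v < a' \<bullet> w}"
      using finite_V by (intro psubset_card_mono) auto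
    ultimately show ?thesis using less.hyps[of u] e cu by blast
  qed simp
qed

text \<open>Balinski's theorem in dimension 3, with \<open>A\<close> a side of a supposed
  separation. Take a plane through \<open>S\<close> and \<open>w\<close>: vertices above it climb to
  the top \<open>M\<close>, vertices below it descend to the bottom \<open>m\<close>, both without
  touching \<open>S\<close>. Vertices in the plane but outside \<open>S\<close> join every open side
  that contains points of \<open>P\<close>.\<close>

lemma not_separated_by_two:
  assumes S: "S \<subseteq> V" "card S \<le> 2"
    and x: "x \<in> V - S" "x \<in> A" and w: "w \<in> V - S" "w \<notin> A"
    and AB: "\<And>e v u. e \<in> E \<Longrightarrow> v \<in> e \<Longrightarrow> u \<in> e \<Longrightarrow> v \<in> V - S \<Longrightarrow> u \<in> V - S \<Longrightarrow> v \<in> A \<longleftrightarrow> u \<in> A"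
  shows False
proof -
  have "finite S" using S finite_V finite_subset by blast
  obtain s1 s2 where s12: "S \<subseteq> {s1, s2}"
  proof -
    consider "card S = 0" | "card S = 1" | "card S = 2" using S(2) by linarith
    then show thesis
    proof cases
      case 1 then show thesis using that \<open>finite S\<close> by auto
    next
      case 2
      then obtain s where "S = {s}" by (rule card_1_singletonE)
      then show thesis using that by auto
    next
      case 3 then show thesis using that by (auto simp: card_2_iff)
    qed
  qed
  \<comment> \<open>Putting \<open>w\<close> itself into the plane makes it the link between both
    sides: it has an edge upwards if \<open>P\<close> has points above, and one downwards if it has
    points below.\<close>
  obtain a where a: "a \<noteq> 0" "a \<bullet> s1 = a \<bullet> w" "a \<bullet> s2 = a \<bullet> w"
    using exists_functional_constant .
  have aS: "a \<bullet> s = a \<bullet> w" if "s \<in> S" for s using that s12 a by auto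
  let ?D = "{p \<in> V \<times> V. a \<bullet> fst p < a \<bullet> snd p}"
  \<comment> \<open>The open set of functionals that keep all strict inequalities of
    \<open>a\<close> between vertices; a generic member only breaks ties.\<close>
  define W where "W = (\<Inter>p\<in>?D. {b. (fst p - snd p) \<bullet> b < 0})"
  have "finite ?D" using finite_V by simp
  then have "open W" unfolding W_def by (intro open_INT ballI open_halfspace_lt)
  moreover have "a \<in> W" by (auto simp: W_def inner_diff_left inner_commute[of _ a])
  ultimately obtain a' where a': "a' \<in> W" "inj_on ((\<bullet>) a') V"
    using generic_functional[OF finite_V] by metis
  have mono: "a' \<bullet> v < a' \<bullet> u" if "v \<in> V" "u \<in> V" "a \<bullet> v < a \<bullet> u" for u v
  proof -
    have "(v - u) \<bullet> a' < 0" using a'(1) that by (auto simp: W_def)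
    then show ?thesis by (simp add: inner_commute[of _ a'] inner_diff_right)
  qed
  have Pne: "P face_of P" "P \<noteq> {}" using convex_P face_of_refl interior_P interior_subset by blast+
  obtain M where M: "M \<in> V" "peak a' P M" using exists_top[OF Pne] .
  obtain m where m: "m \<in> V" "peak (- a') P m" using exists_top[OF Pne] .
  have inj: "inj_on ((\<bullet>) (- a')) V" using a'(2) by (simp add: inj_on_def)
  have up: "v \<in> A \<longleftrightarrow> M \<in> A" if "v \<in> V" "a \<bullet> v > a \<bullet> w" for v
    by (rule same_side_as_peak[OF a'(2) mono M aS AB that])
  have down: "v \<in> A \<longleftrightarrow> m \<in> A" if "v \<in> V" "a \<bullet> v < a \<bullet> w" for v
  proof (rule same_side_as_peak[OF inj _ m, of "- a" S "- (a \<bullet> w)"])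
    show "(- a') \<bullet> p < (- a') \<bullet> q" if "p \<in> V" "q \<in> V" "(- a) \<bullet> p < (- a) \<bullet> q" for p q
      using mono[of q p] that by simp
    show "(- a) \<bullet> s = - (a \<bullet> w)" if "s \<in> S" for s using aS[OF that] by simp
    show "- (a \<bullet> w) < (- a) \<bullet> v" using that by simp
  qed (fact AB that)+
  have level_up: "v \<in> A \<longleftrightarrow> M \<in> A" if vy: "v \<in> V - S" "a \<bullet> v = a \<bullet> w" "y \<in> P" "a \<bullet> y > a \<bullet> w" for v y
  proof -
    obtain e u where e: "e \<in> E" "v \<in> e" "u \<in> e" "u \<in> V" "a \<bullet> v < a \<bullet> u"
      by (rule improving_edge[of v y a]) (use vy that in \<open>simp_all | blast\<close>)
    then have "u \<notin> S" using aS that by force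
    then have "v \<in> A \<longleftrightarrow> u \<in> A" using AB e that by blast
    then show ?thesis using up[of u] e that by simp
  qed
  have level_down: "v \<in> A \<longleftrightarrow> m \<in> A" if vy: "v \<in> V - S" "a \<bullet> v = a \<bullet> w" "y \<in> P" "a \<bullet> y < a \<bullet> w" for v y
  proof -
    obtain e u where e: "e \<in> E" "v \<in> e" "u \<in> e" "u \<in> V" "(- a) \<bullet> v < (- a) \<bullet> u"
      by (rule improving_edge[of v y "- a"]) (use vy that in \<open>simp_all | blast\<close>)
    then have "u \<notin> S" using aS that by force
    then have "v \<in> A \<longleftrightarrow> u \<in> A" using AB e that by blast
    then show ?thesis using down[of u] e that by simp
  qed
  have wP: "w \<in> P" and xP: "x \<in> P" using w x V_subset_P by auto
  obtain y where y: "y \<in> P" "a \<bullet> y \<noteq> a \<bullet> w" using not_constant_on_P[OF a(1)] by blast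
  show False
  proof (cases "\<exists>y\<in>P. a \<bullet> y > a \<bullet> w")
    case True
    then have wM: "M \<notin> A" using level_up w by blast
    show False
    proof (cases "a \<bullet> x < a \<bullet> w")
      case False
      then have "a \<bullet> x > a \<bullet> w \<or> a \<bullet> x = a \<bullet> w" by linarith
      then have "x \<in> A \<longleftrightarrow> M \<in> A" using up level_up x True by blast
      then show False using wM x by blast
    next
      case lt: True
      then have "m \<notin> A" using level_down[of w x] w xP by blast
      then show False using down[of x] x lt by blast
    qed
  next
    case False
    then have lt: "a \<bullet> y < a \<bullet> w" using y by force
    then have wm: "m \<notin> A" using level_down[of w y] w y by blast
    have "a \<bullet> x \<le> a \<bullet> w" using False xP by force
    then have "a \<bullet> x < a \<bullet> w \<or> a \<bullet> x = a \<bullet> w" by linarith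
    then have "x \<in> A \<longleftrightarrow> m \<in> A" using down[of x] level_down[of x y] x y lt by blast
    then show False using wm x by blast
  qed
qed

section \<open>Redistribution of the cost to the rigid vertices\<close>

lemma nonrigid_d: "v \<in> V - R \<Longrightarrow> d v \<ge> 4"
  by (auto simp: R_def)

text \<open>A triangle costs 2 at each of its non-rigid corners. \<open>tU r\<close> is the part of
  this cost handed to the rigid vertex \<open>r\<close>: one unit for each such triangle at
  \<open>r\<close>.\<close>

definition "tU r = card {F \<in> Fc. r \<in> F \<and> fsize F = 3 \<and> (\<exists>u\<in>V - R. u \<in> F)}"

definition "rigid_cost r = int (d r) + int (tU r) + 2 * (int (deg r) - 3)"

text \<open>A triangle with q \<ge> 1 non-rigid corners has 3 - q \<le> 2 q rigid ones, so its cost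
  covers one unit for each of them.\<close>

lemma sum_tU: "(\<Sum>r\<in>R. tU r) \<le> 2 * (\<Sum>u\<in>V - R. t u)"
proof -
  let ?T = "{F \<in> Fc. fsize F = 3 \<and> (\<exists>u\<in>V - R. u \<in> F)}"
  have fin: "finite ?T" "finite (V - R)" "finite R"
    using finite_Fc finite_V finite_R by auto
  have "(\<Sum>r\<in>R. tU r) = (\<Sum>r\<in>R. card {F \<in> ?T. r \<in> F})"
    by (intro sum.cong refl) (auto simp: tU_def intro!: arg_cong[of _ _ card])
  also have "\<dots> = (\<Sum>F\<in>?T. card {r \<in> R. r \<in> F})"
    using fin by (intro double_count)
  also have "\<dots> \<le> (\<Sum>F\<in>?T. 2 * card {u \<in> V - R. u \<in> F})"
  proof (rule sum_mono)
    fix F assume F: "F \<in> ?T"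
    have "{v \<in> V. v \<in> F} = {r \<in> R. r \<in> F} \<union> {u \<in> V - R. u \<in> F}" using R_V by auto
    moreover have "card ({r \<in> R. r \<in> F} \<union> {u \<in> V - R. u \<in> F}) = card {r \<in> R. r \<in> F} + card {u \<in> V - R. u \<in> F}"
      using fin by (intro card_Un_disjoint) auto
    ultimately have "card {r \<in> R. r \<in> F} + card {u \<in> V - R. u \<in> F} = 3"
      using F by (simp add: fsize_def)
    moreover have "card {u \<in> V - R. u \<in> F} > 0"
      unfolding card_gt_0_iff using F finite_V by (intro conjI) (blast, simp)
    ultimately show "card {r \<in> R. r \<in> F} \<le> 2 * card {u \<in> V - R. u \<in> F}" by linarith
  qed
  also have "\<dots> = 2 * (\<Sum>F\<in>?T. card {u \<in> V - R. u \<in> F})" by (simp add: sum_distrib_left)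
  also have "(\<Sum>F\<in>?T. card {u \<in> V - R. u \<in> F}) = (\<Sum>u\<in>V - R. card {F \<in> ?T. u \<in> F})"
    using fin by (intro double_count)
  also have "\<dots> = (\<Sum>u\<in>V - R. t u)"
    by (intro sum.cong refl) (auto simp: t_def intro!: arg_cong[of _ _ card])
  finally show ?thesis by simp
qed

text \<open>A non-rigid vertex costs at least \<open>2 * t\<close>, as its \<open>d\<close> is at
  least 4, and by \<open>sum_tU\<close> this pays for all the \<open>tU\<close>. Facets with more
  than four sides only add to the cost, so the whole budget bounds the rigid vertices.\<close>

lemma sum_rigid_cost: "(\<Sum>r\<in>R. rigid_cost r) \<le> 6 * int (card R) - 24"
proof -
  have "(\<Sum>F | F \<in> Fc \<and> fsize F \<noteq> 3. int (fsize F) - 4) \<ge> 0"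
    using fsize_nontriangular by (intro sum_nonneg) force
  moreover have "(\<Sum>v\<in>V - R. 3 * (int (d v) - 4) + 2 * int (t v)) \<ge> (\<Sum>v\<in>V - R. 2 * int (t v))"
    using nonrigid_d by (intro sum_mono) force
  moreover have "(\<Sum>v\<in>V - R. 2 * int (t v)) \<ge> (\<Sum>r\<in>R. int (tU r))"
    using sum_tU by (simp flip: sum_distrib_left of_nat_sum)
  moreover have "(\<Sum>r\<in>R. rigid_cost r) = (\<Sum>v\<in>R. int (d v) + 2 * (int (deg v) - 3)) + (\<Sum>r\<in>R. int (tU r))"
    unfolding rigid_cost_def sum.distrib[symmetric] by (intro sum.cong) auto
  ultimately show ?thesis using cost_inequality by linarith
qed

lemma rigid_cost_nonneg: "r \<in> V \<Longrightarrow> rigid_cost r \<ge> 0"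
  using deg_ge3 by (force simp: rigid_cost_def)

definition "B = {r \<in> R. \<exists>e\<in>E. \<exists>u\<in>V - R. r \<in> e \<and> u \<in> e}"

lemma facet_with_nonrigid_charged:
  assumes "F \<in> Fc" "r \<in> F" "u \<in> V - R" "u \<in> F"
  shows "F \<in> {F \<in> Fc. r \<in> F \<and> fsize F \<noteq> 3} \<union> {F \<in> Fc. r \<in> F \<and> fsize F = 3 \<and> (\<exists>u\<in>V - R. u \<in> F)}"
  using assms by auto

text \<open>Both facets along an edge from \<open>b\<close> to a non-rigid vertex are counted at
  \<open>b\<close>, in \<open>d\<close> if they are non-triangular and in \<open>tU\<close> if they
  are triangles.\<close>

lemma rigid_cost_boundary:
  assumes b: "b \<in> B"
  shows "int (d b) + int (tU b) \<ge> 2"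
proof -
  obtain e u where e: "e \<in> E" "u \<in> V - R" "b \<in> e" "u \<in> e" using b by (auto simp: B_def)
  let ?X = "{F \<in> Fc. b \<in> F \<and> fsize F \<noteq> 3}"
  let ?Y = "{F \<in> Fc. b \<in> F \<and> fsize F = 3 \<and> (\<exists>u\<in>V - R. u \<in> F)}"
  have "{F \<in> Fc. e \<subseteq> F} \<subseteq> ?X \<union> ?Y"
    using facet_with_nonrigid_charged e by blast
  then have "card {F \<in> Fc. e \<subseteq> F} \<le> card (?X \<union> ?Y)"
    using finite_Fc by (intro card_mono) auto
  also have "\<dots> \<le> card ?X + card ?Y" by (rule card_Un_le)
  finally show ?thesis using card_facets_edge[OF e(1)] by (simp add: d_def tU_def)
qed

text \<open>No edge joins \<open>R - B\<close> to \<open>V - R\<close>, so \<open>B\<close> would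
  separate them if both were nonempty.\<close>

lemma rigid_subset_boundary:
  assumes "V - R \<noteq> {}" "card B \<le> 2"
  shows "R \<subseteq> B"
proof (rule ccontr)
  assume "\<not> R \<subseteq> B"
  then obtain x where x: "x \<in> R" "x \<notin> B" by blast
  obtain w where w: "w \<in> V - R" using assms by blast
  have BR: "B \<subseteq> R" by (auto simp: B_def)
  show False
  proof (rule not_separated_by_two[OF _ assms(2)])
    show "v \<in> R \<longleftrightarrow> u \<in> R" if "e \<in> E" "v \<in> e" "u \<in> e" "v \<in> V - B" "u \<in> V - B" for e v u
      using that unfolding B_def by blast
  qed (use x w BR R_V in auto)
qed

lemma rigid_ge4: "card R \<ge> 4"
  and rigid_4_or_5: "card R \<le> 5 \<Longrightarrow> V = R"
proof -
  have "(\<Sum>r\<in>R. rigid_cost r) \<ge> 0" using rigid_cost_nonneg R_V by (intro sum_nonneg) auto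
  then show ge4: "card R \<ge> 4" using sum_rigid_cost by linarith
  assume le5: "card R \<le> 5"
  have BR: "B \<subseteq> R" by (auto simp: B_def)
  have finB: "finite B" using BR finite_R finite_subset by blast
  show "V = R"
  proof (rule ccontr)
    assume "V \<noteq> R"
    then have ne: "V - R \<noteq> {}" using R_V by blast
    have B3: "card B \<ge> 3"
    proof (rule ccontr)
      assume "\<not> card B \<ge> 3"
      then have "R \<subseteq> B" using rigid_subset_boundary[OF ne] by simp
      then have "card R \<le> card B" using finB card_mono by blast
      then show False using ge4 \<open>\<not> card B \<ge> 3\<close> by simp
    qed
    have split: "(\<Sum>r\<in>R. rigid_cost r) = (\<Sum>r\<in>R - B. rigid_cost r) + (\<Sum>r\<in>B. rigid_cost r)"
      by (rule sum.subset_diff[OF BR finite_R])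
    have costB: "rigid_cost b \<ge> 2" if "b \<in> B" for b
      using rigid_cost_boundary[OF that] deg_ge3[of b] that BR R_V by (force simp: rigid_cost_def)
    have sB: "(\<Sum>r\<in>B. rigid_cost r) \<ge> 2 * int (card B)"
      using sum_mono[of B "\<lambda>_. 2" rigid_cost] costB by simp
    have sRB: "(\<Sum>r\<in>R - B. rigid_cost r) \<ge> 0"
      using rigid_cost_nonneg R_V by (intro sum_nonneg) auto
    \<comment> \<open>At least three boundary vertices spend 2 each, while the budget is at most
      \<open>6 * 5 - 24 = 6\<close>; so every estimate is an equality. Four rigid vertices would
      have budget 0.\<close>
    have k: "card R = 5" "card B = 3" "(\<Sum>r\<in>R - B. rigid_cost r) = 0" "(\<Sum>r\<in>B. rigid_cost r) = 6"
      using sB sRB sum_rigid_cost B3 split le5 ge4 by linarith+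
    have zero: "rigid_cost r = 0" if "r \<in> R - B" for r
      using k(3) that finite_R rigid_cost_nonneg R_V by (subst (asm) sum_nonneg_eq_0_iff) auto
    \<comment> \<open>Nothing is left over: \<open>b\<close> spends exactly 2, all of it on
      \<open>d\<close> and \<open>tU\<close>, so its degree term vanishes.\<close>
    have degB: "deg b = 3" if b: "b \<in> B" for b
    proof -
      have "(\<Sum>r\<in>B - {b}. rigid_cost r) \<ge> 2 * int (card (B - {b}))"
        using sum_mono[of "B - {b}" "\<lambda>_. 2" rigid_cost] costB by simp
      moreover have "(\<Sum>r\<in>B. rigid_cost r) = rigid_cost b + (\<Sum>r\<in>B - {b}. rigid_cost r)"
        using finB b by (simp add: sum.remove)
      ultimately have "rigid_cost b \<le> 2" using k b finB by simp
      then show ?thesis using rigid_cost_boundary[OF b] deg_ge3[of b] b BR R_V by (force simp: rigid_cost_def)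
    qed
    have "card (R - B) = 2" using k BR finB by (simp add: card_Diff_subset)
    then obtain x y where xy: "R - B = {x, y}" "x \<noteq> y" by (auto simp: card_2_iff)
    have xV: "x \<in> V" using xy R_V by blast
    have x0: "d x = 0" "tU x = 0" using zero[of x] xy deg_ge3[OF xV] by (auto simp: rigid_cost_def)
    \<comment> \<open>Otherwise the only possible neighbour of \<open>x\<close> would be
      \<open>y\<close>: non-rigid neighbours are excluded by \<open>x\<close> not being in
      \<open>B\<close>.\<close>
    obtain e b where e: "e \<in> E" "x \<in> e" "b \<in> e" "b \<in> B"
    proof (rule ccontr)
      assume no: "\<not> thesis"
      have "{e \<in> E. x \<in> e} \<subseteq> {closed_segment x y}"
      proof
        fix e assume "e \<in> {e \<in> E. x \<in> e}"
        then have e: "e \<in> E" "x \<in> e" by auto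
        obtain u where u: "u \<in> V" "u \<in> e" "u \<noteq> x" "e = closed_segment x u"
          by (rule other_vertex[OF e(1) xV e(2)]) (use that in blast)
        have "u \<in> R" using u e xy by (auto simp: B_def)
        moreover have "u \<notin> B" using no that u e by blast
        ultimately have "u = y" using u xy by blast
        then show "e \<in> {closed_segment x y}" using u by simp
      qed
      then have "card {e \<in> E. x \<in> e} \<le> card {closed_segment x y}" by (intro card_mono) auto
      then show False using deg_ge3[OF xV] by (simp add: deg_def)
    qed
    obtain e' u where e': "e' \<in> E" "u \<in> V - R" "b \<in> e'" "u \<in> e'" using e(4) by (auto simp: B_def)
    have bV: "b \<in> V" using e BR R_V by blast
    let ?X = "{F \<in> Fc. e \<subseteq> F}" and ?Y = "{F \<in> Fc. e' \<subseteq> F}"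
    \<comment> \<open>Each of the edges \<open>e\<close> and \<open>e'\<close> lies in two facets,
      but \<open>b\<close> has only three, so one facet contains both edges. It contains
      \<open>x\<close> and the non-rigid \<open>u\<close>, hence would cost something at
      \<open>x\<close>.\<close>
    have "?X \<inter> ?Y \<noteq> {}"
    proof
      assume "?X \<inter> ?Y = {}"
      then have "card (?X \<union> ?Y) = 4"
        using finite_Fc card_facets_edge e e' by (simp add: card_Un_disjoint)
      moreover have "card (?X \<union> ?Y) \<le> card {F \<in> Fc. b \<in> F}"
        using finite_Fc e e' by (intro card_mono) auto
      ultimately show False using degB[OF e(4)] deg_facets[OF bV] by simp
    qed
    then obtain F where F: "F \<in> Fc" "x \<in> F" "u \<in> F" using e e' by blast
    then have "{F \<in> Fc. x \<in> F \<and> fsize F \<noteq> 3} \<noteq> {} \<or> {F \<in> Fc. x \<in> F \<and> fsize F = 3 \<and> (\<exists>u\<in>V - R. u \<in> F)} \<noteq> {}"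
      using facet_with_nonrigid_charged[OF F(1,2) e'(2) F(3)] by blast
    then show False using x0 finite_Fc by (simp add: d_def tU_def) blast
  qed
qed

lemma card_R_V: "card V = 4 \<or> card V = 5 \<Longrightarrow> card R = card V"
  using rigid_4_or_5 card_mono[OF finite_V R_V] by fastforce

end

section \<open>Isotopies of graphs on the sphere\<close>

lemma image_left_inverse:
  assumes "\<And>y. y \<in> D \<Longrightarrow> f (g y) = y"
  shows "f ` g ` D = D"
  using assms by (force simp: image_image)

lemma homeomorphism_component_image:
  assumes f: "homeomorphism S T f g" and U: "U \<subseteq> S" and C: "C \<in> components U"
  shows "f ` C \<in> components (f ` U)"
proof -
  have fg: "g (f x) = x" if "x \<in> S" for x using f that by (simp add: homeomorphism_def)
  have gf: "f (g y) = y" if "y \<in> T" for y using f that by (simp add: homeomorphism_def)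
  have fS: "f ` S = T" using f by (auto simp: homeomorphism_def)
  have cont: "continuous_on S f" "continuous_on T g" using f by (auto simp: homeomorphism_def)
  note C' = C[unfolded in_components_maximal]
  have C: "C \<noteq> {}" "C \<subseteq> U" "connected C" using C' by simp_all
  have max: "D = C" if "D \<noteq> {}" "C \<subseteq> D" "D \<subseteq> U" "connected D" for D
    using C' that by simp
  have inv': "g ` f ` X = X" if "X \<subseteq> U" for X
    by (rule image_left_inverse, rule fg) (use that U in blast)
  show ?thesis
    unfolding in_components_maximal
  proof (intro conjI allI impI)
    show "f ` C \<noteq> {}" "f ` C \<subseteq> f ` U" using C by auto
    show "connected (f ` C)"
      using C continuous_on_subset[OF cont(1), of C] U by (intro connected_continuous_image) auto
    fix D assume D: "D \<noteq> {} \<and> f ` C \<subseteq> D \<and> D \<subseteq> f ` U \<and> connected D"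
    have DT: "D \<subseteq> T" using D U fS by blast
    then have "connected (g ` D)"
      using D continuous_on_subset[OF cont(2) DT] by (intro connected_continuous_image) auto
    moreover have "g ` f ` C \<subseteq> g ` D" using D by (intro image_mono) simp
    then have "C \<subseteq> g ` D" using inv'[OF C(2)] by simp
    moreover have "g ` D \<subseteq> g ` f ` U" using D by (intro image_mono) simp
    then have "g ` D \<subseteq> U" using inv'[OF order_refl] by simp
    moreover have "g ` D \<noteq> {}" using D by simp
    ultimately have "g ` D = C" by (intro max)
    moreover have "f ` g ` D = D" by (rule image_left_inverse, rule gf) (use DT in blast)
    ultimately show "D = f ` C" by simp
  qed
qed

lemma homeomorphism_components_image:
  assumes f: "homeomorphism S T f g" and U: "U \<subseteq> S"
  shows "components (f ` U) = (`) f ` components U"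
proof
  have fg: "g (f x) = x" if "x \<in> S" for x using f that by (simp add: homeomorphism_def)
  have gf: "f (g y) = y" if "y \<in> T" for y using f that by (simp add: homeomorphism_def)
  have fU: "f ` U \<subseteq> T" using U f by (auto simp: homeomorphism_def)
  show "(`) f ` components U \<subseteq> components (f ` U)"
    using homeomorphism_component_image[OF f U] by blast
  show "components (f ` U) \<subseteq> (`) f ` components U"
  proof
    fix D assume D: "D \<in> components (f ` U)"
    have "g ` f ` U = U" by (rule image_left_inverse, rule fg) (use U in blast)
    then have "g ` D \<in> components U"
      using homeomorphism_component_image[OF homeomorphism_symD[OF f] fU D] by simp
    moreover have "f ` g ` D = D"
      by (rule image_left_inverse, rule gf) (use in_components_subset[OF D] fU in blast)
    ultimately show "D \<in> (`) f ` components U" by (metis imageI)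
  qed
qed

lemma closure_continuous_image_compact:
  fixes f :: "'a::metric_space \<Rightarrow> 'b::metric_space"
  assumes "compact S" "continuous_on S f" "A \<subseteq> S"
  shows "closure (f ` A) = f ` closure A"
proof
  have cA: "closure A \<subseteq> S" using assms by (simp add: closure_minimal compact_imp_closed)
  then have c: "continuous_on (closure A) f" using assms continuous_on_subset by blast
  have "compact (closure A)"
    using compact_Int_closed[OF assms(1) closed_closure[of A]] cA by (simp add: Int_absorb1)
  then have "closed (f ` closure A)" using c compact_continuous_image compact_imp_closed by blast
  then show "closure (f ` A) \<subseteq> f ` closure A"
    using closure_subset by (intro closure_minimal) auto
  show "f ` closure A \<subseteq> closure (f ` A)"
    using c continuous_image_closure_subset by blast
qed

text \<open>Each member is clopen in the union, because the other members form an open set; a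
  connected set meeting a member therefore stays inside it.\<close>

lemma components_eq_open_partition:
  assumes con: "\<And>C. C \<in> \<C> \<Longrightarrow> connected C \<and> C \<noteq> {}"
    and dis: "\<And>C D. C \<in> \<C> \<Longrightarrow> D \<in> \<C> \<Longrightarrow> C \<noteq> D \<Longrightarrow> C \<inter> D = {}"
    and op: "\<And>C. C \<in> \<C> \<Longrightarrow> openin (top_of_set (\<Union>\<C>)) C"
  shows "components (\<Union>\<C>) = \<C>"
proof -
  have sub: "D \<subseteq> C" if C: "C \<in> \<C>" and D: "connected D" "D \<subseteq> \<Union>\<C>" "D \<inter> C \<noteq> {}" for C D
  proof -
    have "openin (top_of_set (\<Union>\<C>)) (\<Union>(\<C> - {C}))"
      using op by (intro openin_Union) auto
    moreover have "\<Union>(\<C> - {C}) = \<Union>\<C> - C" using dis C by auto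
    ultimately have "closedin (top_of_set (\<Union>\<C>)) C"
      using C by (auto simp: closedin_def)
    then obtain K where "closed K" "C = \<Union>\<C> \<inter> K" by (auto simp: closedin_closed)
    then have "closedin (top_of_set D) (D \<inter> C)" using D(2) by (auto simp: closedin_closed)
    moreover obtain W where "open W" "C = \<Union>\<C> \<inter> W" using op[OF C] by (auto simp: openin_open)
    then have "openin (top_of_set D) (D \<inter> C)" using D(2) by (auto simp: openin_open)
    moreover have "D \<inter> C \<subseteq> D" by simp
    ultimately have "D \<inter> C = D" using D(1,3) connected_clopen by blast
    then show ?thesis by blast
  qed
  have comp: "C \<in> components (\<Union>\<C>)" if "C \<in> \<C>" for C
    unfolding in_components_maximal using that con sub by blast
  show ?thesis
  proof
    show "components (\<Union>\<C>) \<subseteq> \<C>"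
    proof
      fix D assume D: "D \<in> components (\<Union>\<C>)"
      then have "D \<noteq> {}" "D \<subseteq> \<Union>\<C>" using in_components_nonempty in_components_subset by blast+
      then obtain C where "C \<in> \<C>" "D \<inter> C \<noteq> {}" by blast
      then show "D \<in> \<C>" using components_nonoverlap[OF D comp] by blast
    qed
  qed (use comp in blast)
qed

section \<open>Transport of graphs along homeomorphisms of the sphere\<close>

definition gmap :: "(real^3 \<Rightarrow> real^3) \<Rightarrow> sgraph \<Rightarrow> sgraph" where
  "gmap f G = SGraph (f ` verts G) ((`) f ` edges G)"

text \<open>The maps of an isotopy are controlled only on \<open>S2\<close>, so reversing an isotopy
  and transferring counts need graphs that lie there.\<close>

definition on_sphere :: "sgraph \<Rightarrow> bool" where
  "on_sphere G \<longleftrightarrow> verts G \<subseteq> S2 \<and> (\<forall>e\<in>edges G. e \<subseteq> S2)"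

lemma gmap_simps [simp]: "verts (gmap f G) = f ` verts G" "edges (gmap f G) = (`) f ` edges G"
  by (simp_all add: gmap_def)

lemma gmap_comp: "gmap f (gmap g G) = gmap (f \<circ> g) G"
  by (simp add: gmap_def image_image)

lemma gmap_cong: "on_sphere G \<Longrightarrow> (\<And>x. x \<in> S2 \<Longrightarrow> f x = g x) \<Longrightarrow> gmap f G = gmap g G"
  unfolding gmap_def on_sphere_def by (auto intro!: image_cong simp: subset_iff)

lemma gmap_id: "on_sphere G \<Longrightarrow> (\<And>x. x \<in> S2 \<Longrightarrow> f x = x) \<Longrightarrow> gmap f G = G"
  using gmap_cong[of G f id] by (cases G) (simp add: gmap_def)

lemma isotopic_gmap:
  "isotopic G G' \<longleftrightarrow> (\<exists>h :: real \<Rightarrow> real^3 \<Rightarrow> real^3. continuous_on ({0..1} \<times> S2) (\<lambda>(t, x). h t x) \<and>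
     (\<forall>t\<in>{0..1}. \<exists>g. homeomorphism S2 S2 (h t) g) \<and> (\<forall>x\<in>S2. h 0 x = x) \<and> G' = gmap (h 1) G)"
  unfolding isotopic_def by (cases G') (auto simp: gmap_def)

lemma isotopic_homeomorphism:
  assumes "isotopic G G'"
  obtains f g where "homeomorphism S2 S2 f g" "G' = gmap f G"
proof -
  obtain h :: "real \<Rightarrow> real^3 \<Rightarrow> real^3" where h0: "continuous_on ({0..1} \<times> S2) (\<lambda>(t, x). h t x) \<and>
     (\<forall>t\<in>{0..1}. \<exists>g. homeomorphism S2 S2 (h t) g) \<and> (\<forall>x\<in>S2. h 0 x = x) \<and> G' = gmap (h 1) G"
    using assms unfolding isotopic_gmap by (rule exE)
  have h: "continuous_on ({0..1} \<times> S2) (\<lambda>(t, x). h t x)"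
     "\<And>t. t \<in> {0..1} \<Longrightarrow> \<exists>g. homeomorphism S2 S2 (h t) g" "\<And>x. x \<in> S2 \<Longrightarrow> h 0 x = x" "G' = gmap (h 1) G"
    using h0 by simp_all
  have "\<exists>g. homeomorphism S2 S2 (h 1) g" using h(2) by simp
  then obtain g where "homeomorphism S2 S2 (h 1) g" ..
  then show thesis using that h(4) by blast
qed

lemma isotopic_refl: "isotopic G G"
  unfolding isotopic_gmap
  by (rule exI[of _ "\<lambda>t x. x"])
     (auto simp: split_def gmap_def intro!: continuous_intros exI[of _ "\<lambda>x. x"] homeomorphism_ident)

lemma isotopic_trans:
  assumes "isotopic G G'" "isotopic G' G''"
  shows "isotopic G G''"
proof -
  obtain h :: "real \<Rightarrow> real^3 \<Rightarrow> real^3" where h0: "continuous_on ({0..1} \<times> S2) (\<lambda>(t, x). h t x) \<and>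
     (\<forall>t\<in>{0..1}. \<exists>g. homeomorphism S2 S2 (h t) g) \<and> (\<forall>x\<in>S2. h 0 x = x) \<and> G' = gmap (h 1) G"
    using assms(1) unfolding isotopic_gmap by (rule exE)
  have h: "continuous_on ({0..1} \<times> S2) (\<lambda>(t, x). h t x)"
     "\<And>t. t \<in> {0..1} \<Longrightarrow> \<exists>g. homeomorphism S2 S2 (h t) g" "\<And>x. x \<in> S2 \<Longrightarrow> h 0 x = x" "G' = gmap (h 1) G"
    using h0 by simp_all
  obtain k :: "real \<Rightarrow> real^3 \<Rightarrow> real^3" where k0: "continuous_on ({0..1} \<times> S2) (\<lambda>(t, x). k t x) \<and>
     (\<forall>t\<in>{0..1}. \<exists>g. homeomorphism S2 S2 (k t) g) \<and> (\<forall>x\<in>S2. k 0 x = x) \<and> G'' = gmap (k 1) G'"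
    using assms(2) unfolding isotopic_gmap by (rule exE)
  have k: "continuous_on ({0..1} \<times> S2) (\<lambda>(t, x). k t x)"
     "\<And>t. t \<in> {0..1} \<Longrightarrow> \<exists>g. homeomorphism S2 S2 (k t) g" "\<And>x. x \<in> S2 \<Longrightarrow> k 0 x = x" "G'' = gmap (k 1) G'"
    using k0 by simp_all
  have h1: "h 1 x \<in> S2" if "x \<in> S2" for x
    using h(2)[of 1] that by (force simp: homeomorphism_def)
  define l where "l t x = (if t \<le> 1/2 then h (2 * t) x else k (2 * t - 1) (h 1 x))" for t :: real and x
  have "continuous_on ({0..1} \<times> S2) (\<lambda>(t, x). l t x)"
  proof -
    let ?A = "{0..1/2::real} \<times> S2" and ?B = "{1/2..1::real} \<times> S2"
    have A: "continuous_on ?A (\<lambda>(t, x). h (2 * t) x)"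
    proof -
      have "continuous_on ?A ((\<lambda>(t, x). h t x) \<circ> (\<lambda>(t, x). (2 * t, x)))"
        by (intro continuous_on_compose continuous_on_subset[OF h(1)])
           (auto simp: split_def intro!: continuous_intros)
      then show ?thesis by (simp add: comp_def split_def)
    qed
    have B: "continuous_on ?B (\<lambda>(t, x). k (2 * t - 1) (h 1 x))"
    proof -
      have "continuous_on S2 (h 1)" using h(2)[of 1] by (auto simp: homeomorphism_def)
      then have "continuous_on ?B (\<lambda>p. h 1 (snd p))"
        by (rule continuous_on_compose2) (auto intro!: continuous_intros)
      then have "continuous_on ?B ((\<lambda>(t, x). k t x) \<circ> (\<lambda>(t, x). (2 * t - 1, h 1 x)))"
        using h1 by (intro continuous_on_compose continuous_on_subset[OF k(1)])
           (auto simp: split_def intro!: continuous_intros)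
      then show ?thesis by (simp add: comp_def split_def)
    qed
    have c: "continuous_on (?A \<union> ?B) (\<lambda>p. if fst p \<le> 1/2 then (case p of (t, x) \<Rightarrow> h (2 * t) x) else (case p of (t, x) \<Rightarrow> k (2 * t - 1) (h 1 x)))"
    proof (rule continuous_on_cases[OF _ _ A B])
      show "closed ?A" "closed ?B" by (auto intro!: closed_Times)
      show "\<forall>p. p \<in> ?A \<and> \<not> fst p \<le> 1/2 \<or> p \<in> ?B \<and> fst p \<le> 1/2 \<longrightarrow>
         (case p of (t, x) \<Rightarrow> h (2 * t) x) = (case p of (t, x) \<Rightarrow> k (2 * t - 1) (h 1 x))"
      proof (intro allI impI)
        fix p assume "p \<in> ?A \<and> \<not> fst p \<le> 1/2 \<or> p \<in> ?B \<and> fst p \<le> 1/2"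
        then obtain x where "p = (1/2, x)" "x \<in> S2" by (cases p) force
        then show "(case p of (t, x) \<Rightarrow> h (2 * t) x) = (case p of (t, x) \<Rightarrow> k (2 * t - 1) (h 1 x))"
          using k(3)[OF h1[of x]] by simp
      qed
    qed
    have AB: "?A \<union> ?B = {0..1} \<times> S2" by auto
    have l: "(\<lambda>(t, x). l t x) = (\<lambda>p. if fst p \<le> 1/2 then (case p of (t, x) \<Rightarrow> h (2 * t) x) else (case p of (t, x) \<Rightarrow> k (2 * t - 1) (h 1 x)))"
      by (auto simp: l_def fun_eq_iff)
    show ?thesis using c unfolding AB l .
  qed
  moreover have "\<exists>g. homeomorphism S2 S2 (l t) g" if t: "t \<in> {0..1}" for t
  proof (cases "t \<le> 1/2")
    case True
    then show ?thesis using h(2)[of "2 * t"] t by (simp add: l_def[abs_def])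
  next
    case False
    obtain g1 where g1: "homeomorphism S2 S2 (h 1) g1" using h(2)[of 1] by auto
    obtain g2 where g2: "homeomorphism S2 S2 (k (2 * t - 1)) g2" using k(2)[of "2 * t - 1"] False t by auto
    have "l t = k (2 * t - 1) \<circ> h 1" using False by (auto simp: l_def)
    then show ?thesis using homeomorphism_compose[OF g1 g2] by metis
  qed
  moreover have "\<forall>x\<in>S2. l 0 x = x" using h by (simp add: l_def)
  moreover have "l 1 = k 1 \<circ> h 1" by (auto simp: l_def)
  then have "G'' = gmap (l 1) G" using h(4) k(4) by (simp add: gmap_comp)
  ultimately show ?thesis unfolding isotopic_gmap by blast
qed

lemma isotopic_sym:
  assumes G: "on_sphere G" and "isotopic G G'"
  shows "isotopic G' G"
proof -
  obtain h :: "real \<Rightarrow> real^3 \<Rightarrow> real^3" where h0: "continuous_on ({0..1} \<times> S2) (\<lambda>(t, x). h t x) \<and>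
     (\<forall>t\<in>{0..1}. \<exists>g. homeomorphism S2 S2 (h t) g) \<and> (\<forall>x\<in>S2. h 0 x = x) \<and> G' = gmap (h 1) G"
    using assms(2) unfolding isotopic_gmap by (rule exE)
  have h: "continuous_on ({0..1} \<times> S2) (\<lambda>(t, x). h t x)"
     "\<And>t. t \<in> {0..1} \<Longrightarrow> \<exists>g. homeomorphism S2 S2 (h t) g" "\<And>x. x \<in> S2 \<Longrightarrow> h 0 x = x" "G' = gmap (h 1) G"
    using h0 by simp_all
  obtain g where g: "homeomorphism S2 S2 (h 1) g" using h(2)[of 1] by auto
  have gS: "g x \<in> S2" if "x \<in> S2" for x using g that by (force simp: homeomorphism_def)
  \<comment> \<open>Time reversal, precomposed with the inverse of the end map so that the path
    starts at the identity.\<close>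
  define k where "k t x = h (1 - t) (g x)" for t x
  have "continuous_on ({0..1} \<times> S2) (\<lambda>p. g (snd p))"
    by (rule continuous_on_compose2[of S2 g]) (use g in \<open>auto simp: homeomorphism_def intro!: continuous_intros\<close>)
  then have "continuous_on ({0..1} \<times> S2) ((\<lambda>(t, x). h t x) \<circ> (\<lambda>(t, x). (1 - t, g x)))"
    using gS by (intro continuous_on_compose continuous_on_subset[OF h(1)])
       (auto simp: split_def intro!: continuous_intros)
  then have "continuous_on ({0..1} \<times> S2) (\<lambda>(t, x). k t x)" by (simp add: comp_def split_def k_def)
  moreover have "\<exists>g'. homeomorphism S2 S2 (k t) g'" if t: "t \<in> {0..1}" for t
  proof -
    obtain g' where "homeomorphism S2 S2 (h (1 - t)) g'" using h(2)[of "1 - t"] t by auto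
    then have "homeomorphism S2 S2 (h (1 - t) \<circ> g) (h 1 \<circ> g')"
      using homeomorphism_compose homeomorphism_symD[OF g] by blast
    moreover have "h (1 - t) \<circ> g = k t" by (auto simp: k_def)
    ultimately show ?thesis by metis
  qed
  moreover have "\<forall>x\<in>S2. k 0 x = x" using g by (simp add: k_def homeomorphism_def)
  moreover have "G = gmap (k 1) G'"
  proof -
    have "k 1 (h 1 x) = x" if "x \<in> S2" for x
    proof -
      have "g (h 1 x) = x" using g that by (simp add: homeomorphism_def)
      then show ?thesis using h(3) that by (simp add: k_def)
    qed
    then show ?thesis using h(4) gmap_id[OF G, of "k 1 \<circ> h 1"] by (simp add: gmap_comp)
  qed
  ultimately show ?thesis unfolding isotopic_gmap by blast
qed

lemma on_sphere_gmap: "homeomorphism S2 S2 f g \<Longrightarrow> on_sphere G \<Longrightarrow> on_sphere (gmap f G)"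
  by (force simp: on_sphere_def homeomorphism_def)

lemma isotopic_on_sphere: "isotopic G G' \<Longrightarrow> on_sphere G \<Longrightarrow> on_sphere G'"
  using isotopic_homeomorphism on_sphere_gmap by metis

lemma isotopy_class_eq:
  assumes "on_sphere G" "isotopic G G'"
  shows "isotopy_class G = isotopy_class G'"
  using assms isotopic_sym isotopic_trans
  unfolding isotopy_class_def isotopy_rel_def by blast

lemma mem_isotopy_class: "H \<in> isotopy_class G \<longleftrightarrow> isotopic G H"
  by (simp add: isotopy_class_def isotopy_rel_def)

lemma faces_subset: "F \<in> faces G \<Longrightarrow> F \<subseteq> S2"
  unfolding faces_def using in_components_subset by blast

lemma faces_gmap:
  assumes f: "homeomorphism S2 S2 f g" and G: "on_sphere G"
  shows "faces (gmap f G) = (`) f ` faces G"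
proof -
  have inj: "inj_on f S2" using f by (metis homeomorphism_def inj_on_inverseI)
  have fS: "f ` S2 = S2" using f by (simp add: homeomorphism_def)
  have "S2 - (verts (gmap f G) \<union> \<Union>(edges (gmap f G))) = f ` (S2 - (verts G \<union> \<Union>(edges G)))"
  proof -
    have "f ` (S2 - (verts G \<union> \<Union>(edges G))) = f ` S2 - f ` (verts G \<union> \<Union>(edges G))"
      using G by (intro inj_on_image_set_diff[OF inj]) (auto simp: on_sphere_def)
    also have "f ` (verts G \<union> \<Union>(edges G)) = verts (gmap f G) \<union> \<Union>(edges (gmap f G))" by auto
    finally show ?thesis using fS by simp
  qed
  then show ?thesis unfolding faces_def
    using homeomorphism_components_image[OF f, of "S2 - (verts G \<union> \<Union>(edges G))"] by simp
qed

lemma closure_sphere_image: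
  assumes f: "homeomorphism S2 S2 f g" and F: "F \<subseteq> S2"
  shows "closure (f ` F) = f ` closure F" "closure F \<subseteq> S2"
  using closure_continuous_image_compact[of S2 f F] f F closure_minimal[OF F]
  by (auto simp: homeomorphism_def)

lemma card_image_subsets:
  assumes "inj_on f S" "A \<subseteq> Pow S"
  shows "card ((`) f ` A) = card A"
  using assms by (intro card_image inj_on_subset[OF inj_on_image_Pow]) auto

lemma triangular_gmap:
  assumes f: "homeomorphism S2 S2 f g" and G: "on_sphere G" and F: "F \<in> faces G"
  shows "triangular (gmap f G) (f ` F) \<longleftrightarrow> triangular G F"
proof -
  have inj: "inj_on f S2" using f by (metis homeomorphism_def inj_on_inverseI)
  note cl = closure_sphere_image[OF f faces_subset[OF F]]
  have "f ` e \<subseteq> f ` closure F \<longleftrightarrow> e \<subseteq> closure F" if "e \<in> edges G" for e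
    using that G cl(2) by (intro inj_on_image_subset_iff[OF inj]) (auto simp: on_sphere_def)
  then have eq: "{e \<in> edges (gmap f G). e \<subseteq> closure (f ` F)} = (`) f ` {e \<in> edges G. e \<subseteq> closure F}"
    unfolding cl(1) by auto
  have sub: "{e \<in> edges G. e \<subseteq> closure F} \<subseteq> Pow S2" using G by (auto simp: on_sphere_def)
  show ?thesis unfolding triangular_def eq card_image_subsets[OF inj sub] ..
qed

lemma nontriangular_degree_gmap:
  assumes f: "homeomorphism S2 S2 f g" and G: "on_sphere G" and v: "v \<in> S2"
  shows "nontriangular_degree (gmap f G) (f v) = nontriangular_degree G v"
proof -
  have inj: "inj_on f S2" using f by (metis homeomorphism_def inj_on_inverseI)
  have "f v \<in> closure (f ` F) \<longleftrightarrow> v \<in> closure F" if "F \<in> faces G" for F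
    using closure_sphere_image[OF f faces_subset[OF that]] inj_on_image_mem_iff[OF inj v] by auto
  then have eq: "{F \<in> faces (gmap f G). f v \<in> closure F \<and> \<not> triangular (gmap f G) F} =
    (`) f ` {F \<in> faces G. v \<in> closure F \<and> \<not> triangular G F}"
    using triangular_gmap[OF f G] unfolding faces_gmap[OF f G] by auto
  have sub: "{F \<in> faces G. v \<in> closure F \<and> \<not> triangular G F} \<subseteq> Pow S2" using faces_subset by blast
  show ?thesis unfolding nontriangular_degree_def eq card_image_subsets[OF inj sub] ..
qed

lemma card_rigid_gmap:
  assumes f: "homeomorphism S2 S2 f g" and G: "on_sphere G"
  shows "card (rigid_vertices (gmap f G)) = card (rigid_vertices G)"
proof -
  have inj: "inj_on f S2" using f by (metis homeomorphism_def inj_on_inverseI)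
  have "rigid_vertices (gmap f G) = f ` rigid_vertices G"
    using nontriangular_degree_gmap[OF f G] G unfolding rigid_vertices_def on_sphere_def by auto
  moreover have "inj_on f (rigid_vertices G)"
    using G by (intro inj_on_subset[OF inj]) (auto simp: rigid_vertices_def on_sphere_def)
  ultimately show ?thesis by (simp add: card_image)
qed

lemma isotopic_card_rigid: "isotopic G G' \<Longrightarrow> on_sphere G \<Longrightarrow> card (rigid_vertices G') = card (rigid_vertices G)"
  using isotopic_homeomorphism card_rigid_gmap by metis

lemma isotopic_card_verts:
  assumes "isotopic G G'" "on_sphere G"
  shows "card (verts G') = card (verts G)"
proof -
  obtain f g where f: "homeomorphism S2 S2 f g" "G' = gmap f G" using isotopic_homeomorphism[OF assms(1)] .
  have "inj_on f S2" using f by (metis homeomorphism_def inj_on_inverseI)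
  then have "inj_on f (verts G)" using assms inj_on_subset by (auto simp: on_sphere_def)
  then show ?thesis using f by (simp add: card_image)
qed

section \<open>Isotopies induced by matrices\<close>

definition GL3 :: "(real^3^3) set" where "GL3 = {A. det A \<noteq> 0}"

lemma path_component_GL3_segment:
  assumes "\<And>t. 0 \<le> t \<Longrightarrow> t \<le> 1 \<Longrightarrow> det ((1 - t) *\<^sub>R X + t *\<^sub>R Y) \<noteq> 0"
  shows "path_component GL3 X Y"
proof -
  have "path_image (linepath X Y) \<subseteq> GL3"
    using assms by (auto simp: GL3_def path_image_def linepath_def)
  then show ?thesis
    unfolding path_component_def by (intro exI[of _ "linepath X Y"]) auto
qed

lemma path_component_GL3_linear:
  assumes f: "linear f" "\<And>A. det A \<noteq> 0 \<Longrightarrow> det (f A) \<noteq> 0" and "path_component GL3 X Y"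
  shows "path_component GL3 (f X) (f Y)"
proof -
  obtain p where p: "path p" "path_image p \<subseteq> GL3" "pathstart p = X" "pathfinish p = Y"
    using assms(3) unfolding path_component_def by auto
  have "path (f \<circ> p)"
    using p(1) linear_continuous_on[OF linear_linear[THEN iffD2, OF f(1)]] by (intro path_continuous_image)
  moreover have "path_image (f \<circ> p) \<subseteq> GL3"
    using p(2) f(2) by (auto simp: path_image_def GL3_def)
  ultimately show ?thesis
    unfolding path_component_def using p
    by (intro exI[of _ "f \<circ> p"]) (auto simp: pathstart_def pathfinish_def)
qed

lemma path_component_GL3_mult:
  assumes "path_component GL3 X Y" "det Z \<noteq> 0"
  shows path_component_GL3_mult_right: "path_component GL3 (X ** Z) (Y ** Z)"
    and path_component_GL3_mult_left: "path_component GL3 (Z ** X) (Z ** Y)"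
proof -
  have "linear (\<lambda>A. A ** Z)" "linear (\<lambda>A. Z ** A)"
    by (auto intro!: linearI simp: matrix_matrix_mult_def vec_eq_iff sum.distrib algebra_simps sum_distrib_left)
  from this[THEN path_component_GL3_linear[OF _ _ assms(1)]]
  show "path_component GL3 (X ** Z) (Y ** Z)" "path_component GL3 (Z ** X) (Z ** Y)"
    using assms(2) by (simp_all add: det_mul)
qed

definition diag3 :: "real \<Rightarrow> real \<Rightarrow> real \<Rightarrow> real^3^3" where
  "diag3 a b c = vector [vector [a, 0, 0], vector [0, b, 0], vector [0, 0, c]]"

lemma diag3_nth [simp]:
  "diag3 a b c $ 1 = vector [a, 0, 0]" "diag3 a b c $ 2 = vector [0, b, 0]" "diag3 a b c $ 3 = vector [0, 0, c]"
  by (simp_all add: diag3_def)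

lemma det_diag3: "det (diag3 a b c) = a * b * c"
  by (simp add: det_3)

lemma diag3_mult: "diag3 a b c ** diag3 a' b' c' = diag3 (a * a') (b * b') (c * c')"
  by (simp add: vec_eq_iff forall_3 matrix_matrix_mult_def sum_3)

lemma diag3_1: "diag3 1 1 1 = mat 1"
  by (simp add: vec_eq_iff forall_3 mat_def)

lemma sum_squares_pos: "(1 - t)\<^sup>2 + t\<^sup>2 > (0::real)"
  by (metis add_diff_cancel diff_0_right sum_power2_gt_zero_iff zero_neq_one cancel_comm_monoid_add_class.diff_cancel)

text \<open>Half turns about the coordinate axes. The straight segment from the identity would pass
  through a singular matrix; with a stop at the quarter turn the determinant is (1 - t)^2 + t^2 on
  both halves.\<close>

lemma path_component_two_signs:
  shows "path_component GL3 (mat 1) (diag3 (-1) (-1) 1)"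
    and "path_component GL3 (mat 1) (diag3 (-1) 1 (-1))"
    and "path_component GL3 (mat 1) (diag3 1 (-1) (-1))"
proof -
  have pos: "(1 - t) * (1 - t) + t * t \<noteq> (0::real)" for t
    using sum_squares_pos[of t] by (simp add: power2_eq_square)
  have "path_component GL3 (diag3 1 1 1) (vector [vector [0, -1, 0], vector [1, 0, 0], vector [0, 0, 1]])"
    by (rule path_component_GL3_segment) (use pos in \<open>simp add: det_3 algebra_simps\<close>)
  moreover have "path_component GL3 (vector [vector [0, -1, 0], vector [1, 0, 0], vector [0, 0, 1]]) (diag3 (-1) (-1) 1)"
    by (rule path_component_GL3_segment) (use pos in \<open>simp add: det_3 algebra_simps\<close>)
  ultimately show "path_component GL3 (mat 1) (diag3 (-1) (-1) 1)"
    unfolding diag3_1 by (rule path_component_trans)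
  have "path_component GL3 (diag3 1 1 1) (vector [vector [0, 0, -1], vector [0, 1, 0], vector [1, 0, 0]])"
    by (rule path_component_GL3_segment) (use pos in \<open>simp add: det_3 algebra_simps\<close>)
  moreover have "path_component GL3 (vector [vector [0, 0, -1], vector [0, 1, 0], vector [1, 0, 0]]) (diag3 (-1) 1 (-1))"
    by (rule path_component_GL3_segment) (use pos in \<open>simp add: det_3 algebra_simps\<close>)
  ultimately show "path_component GL3 (mat 1) (diag3 (-1) 1 (-1))"
    unfolding diag3_1 by (rule path_component_trans)
  have "path_component GL3 (diag3 1 1 1) (vector [vector [1, 0, 0], vector [0, 0, -1], vector [0, 1, 0]])"
    by (rule path_component_GL3_segment) (use pos in \<open>simp add: det_3 algebra_simps\<close>)
  moreover have "path_component GL3 (vector [vector [1, 0, 0], vector [0, 0, -1], vector [0, 1, 0]]) (diag3 1 (-1) (-1))"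
    by (rule path_component_GL3_segment) (use pos in \<open>simp add: det_3 algebra_simps\<close>)
  ultimately show "path_component GL3 (mat 1) (diag3 1 (-1) (-1))"
    unfolding diag3_1 by (rule path_component_trans)
qed

text \<open>The identity and one reflection represent the two path components of \<open>GL3\<close>;
  every invertible matrix is going to be joined to one of them.\<close>

definition "reflected_or_id A \<longleftrightarrow> path_component GL3 (mat 1) A \<or> path_component GL3 (diag3 (-1) 1 1) A"

lemma reflected_or_id_trans:
  "reflected_or_id A \<Longrightarrow> path_component GL3 A B \<Longrightarrow> reflected_or_id B"
  unfolding reflected_or_id_def using path_component_trans by blast

lemma reflected_or_id_diag3:
  assumes "a \<noteq> 0" "b \<noteq> 0" "c \<noteq> 0"
  shows "reflected_or_id (diag3 a b c)"
proof -
  have GL: "mat 1 \<in> GL3" "diag3 (-1) 1 1 \<in> GL3" by (simp_all add: GL3_def det_diag3)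
  have refl: "reflected_or_id (mat 1)" "reflected_or_id (diag3 (-1) 1 1)"
    using GL path_component_refl by (auto simp: reflected_or_id_def)
  have two: "reflected_or_id (diag3 (-1) (-1) 1)" "reflected_or_id (diag3 (-1) 1 (-1))" "reflected_or_id (diag3 1 (-1) (-1))"
    using path_component_two_signs by (auto simp: reflected_or_id_def)
  have D: "path_component GL3 (diag3 (-1) 1 1) (diag3 (-1) 1 1 ** X)" if "path_component GL3 (mat 1) X" for X
    using path_component_GL3_mult_left[OF that, of "diag3 (-1) 1 1"] by (simp add: det_diag3)
  have one: "reflected_or_id (diag3 1 (-1) 1)" "reflected_or_id (diag3 1 1 (-1))" "reflected_or_id (diag3 (-1) (-1) (-1))"
    using D[OF path_component_two_signs(1)] D[OF path_component_two_signs(2)] D[OF path_component_two_signs(3)]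
    by (simp_all add: diag3_mult reflected_or_id_def)
  have "sgn x = 1 \<or> sgn x = -1" if "x \<noteq> 0" for x :: real using that by (auto simp: sgn_if)
  from this[OF assms(1)] this[OF assms(2)] this[OF assms(3)]
  have "reflected_or_id (diag3 (sgn a) (sgn b) (sgn c))"
    using refl two one by (auto simp: diag3_1)
  moreover have "path_component GL3 (diag3 (sgn a) (sgn b) (sgn c)) (diag3 a b c)"
  proof (rule path_component_GL3_segment)
    fix t :: real assume t: "0 \<le> t" "t \<le> 1"
    have nz: "(1 - t) * sgn x + t * x \<noteq> 0" if "x \<noteq> 0" for x :: real
    proof -
      have "(1 - t) * sgn x + t * x = sgn x * ((1 - t) + t * \<bar>x\<bar>)"
        by (simp add: algebra_simps abs_mult_sgn sgn_mult_abs mult.left_commute)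
      moreover have "(1 - t) + t * \<bar>x\<bar> > 0"
        using t that by (cases "t = 0") (auto intro: add_nonneg_pos)
      ultimately show ?thesis using that by (simp add: sgn_eq_0_iff)
    qed
    have "(1 - t) *\<^sub>R diag3 (sgn a) (sgn b) (sgn c) + t *\<^sub>R diag3 a b c =
      diag3 ((1 - t) * sgn a + t * a) ((1 - t) * sgn b + t * b) ((1 - t) * sgn c + t * c)"
      by (simp add: vec_eq_iff forall_3)
    then show "det ((1 - t) *\<^sub>R diag3 (sgn a) (sgn b) (sgn c) + t *\<^sub>R diag3 a b c) \<noteq> 0"
      using nz assms by (simp add: det_diag3)
  qed
  ultimately show ?thesis by (rule reflected_or_id_trans)
qed

lemma reflected_or_id_mult:
  assumes A: "reflected_or_id A" and B: "reflected_or_id B"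
  shows "reflected_or_id (A ** B)"
proof -
  let ?D = "diag3 (-1) 1 1"
  have GL: "det A \<noteq> 0" "det B \<noteq> 0"
    using A B path_component_mem(2)[of GL3] unfolding reflected_or_id_def GL3_def by blast+
  have D: "det ?D \<noteq> 0" by (simp add: det_diag3)
  obtain X where X: "X = mat 1 \<or> X = ?D" "path_component GL3 X A" using A by (auto simp: reflected_or_id_def)
  obtain Y where Y: "Y = mat 1 \<or> Y = ?D" "path_component GL3 Y B" using B by (auto simp: reflected_or_id_def)
  have "X ** Y = mat 1 \<or> X ** Y = ?D" using X Y by (auto simp: diag3_mult diag3_1)
  moreover have "path_component GL3 (X ** Y) (X ** B)"
    using X D by (intro path_component_GL3_mult_left Y) auto
  moreover have "path_component GL3 (X ** B) (A ** B)"
    using GL by (intro path_component_GL3_mult_right X)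
  ultimately show ?thesis unfolding reflected_or_id_def by (metis path_component_trans)
qed

text \<open>Induction over elementary matrices: products multiply the paths, diagonal matrices
  reduce to their signs, and swaps and shears are joined to diagonal matrices by segments of
  invertible matrices.\<close>

lemma reflected_or_id: "det A \<noteq> 0 \<longrightarrow> reflected_or_id A"
proof (rule induct_matrix_elementary[where P = "\<lambda>A. det A \<noteq> 0 \<longrightarrow> reflected_or_id A"])
  fix A B :: "real^3^3"
  assume "det A \<noteq> 0 \<longrightarrow> reflected_or_id A" "det B \<noteq> 0 \<longrightarrow> reflected_or_id B"
  then show "det (A ** B) \<noteq> 0 \<longrightarrow> reflected_or_id (A ** B)"
    using reflected_or_id_mult by (auto simp: det_mul)
next
  fix A :: "real^3^3" and i
  assume "row i A = 0"
  then show "det A \<noteq> 0 \<longrightarrow> reflected_or_id A" using det_zero_row by blast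
next
  fix A :: "real^3^3"
  assume diagonal: "\<And>i j. i \<noteq> j \<Longrightarrow> A $ i $ j = 0"
  have "A = diag3 (A$1$1) (A$2$2) (A$3$3)"
    using diagonal by (simp add: vec_eq_iff forall_3)
  then show "det A \<noteq> 0 \<longrightarrow> reflected_or_id A" using reflected_or_id_diag3 det_diag3 by (metis mult_eq_0_iff)
next
  fix m n :: 3
  assume swap1: "m \<noteq> n"
  let ?S = "\<chi> i j. mat 1 $ i $ Transposition.transpose m n j :: real^3^3"
  \<comment> \<open>The entry -1 in place \<open>n\<close> gives \<open>?M\<close> the orientation
    of the swap; along the segment the determinant is -((1 - t)^2 + t^2).\<close>
  let ?M = "diag3 (if n = 1 then -1 else 1) (if n = 2 then -1 else 1) (if n = 3 then -1 else 1)"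
  have pos: "(1 - t) * (1 - t) + t * t \<noteq> (0::real)" for t
    using sum_squares_pos[of t] by (simp add: power2_eq_square)
  have "path_component GL3 ?M ?S"
  proof (rule path_component_GL3_segment)
    fix t :: real
    show "det ((1 - t) *\<^sub>R ?M + t *\<^sub>R ?S) \<noteq> 0"
      using exhaust_3[of m] exhaust_3[of n] swap1 pos[of t]
      by (elim disjE) (simp_all add: det_3 mat_def Transposition.transpose_def algebra_simps)
  qed
  moreover have "reflected_or_id ?M" by (intro reflected_or_id_diag3) auto
  ultimately have "reflected_or_id ?S" by (rule reflected_or_id_trans[rotated])
  then show "det ?S \<noteq> 0 \<longrightarrow> reflected_or_id ?S" ..
next
  fix m n :: 3 and c :: real
  assume idplus: "m \<noteq> n"
  let ?S = "\<chi> i j. if i = m \<and> j = n then c else of_bool (i = j) :: real^3^3"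
  have "path_component GL3 (diag3 1 1 1) ?S"
  proof (rule path_component_GL3_segment)
    fix t :: real
    show "det ((1 - t) *\<^sub>R diag3 1 1 1 + t *\<^sub>R ?S) \<noteq> 0"
      using exhaust_3[of m] exhaust_3[of n] idplus
      by (elim disjE) (simp_all add: det_3 algebra_simps)
  qed
  then show "det ?S \<noteq> 0 \<longrightarrow> reflected_or_id ?S" using reflected_or_id_trans[of "diag3 1 1 1"] reflected_or_id_diag3[of 1 1 1] by simp
qed

lemma continuous_on_det3: "continuous_on UNIV (\<lambda>A::real^3^3. det A)"
  unfolding det_3 by (intro continuous_intros)

text \<open>A path from the reflection to a matrix of positive determinant would pass through
  determinant 0, by continuity.\<close>

lemma path_component_pos_det:
  assumes "det A > 0"
  shows "path_component GL3 (mat 1) A"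
proof (rule ccontr)
  assume "\<not> ?thesis"
  then have "path_component GL3 (diag3 (-1) 1 1) A"
    using reflected_or_id[of A] assms by (auto simp: reflected_or_id_def)
  then obtain p where p: "path p" "path_image p \<subseteq> GL3" "pathstart p = diag3 (-1) 1 1" "pathfinish p = A"
    unfolding path_component_def by auto
  have "connected (det ` path_image p)"
    using p continuous_on_subset[OF continuous_on_det3] by (intro connected_continuous_image connected_path_image) auto
  moreover have "-1 \<in> det ` path_image p"
    using p pathstart_in_path_image[of p] by (force simp: det_diag3 image_iff)
  moreover have "det A \<in> det ` path_image p"
    using p pathfinish_in_path_image[of p] by force
  ultimately have "0 \<in> det ` path_image p"
    using assms connectedD_interval[of "det ` path_image p" "-1" "det A" 0] by simp
  then show False using p by (auto simp: GL3_def)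
qed

lemma sgn_matrix_sgn:
  fixes A :: "real^3^3"
  assumes "y \<noteq> 0"
  shows "sgn (A *v sgn y) = sgn (A *v y)"
proof -
  have "A *v sgn y = inverse (norm y) *\<^sub>R (A *v y)"
    by (simp add: sgn_div_norm matrix_vector_mult_scaleR)
  then show ?thesis using assms by (simp add: sgn_scaleR)
qed

lemma matrix_nonzero:
  fixes A :: "real^3^3"
  assumes "det A \<noteq> 0" "x \<noteq> 0"
  shows "A *v x \<noteq> 0"
  using assms invertible_det_nz matrix_left_invertible_ker invertible_left_inverse by metis

lemma homeomorphism_sgn_matrix:
  fixes A :: "real^3^3"
  assumes "det A \<noteq> 0"
  shows "\<exists>g. homeomorphism S2 S2 (\<lambda>x. sgn (A *v x)) g"
proof -
  obtain B where B: "A ** B = mat 1" "B ** A = mat 1"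
    using assms invertible_det_nz invertible_def by metis
  have dB: "det B \<noteq> 0" using B det_mul[of A B] by auto
  have "x \<noteq> 0" if "x \<in> S2" for x :: "real^3" using that by auto
  have K: "continuous_on S2 (\<lambda>x. sgn (C *v x))" "\<And>x. x \<in> S2 \<Longrightarrow> sgn (C *v x) \<in> S2"
    if "det C \<noteq> 0" for C :: "real^3^3"
  proof -
    have "C *v x \<noteq> 0" if "x \<in> S2" for x
    proof -
      have "x \<noteq> 0" using that by auto
      then show ?thesis using matrix_nonzero \<open>det C \<noteq> 0\<close> by blast
    qed
    then show "continuous_on S2 (\<lambda>x. sgn (C *v x))" "\<And>x. x \<in> S2 \<Longrightarrow> sgn (C *v x) \<in> S2"
      by (auto intro!: continuous_on_sgn matrix_vector_mult_linear_continuous_on simp: norm_sgn)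
  qed
  have inv: "sgn (D *v sgn (C *v x)) = x" if "det C \<noteq> 0" "D ** C = mat 1" "x \<in> S2" for C D :: "real^3^3" and x
  proof -
    have "x \<noteq> 0" using that(3) by auto
    then have "C *v x \<noteq> 0" using matrix_nonzero that(1) by blast
    then have "sgn (D *v sgn (C *v x)) = sgn (D *v (C *v x))" by (rule sgn_matrix_sgn)
    also have "\<dots> = sgn x" using that by (simp add: matrix_vector_mul_assoc)
    also have "\<dots> = x" using that by (simp add: sgn_div_norm)
    finally show ?thesis .
  qed
  have "homeomorphism S2 S2 (\<lambda>x. sgn (A *v x)) (\<lambda>x. sgn (B *v x))"
  proof (rule homeomorphismI)
    show "(\<lambda>x. sgn (A *v x)) ` S2 \<subseteq> S2" "(\<lambda>x. sgn (B *v x)) ` S2 \<subseteq> S2"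
      using K(2)[OF assms] K(2)[OF dB] by blast+
  qed (use K(1)[OF assms] K(1)[OF dB] inv[OF assms B(2)] inv[OF dB B(1)] in auto)
  then show ?thesis by blast
qed

text \<open>A path of invertible matrices from the identity to \<open>A\<close>, acting on unit
  vectors with renormalisation, is an ambient isotopy.\<close>

lemma isotopic_matrix:
  assumes "det A > 0"
  shows "isotopic G (gmap (\<lambda>x. sgn (A *v x)) G)"
proof -
  obtain p where p: "path p" "path_image p \<subseteq> GL3" "pathstart p = mat 1" "pathfinish p = A"
    using path_component_pos_det[OF assms] unfolding path_component_def by auto
  have nz: "det (p t) \<noteq> 0" if "t \<in> {0..1}" for t
  proof -
    have "p t \<in> path_image p" using that by (simp add: path_image_def)
    then show ?thesis using p(2) by (auto simp: GL3_def)
  qed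
  have "continuous_on ({0..1} \<times> S2) (\<lambda>q. p (fst q) *v snd q)"
  proof -
    have "continuous_on ({0..1} \<times> S2) (\<lambda>q. p (fst q))"
      by (rule continuous_on_compose2[OF p(1)[unfolded path_def] continuous_on_fst[OF continuous_on_id]]) auto
    then show ?thesis
      unfolding matrix_vector_mult_def by (intro continuous_intros)
  qed
  then have "continuous_on ({0..1} \<times> S2) (\<lambda>q. sgn (p (fst q) *v snd q))"
  proof (rule continuous_on_sgn)
    show "\<forall>q\<in>{0..1} \<times> S2. p (fst q) *v snd q \<noteq> 0"
    proof
      fix q :: "real \<times> (real^3)" assume q: "q \<in> {0..1} \<times> S2"
      then have "snd q \<noteq> 0" by auto
      moreover have "det (p (fst q)) \<noteq> 0" using q by (intro nz) auto
      ultimately show "p (fst q) *v snd q \<noteq> 0" using matrix_nonzero by blast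
    qed
  qed
  moreover have "(\<lambda>q. sgn (p (fst q) *v snd q)) = (\<lambda>(t, x). sgn (p t *v x))"
    by (simp add: split_def)
  ultimately have "continuous_on ({0..1} \<times> S2) (\<lambda>(t, x). sgn (p t *v x))"
    by (simp only:)
  moreover have "\<forall>t\<in>{0..1}. \<exists>g. homeomorphism S2 S2 (\<lambda>x. sgn (p t *v x)) g"
    using nz homeomorphism_sgn_matrix by blast
  moreover have "\<forall>x\<in>S2. sgn (p 0 *v x) = x"
    using p(3) by (simp add: pathstart_def sgn_div_norm)
  moreover have "p 1 = A" using p(4) by (simp add: pathfinish_def)
  ultimately show ?thesis
    unfolding isotopic_gmap by (intro exI[of _ "\<lambda>t x. sgn (p t *v x)"] conjI) simp_all
qed

section \<open>Skeletons of polytopes\<close>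

text \<open>Of two frontier points on one ray from \<open>c\<close>, the nearer would lie strictly
  between an interior point and a point of the closure, hence in the interior.\<close>

lemma convex_frontier_ray_inj:
  fixes S :: "'a::euclidean_space set"
  assumes S: "convex S" and c: "c \<in> interior S" and x: "x \<in> frontier S" and y: "y \<in> frontier S"
    and eq: "sgn (x - c) = sgn (y - c)"
  shows "x = y"
proof -
  have K: False if x: "x \<in> frontier S" and y: "y \<in> frontier S" and eq: "sgn (x - c) = sgn (y - c)"
     and lt: "norm (x - c) < norm (y - c)" for x y
  proof -
    have "x \<noteq> c" using x c by (auto simp: frontier_def)
    define r where "r = norm (x - c) / norm (y - c)"
    have ny: "norm (y - c) > 0" using lt norm_ge_zero[of "x - c"] by linarith
    have r: "0 < r" "r < 1" using \<open>x \<noteq> c\<close> lt ny by (auto simp: r_def)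
    have "x - c = norm (x - c) *\<^sub>R sgn (x - c)" using \<open>x \<noteq> c\<close> by (simp add: sgn_div_norm)
    also have "\<dots> = r *\<^sub>R (y - c)" unfolding eq by (simp add: sgn_div_norm r_def divide_inverse)
    finally have "x = c + r *\<^sub>R (y - c)" by (metis add_diff_cancel_left' diff_add_cancel add.commute)
    then have "x = (1 - r) *\<^sub>R c + r *\<^sub>R y" by (simp add: algebra_simps)
    moreover have "c \<noteq> y" using ny by auto
    ultimately have "x \<in> open_segment c y" using r by (auto simp: in_segment)
    moreover have "y \<in> closure S" using y by (simp add: frontier_def)
    ultimately have "x \<in> interior S" using in_interior_closure_convex_segment[OF S c] by blast
    then show False using x by (simp add: frontier_def)
  qed
  have "norm (x - c) = norm (y - c)"
    using K[OF x y eq] K[OF y x eq[symmetric]] by (meson linorder_less_linear)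
  moreover have "x - c = norm (x - c) *\<^sub>R sgn (x - c)" for x by (cases "x = c") (simp_all add: sgn_div_norm)
  ultimately have "x - c = y - c" using eq by metis
  then show ?thesis by simp
qed

lemma homeomorphism_frontier_sphere:
  fixes S :: "'a::euclidean_space set"
  assumes S: "compact S" "convex S" and c: "c \<in> interior S"
  shows "\<exists>g. homeomorphism (frontier S) (sphere 0 1) (\<lambda>x. sgn (x - c)) g"
proof (rule homeomorphism_compact)
  have ne: "x - c \<noteq> 0" if "x \<in> frontier S" for x using that c by (auto simp: frontier_def)
  show "compact (frontier S)" using S by (simp add: compact_frontier)
  show "continuous_on (frontier S) (\<lambda>x. sgn (x - c))"
    using ne by (intro continuous_on_sgn continuous_intros) auto
  show "inj_on (\<lambda>x. sgn (x - c)) (frontier S)"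
    using convex_frontier_ray_inj[OF S(2) c] by (intro inj_onI) blast
  show "(\<lambda>x. sgn (x - c)) ` frontier S = sphere 0 1"
  proof
    show "(\<lambda>x. sgn (x - c)) ` frontier S \<subseteq> sphere 0 1" using ne by (auto simp: norm_sgn)
    show "sphere 0 1 \<subseteq> (\<lambda>x. sgn (x - c)) ` frontier S"
    proof
      fix y :: 'a assume y: "y \<in> sphere 0 1"
      then have "y \<noteq> 0" by auto
      then obtain r where r: "0 < r" "c + r *\<^sub>R y \<in> frontier S"
        using ray_to_frontier[OF compact_imp_bounded[OF S(1)] c] by metis
      have "sgn (c + r *\<^sub>R y - c) = y" using r y by (simp add: sgn_scaleR sgn_div_norm)
      then show "y \<in> (\<lambda>x. sgn (x - c)) ` frontier S" using r by (metis image_eqI)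
    qed
  qed
qed

section \<open>The radial drawing of the skeleton\<close>

definition "proj c x = sgn (x - c)" for c x :: "real^3"

context polytope3 begin

lemma frontier_P: "frontier P = \<Union>Fc"
  using rel_frontier_of_polyhedron[OF polyhedron_P] rel_frontier_nonempty_interior[OF interior_P]
  by (simp add: Fc_def)

lemma face_subset_frontier:
  assumes "T face_of P" "aff_dim T < 3"
  shows "T \<subseteq> frontier P"
proof -
  have "T \<noteq> P" using assms aff_dim_P by auto
  then show ?thesis
    using assms rel_frontier_of_polyhedron_alt[OF polyhedron_P] rel_frontier_nonempty_interior[OF interior_P] by blast
qed

lemma V_frontier: "V \<subseteq> frontier P"
proof
  fix v assume "v \<in> V"
  then have "{v} face_of P" by (simp add: V_def face_of_singleton)
  then show "v \<in> frontier P" using face_subset_frontier[of "{v}"] by simp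
qed

lemma E_frontier: "e \<in> E \<Longrightarrow> e \<subseteq> frontier P"
  using face_subset_frontier edge_face by auto

lemma Fc_frontier: "F \<in> Fc \<Longrightarrow> F \<subseteq> frontier P"
  using frontier_P by blast

lemma facet_closed: "F \<in> Fc \<Longrightarrow> closed F"
  using facet_polytope polytope_imp_closed by blast

lemma face_subset_if_meets_rel_interior:
  assumes "F face_of P" "T face_of P" "x \<in> T" "x \<in> rel_interior F"
  shows "F \<subseteq> T"
  using subset_of_face_of[of T P F] assms face_of_imp_subset by blast

lemma rel_frontier_facet:
  assumes "F \<in> Fc"
  shows "F - rel_interior F = \<Union>{e \<in> E. e \<subseteq> F}"
proof -
  have "polyhedron F" using facet_polytope assms polytope_imp_polyhedron by blast
  then have "rel_frontier F = \<Union>{e. e facet_of F}" by (rule rel_frontier_of_polyhedron)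
  moreover have "rel_frontier F = F - rel_interior F"
    using facet_closed[OF assms] by (simp add: rel_frontier_def)
  ultimately show ?thesis using edges_of_facet[OF assms] by auto
qed

lemma frontier_minus_skeleton: "frontier P - (V \<union> \<Union>E) = \<Union>(rel_interior ` Fc)"
proof
  show "frontier P - (V \<union> \<Union>E) \<subseteq> \<Union>(rel_interior ` Fc)"
    using frontier_P rel_frontier_facet by blast
  show "\<Union>(rel_interior ` Fc) \<subseteq> frontier P - (V \<union> \<Union>E)"
  proof
    fix x assume "x \<in> \<Union>(rel_interior ` Fc)"
    then obtain F where F: "F \<in> Fc" "x \<in> rel_interior F" by blast
    have no: False if "T face_of P" "aff_dim T < 2" "x \<in> T" for T
      using face_subset_if_meets_rel_interior[OF facet_face(1)[OF F(1)] that(1,3) F(2)] that(2)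
        aff_dim_subset[of F T] facet_face(2)[OF F(1)] by simp
    have "x \<notin> V" using no[of "{x}"] by (auto simp: V_def face_of_singleton)
    moreover have "x \<notin> e" if "e \<in> E" for e using no[of e] edge_face that by auto
    moreover have "x \<in> frontier P" using F Fc_frontier rel_interior_subset by blast
    ultimately show "x \<in> frontier P - (V \<union> \<Union>E)" by blast
  qed
qed

lemma rel_interior_facets_disjoint:
  "F \<in> Fc \<Longrightarrow> G \<in> Fc \<Longrightarrow> F \<noteq> G \<Longrightarrow> G \<inter> rel_interior F = {}"
  using face_subset_if_meets_rel_interior facet_face(1) facet_of_subset_eq[of F P G] unfolding Fc_def by blast

text \<open>What remains of the frontier is the disjoint union of the open facets. Each is convex,
  hence connected, and relatively open because the other facets are closed and finitely
  many.\<close>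

lemma components_frontier_minus_skeleton:
  "components (frontier P - (V \<union> \<Union>E)) = rel_interior ` Fc"
  unfolding frontier_minus_skeleton
proof (rule components_eq_open_partition)
  fix C assume "C \<in> rel_interior ` Fc"
  then obtain F where F: "F \<in> Fc" "C = rel_interior F" by blast
  have cF: "convex F" using facet_face(1) F face_of_imp_convex by blast
  then show "connected C \<and> C \<noteq> {}"
    using F facet_ne rel_interior_eq_empty convex_rel_interior convex_connected by metis
  have "closed (\<Union>(Fc - {F}))" using finite_Fc facet_closed by (intro closed_Union) auto
  moreover have "C = \<Union>(rel_interior ` Fc) - \<Union>(Fc - {F})"
  proof
    show "C \<subseteq> \<Union>(rel_interior ` Fc) - \<Union>(Fc - {F})"
      using F rel_interior_facets_disjoint by blast
    show "\<Union>(rel_interior ` Fc) - \<Union>(Fc - {F}) \<subseteq> C"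
      using F(2) rel_interior_subset by blast
  qed
  then have "C = \<Union>(rel_interior ` Fc) \<inter> - \<Union>(Fc - {F})" by blast
  ultimately show "openin (top_of_set (\<Union>(rel_interior ` Fc))) C"
    by (metis open_Compl openin_open_Int)
  fix D assume D: "D \<in> rel_interior ` Fc" "C \<noteq> D"
  then show "C \<inter> D = {}" using F rel_interior_facets_disjoint rel_interior_subset by blast
qed

lemma skeleton_gmap: "skeleton_graph c P = gmap (proj c) (SGraph V E)"
  by (simp add: skeleton_graph_def gmap_def proj_def[abs_def] V_def E_def)

context
  fixes c assumes c: "c \<in> interior P"
begin

lemma proj_homeomorphism:
  obtains g where "homeomorphism (frontier P) S2 (proj c) g"
  using homeomorphism_frontier_sphere[OF polytope_imp_compact[OF polytope_P] convex_P c]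
  by (auto simp: proj_def[abs_def])

lemma inj_proj: "inj_on (proj c) (frontier P)"
  using proj_homeomorphism by (metis homeomorphism_def inj_on_inverseI)

lemma proj_image: "proj c ` frontier P = S2"
  using proj_homeomorphism by (metis homeomorphism_def)

lemma on_sphere_skeleton: "on_sphere (skeleton_graph c P)"
proof -
  have "proj c ` X \<subseteq> S2" if "X \<subseteq> frontier P" for X using image_mono[OF that] proj_image by metis
  then show ?thesis
    unfolding skeleton_gmap on_sphere_def using V_frontier E_frontier by simp
qed

lemma faces_skeleton: "faces (skeleton_graph c P) = (\<lambda>F. proj c ` rel_interior F) ` Fc"
proof -
  obtain g where g: "homeomorphism (frontier P) S2 (proj c) g" by (rule proj_homeomorphism)
  have "S2 - (proj c ` V \<union> \<Union>((`) (proj c) ` E)) = proj c ` (frontier P - (V \<union> \<Union>E))"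
  proof -
    have "proj c ` (frontier P - (V \<union> \<Union>E)) = proj c ` frontier P - proj c ` (V \<union> \<Union>E)"
      using V_frontier E_frontier by (intro inj_on_image_set_diff[OF inj_proj]) auto
    then show ?thesis using proj_image by auto
  qed
  then show ?thesis
    using homeomorphism_components_image[OF g, of "frontier P - (V \<union> \<Union>E)"]
    by (simp add: faces_def skeleton_gmap components_frontier_minus_skeleton image_image)
qed

lemma closure_face_skeleton:
  assumes "F \<in> Fc"
  shows "closure (proj c ` rel_interior F) = proj c ` F"
proof -
  obtain g where g: "homeomorphism (frontier P) S2 (proj c) g" by (rule proj_homeomorphism)
  have "compact (frontier P)" using polytope_imp_compact[OF polytope_P] by (simp add: compact_frontier)
  then have "closure (proj c ` rel_interior F) = proj c ` closure (rel_interior F)"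
    using g Fc_frontier[OF assms] rel_interior_subset[of F]
    by (intro closure_continuous_image_compact[of "frontier P"]) (auto simp: homeomorphism_def)
  also have "closure (rel_interior F) = F"
    using convex_closure_rel_interior[of F] facet_closed[OF assms] facet_face(1)[OF assms] face_of_imp_convex
    by (metis closure_closed)
  finally show ?thesis .
qed

text \<open>\<open>triangular\<close> counts edges in the closure whereas \<open>fsize\<close>
  counts vertices; a facet has as many of the one as of the other.\<close>

lemma triangular_skeleton:
  assumes F: "F \<in> Fc"
  shows "triangular (skeleton_graph c P) (proj c ` rel_interior F) \<longleftrightarrow> fsize F = 3"
proof -
  have "proj c ` e \<subseteq> proj c ` F \<longleftrightarrow> e \<subseteq> F" if "e \<in> E" for e
    using that F E_frontier Fc_frontier by (intro inj_on_image_subset_iff[OF inj_proj]) auto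
  then have eq: "{e \<in> edges (skeleton_graph c P). e \<subseteq> closure (proj c ` rel_interior F)} = (`) (proj c) ` {e \<in> E. e \<subseteq> F}"
    unfolding closure_face_skeleton[OF F] by (auto simp: skeleton_gmap)
  have sub: "{e \<in> E. e \<subseteq> F} \<subseteq> Pow (frontier P)" using E_frontier by blast
  show ?thesis
    unfolding triangular_def eq card_image_subsets[OF inj_proj sub] fsize_edges[OF F] ..
qed

lemma nontriangular_degree_skeleton:
  assumes v: "v \<in> V"
  shows "nontriangular_degree (skeleton_graph c P) (proj c v) = d v"
proof -
  have "proj c v \<in> proj c ` F \<longleftrightarrow> v \<in> F" if "F \<in> Fc" for F
    using inj_on_image_mem_iff[OF inj_proj _ Fc_frontier[OF that]] v V_frontier by blast
  then have eq: "{F \<in> faces (skeleton_graph c P). proj c v \<in> closure F \<and> \<not> triangular (skeleton_graph c P) F} =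
    (\<lambda>F. proj c ` rel_interior F) ` {F \<in> Fc. v \<in> F \<and> fsize F \<noteq> 3}"
    unfolding faces_skeleton using closure_face_skeleton triangular_skeleton by auto
  have "inj_on (\<lambda>F. proj c ` rel_interior F) Fc"
  proof (rule inj_onI)
    fix F G assume FG: "F \<in> Fc" "G \<in> Fc" "proj c ` rel_interior F = proj c ` rel_interior G"
    then have "proj c ` F = proj c ` G" using closure_face_skeleton by metis
    then show "F = G" using inj_on_image_eq_iff[OF inj_proj] Fc_frontier FG by blast
  qed
  then have "inj_on (\<lambda>F. proj c ` rel_interior F) {F \<in> Fc. v \<in> F \<and> fsize F \<noteq> 3}"
    by (rule inj_on_subset) auto
  then show ?thesis unfolding nontriangular_degree_def eq by (simp add: card_image d_def)
qed

lemma card_verts_skeleton: "card (verts (skeleton_graph c P)) = card V"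
  using inj_on_subset[OF inj_proj V_frontier] by (simp add: skeleton_gmap card_image)

lemma card_rigid_skeleton: "card (rigid_vertices (skeleton_graph c P)) = card R"
proof -
  have "rigid_vertices (skeleton_graph c P) = proj c ` R"
    unfolding rigid_vertices_def R_def
    using nontriangular_degree_skeleton by (auto simp: skeleton_gmap)
  moreover have "inj_on (proj c) R" using inj_on_subset[OF inj_proj] R_V V_frontier by blast
  ultimately show ?thesis by (simp add: card_image)
qed

end

text \<open>Lift the sphere to the frontier by the inverse of the first projection and project back
  from a centre moving along the segment from \<open>c\<close> to \<open>c'\<close>, which stays in
  the interior.\<close>

lemma isotopic_centre:
  assumes c: "c \<in> interior P" and c': "c' \<in> interior P"
  shows "isotopic (skeleton_graph c P) (skeleton_graph c' P)"
proof -
  obtain g where g: "homeomorphism (frontier P) S2 (proj c) g" using proj_homeomorphism[OF c] .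
  have gS: "g x \<in> frontier P" "continuous_on S2 g" "proj c (g x) = x" if "x \<in> S2" for x
    using g that by (auto simp: homeomorphism_def)
  have gp: "g (proj c x) = x" if "x \<in> frontier P" for x using g that by (simp add: homeomorphism_def)
  define ct where "ct t = (1 - t) *\<^sub>R c + t *\<^sub>R c'" for t
  have ct: "ct t \<in> interior P" if "t \<in> {0..1}" for t
    unfolding ct_def using convexD_alt[OF convex_interior[OF convex_P] c c'] that by auto
  define h where "h t x = proj (ct t) (g x)" for t x
  have "continuous_on S2 g" using g by (simp add: homeomorphism_def)
  then have "continuous_on ({0..1} \<times> S2) (\<lambda>q. g (snd q))"
    by (rule continuous_on_compose2[OF _ continuous_on_snd[OF continuous_on_id]]) auto
  then have "continuous_on ({0..1} \<times> S2) (\<lambda>q. sgn (g (snd q) - ct (fst q)))"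
  proof (intro continuous_on_sgn continuous_on_diff)
    show "continuous_on ({0..1} \<times> S2) (\<lambda>q. ct (fst q))"
      unfolding ct_def by (intro continuous_intros)
    show "\<forall>q\<in>{0..1} \<times> S2. g (snd q) - ct (fst q) \<noteq> 0"
    proof
      fix q :: "real \<times> (real^3)" assume "q \<in> {0..1} \<times> S2"
      then have "g (snd q) \<in> frontier P" "ct (fst q) \<in> interior P" using gS(1) ct by auto
      then show "g (snd q) - ct (fst q) \<noteq> 0" by (auto simp: frontier_def)
    qed
  qed
  moreover have "(\<lambda>q. sgn (g (snd q) - ct (fst q))) = (\<lambda>(t, x). h t x)"
    by (simp add: split_def h_def proj_def)
  ultimately have "continuous_on ({0..1} \<times> S2) (\<lambda>(t, x). h t x)" by (simp only:)
  moreover have "\<forall>t\<in>{0..1}. \<exists>g'. homeomorphism S2 S2 (h t) g'"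
  proof
    fix t :: real assume "t \<in> {0..1}"
    then obtain k where "homeomorphism (frontier P) S2 (proj (ct t)) k" using proj_homeomorphism[OF ct] by metis
    then have "homeomorphism S2 S2 (proj (ct t) \<circ> g) (proj c \<circ> k)"
      using homeomorphism_compose homeomorphism_symD[OF g] by blast
    moreover have "proj (ct t) \<circ> g = h t" by (simp add: fun_eq_iff h_def)
    ultimately show "\<exists>g'. homeomorphism S2 S2 (h t) g'" by metis
  qed
  moreover have "\<forall>x\<in>S2. h 0 x = x" using gS(3) by (simp add: h_def ct_def)
  moreover have "skeleton_graph c' P = gmap (h 1) (skeleton_graph c P)"
  proof -
    have "h 1 (proj c x) = proj c' x" if "x \<in> frontier P" for x
      using gp[OF that] by (simp add: h_def ct_def)
    then have "(\<lambda>x. h 1 (proj c x)) ` X = proj c' ` X" if "X \<subseteq> frontier P" for X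
      using that by (intro image_cong) auto
    then show ?thesis
      using V_frontier E_frontier unfolding skeleton_gmap gmap_def by (auto simp: image_image)
  qed
  ultimately show ?thesis unfolding isotopic_gmap by blast
qed

end

section \<open>Affine relations between the vertices\<close>

definition affine_relation :: "'a::real_vector set \<Rightarrow> ('a \<Rightarrow> real) \<Rightarrow> bool" where
  "affine_relation W L \<longleftrightarrow> sum L W = 0 \<and> (\<Sum>v\<in>W. L v *\<^sub>R v) = 0"

text \<open>The affine relations form at most a line: it is spanned by \<open>L\<close> for five
  vertices and trivial, with \<open>L\<close> zero, for four. One notion covers both cases.\<close>

definition generates_relations :: "'a::real_vector set \<Rightarrow> ('a \<Rightarrow> real) \<Rightarrow> bool" where
  "generates_relations W L \<longleftrightarrow> affine_relation W L \<and>
     (\<forall>a. affine_relation W a \<longrightarrow> (\<exists>\<kappa>. \<forall>v\<in>W. a v = \<kappa> * L v))"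

lemma generates_relations_uminus:
  assumes "generates_relations W L" shows "generates_relations W (\<lambda>v. - L v)"
proof -
  have "affine_relation W (\<lambda>v. - L v)"
    using assms by (simp add: generates_relations_def affine_relation_def sum_negf)
  moreover have "\<exists>\<kappa>. \<forall>v\<in>W. a v = \<kappa> * - L v" if a: "affine_relation W a" for a
  proof -
    obtain \<kappa> where "\<forall>v\<in>W. a v = \<kappa> * L v" using assms a unfolding generates_relations_def by blast
    then show ?thesis by (intro exI[of _ "- \<kappa>"]) simp
  qed
  ultimately show ?thesis by (simp add: generates_relations_def)
qed

text \<open>These weights remove the metric content of the relation: the vectors
  \<open>ray W L v\<close> sum to 0, and so do they with coefficients \<open>sgn (L v)\<close>. The
  value 1 keeps the weight positive where \<open>L\<close> vanishes.\<close>

definition wt :: "('a \<Rightarrow> real) \<Rightarrow> 'a \<Rightarrow> real" where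
  "wt L v = (if L v = 0 then 1 else \<bar>L v\<bar>)"

definition ctr :: "'a::real_vector set \<Rightarrow> ('a \<Rightarrow> real) \<Rightarrow> 'a" where
  "ctr W L = (1 / sum (wt L) W) *\<^sub>R (\<Sum>v\<in>W. wt L v *\<^sub>R v)"

definition ray :: "'a::real_vector set \<Rightarrow> ('a \<Rightarrow> real) \<Rightarrow> 'a \<Rightarrow> 'a" where
  "ray W L v = wt L v *\<^sub>R (v - ctr W L)"

lemma wt_pos: "wt L v > 0"
  by (simp add: wt_def)

lemma sum_wt_pos: "finite W \<Longrightarrow> W \<noteq> {} \<Longrightarrow> sum (wt L) W > 0"
  by (intro sum_pos) (auto simp: wt_pos)

lemma sgn_wt: "sgn (L v) * wt L v = L v"
  by (simp add: wt_def sgn_mult_abs)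

lemma sum_scaled_rays:
  "(\<Sum>v\<in>W. a v *\<^sub>R ray W L v) = (\<Sum>v\<in>W. (a v * wt L v) *\<^sub>R v) - (\<Sum>v\<in>W. a v * wt L v) *\<^sub>R ctr W L"
  by (simp add: ray_def scaleR_diff_right sum_subtractf scaleR_left.sum)

lemma sum_rays:
  assumes "finite W" "W \<noteq> {}"
  shows "(\<Sum>v\<in>W. ray W L v) = 0"
  using sum_scaled_rays[of "\<lambda>_. 1" W L] sum_wt_pos[OF assms, of L] by (simp add: ctr_def)

lemma sum_signed_rays:
  assumes "affine_relation W L"
  shows "(\<Sum>v\<in>W. sgn (L v) *\<^sub>R ray W L v) = 0"
  using assms unfolding sum_scaled_rays sgn_wt affine_relation_def by simp

text \<open>Subtracting the weighted mean \<alpha> from the coefficients turns a linear relation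
  between rays into an affine relation between points, which is a multiple of \<open>L\<close>. So
  the linear relations between the rays are determined by the signs of \<open>L\<close>
  alone.\<close>

lemma relation_of_rays:
  assumes W: "finite W" "W \<noteq> {}" and L: "generates_relations W L"
    and a: "(\<Sum>v\<in>W. a v *\<^sub>R ray W L v) = 0"
  obtains \<alpha> \<beta> where "\<And>v. v \<in> W \<Longrightarrow> a v = \<alpha> + \<beta> * sgn (L v)"
proof -
  let ?s = "sum (wt L) W"
  have s: "?s > 0" using sum_wt_pos[OF W] .
  define \<alpha> where "\<alpha> = (\<Sum>v\<in>W. a v * wt L v) / ?s"
  define b where "b v = (a v - \<alpha>) * wt L v" for v
  have "sum b W = (\<Sum>v\<in>W. a v * wt L v) - \<alpha> * ?s"
    by (simp add: b_def left_diff_distrib sum_subtractf sum_distrib_left)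
  then have b0: "sum b W = 0" using s by (simp add: \<alpha>_def)
  have "(\<Sum>v\<in>W. (a v - \<alpha>) *\<^sub>R ray W L v) = 0"
    using a sum_rays[OF W, of L] by (simp add: scaleR_diff_left sum_subtractf flip: scaleR_right.sum)
  then have "(\<Sum>v\<in>W. b v *\<^sub>R v) = 0"
    using b0 unfolding sum_scaled_rays b_def by simp
  then have "affine_relation W b" using b0 by (simp add: affine_relation_def)
  then obtain \<kappa> where \<kappa>: "\<And>v. v \<in> W \<Longrightarrow> b v = \<kappa> * L v"
    using L unfolding generates_relations_def by blast
  have "a v = \<alpha> + \<kappa> * sgn (L v)" if "v \<in> W" for v
  proof -
    have "(a v - \<alpha>) * wt L v = (\<kappa> * sgn (L v)) * wt L v"
      using \<kappa>[OF that] sgn_wt[of L v] by (simp add: b_def mult.assoc)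
    then show ?thesis using wt_pos[of L v] by simp
  qed
  then show thesis using that by blast
qed

text \<open>\<open>F\<close> is prescribed on a basis chosen among the \<open>z v\<close>. The
  expansion of any other \<open>z w\<close> in it is a relation, which holds for the
  \<open>z' v\<close> as well and forces \<open>F (z w) = z' w\<close>.\<close>

lemma linear_map_of_relations:
  fixes z :: "'i \<Rightarrow> 'a::euclidean_space" and z' :: "'i \<Rightarrow> 'b::euclidean_space"
  assumes W: "finite W"
    and rel: "\<And>a. (\<Sum>v\<in>W. a v *\<^sub>R z v) = 0 \<Longrightarrow> (\<Sum>v\<in>W. a v *\<^sub>R z' v) = 0"
  obtains F where "linear F" "\<And>v. v \<in> W \<Longrightarrow> F (z v) = z' v"
proof -
  obtain B where B: "B \<subseteq> z ` W" "independent B" "z ` W \<subseteq> span B"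
    using maximal_independent_subset by metis
  have finB: "finite B" using B W finite_surj by blast
  have "\<forall>b\<in>B. \<exists>v\<in>W. z v = b" using B by blast
  then obtain g where g: "\<And>b. b \<in> B \<Longrightarrow> g b \<in> W" "\<And>b. b \<in> B \<Longrightarrow> z (g b) = b" by metis
  obtain F where F: "linear F" "\<And>b. b \<in> B \<Longrightarrow> F b = z' (g b)"
    using linear_independent_extend[OF B(2), of "\<lambda>b. z' (g b)"] by auto
  have "F (z w) = z' w" if w: "w \<in> W" for w
  proof -
    have "z w \<in> span B" using B w by blast
    then obtain k where k: "z w = (\<Sum>b\<in>B. k b *\<^sub>R b)" using span_finite[OF finB] by auto
    \<comment> \<open>The expansion of \<open>z w\<close> rewritten with coefficients indexed by
      \<open>W\<close>; \<open>g\<close> picks an index for each basis vector.\<close>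
    define a where "a v = of_bool (v = w) - (\<Sum>b\<in>B. if g b = v then k b else 0)" for v
    have expand: "(\<Sum>v\<in>W. a v *\<^sub>R y v) = y w - (\<Sum>b\<in>B. k b *\<^sub>R y (g b))" for y :: "'i \<Rightarrow> 'c::real_vector"
    proof -
      have "(\<Sum>v\<in>W. a v *\<^sub>R y v) = (\<Sum>v\<in>W. of_bool (v = w) *\<^sub>R y v) - (\<Sum>v\<in>W. \<Sum>b\<in>B. (if g b = v then k b else 0) *\<^sub>R y v)"
        by (simp add: a_def scaleR_diff_left sum_subtractf scaleR_left.sum)
      also have "(\<Sum>v\<in>W. of_bool (v = w) *\<^sub>R y v) = y w"
        using W w by (simp add: of_bool_def if_distrib[of "\<lambda>x. x *\<^sub>R _"] cong: if_cong)
      also have "(\<Sum>v\<in>W. \<Sum>b\<in>B. (if g b = v then k b else 0) *\<^sub>R y v) = (\<Sum>b\<in>B. \<Sum>v\<in>W. (if g b = v then k b else 0) *\<^sub>R y v)"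
        by (rule sum.swap)
      also have "\<dots> = (\<Sum>b\<in>B. k b *\<^sub>R y (g b))"
        using W g(1) by (intro sum.cong refl) (simp add: if_distrib[of "\<lambda>x. x *\<^sub>R _"] cong: if_cong)
      finally show ?thesis .
    qed
    have "(\<Sum>v\<in>W. a v *\<^sub>R z v) = 0" unfolding expand using k g by simp
    then have "z' w = (\<Sum>b\<in>B. k b *\<^sub>R z' (g b))" using rel[of a] unfolding expand by simp
    also have "\<dots> = F (z w)"
      unfolding k using F by (simp add: linear_sum linear_scale)
    finally show ?thesis by simp
  qed
  then show thesis using that F(1) by blast
qed

text \<open>The arc drawn for an edge, described by the cone over it. Unlike a projected segment,
  this form is insensitive to positive rescaling of the two end vectors and compatible with linear
  maps.\<close>

definition rayseg :: "real^3 \<Rightarrow> real^3 \<Rightarrow> (real^3) set" where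
  "rayseg p q = {sgn (\<alpha> *\<^sub>R p + \<beta> *\<^sub>R q) | \<alpha> \<beta>. \<alpha> \<ge> 0 \<and> \<beta> \<ge> 0 \<and> \<alpha> + \<beta> > 0}"

lemma proj_segment: "proj c ` closed_segment u v = rayseg (u - c) (v - c)"
proof
  have eq: "(1 - s) *\<^sub>R u + s *\<^sub>R v - c = (1 - s) *\<^sub>R (u - c) + s *\<^sub>R (v - c)" for s
    by (simp add: algebra_simps)
  show "proj c ` closed_segment u v \<subseteq> rayseg (u - c) (v - c)"
  proof
    fix y assume "y \<in> proj c ` closed_segment u v"
    then obtain s where "y = sgn ((1 - s) *\<^sub>R u + s *\<^sub>R v - c)" "0 \<le> s" "s \<le> 1"
      by (auto simp: proj_def closed_segment_def)
    then show "y \<in> rayseg (u - c) (v - c)"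
      unfolding rayseg_def eq by (intro CollectI exI[of _ "1 - s"] exI[of _ s]) simp
  qed
  show "rayseg (u - c) (v - c) \<subseteq> proj c ` closed_segment u v"
  proof
    fix y assume "y \<in> rayseg (u - c) (v - c)"
    then obtain \<alpha> \<beta> where y: "y = sgn (\<alpha> *\<^sub>R (u - c) + \<beta> *\<^sub>R (v - c))" "\<alpha> \<ge> 0" "\<beta> \<ge> 0" "\<alpha> + \<beta> > 0"
      by (auto simp: rayseg_def)
    define s where "s = \<beta> / (\<alpha> + \<beta>)"
    have s: "0 \<le> s" "s \<le> 1" "(\<alpha> + \<beta>) * s = \<beta>" "(\<alpha> + \<beta>) * (1 - s) = \<alpha>"
      using y by (auto simp: s_def field_simps)
    have "\<alpha> *\<^sub>R (u - c) + \<beta> *\<^sub>R (v - c) = (\<alpha> + \<beta>) *\<^sub>R ((1 - s) *\<^sub>R u + s *\<^sub>R v - c)"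
      unfolding eq scaleR_add_right scaleR_scaleR s(3,4) ..
    then have "y = proj c ((1 - s) *\<^sub>R u + s *\<^sub>R v)" using y by (simp add: sgn_scaleR proj_def)
    then show "y \<in> proj c ` closed_segment u v" using s by (auto simp: closed_segment_def)
  qed
qed

lemma rayseg_scale:
  assumes "a > 0" "b > 0"
  shows "rayseg (a *\<^sub>R p) (b *\<^sub>R q) = rayseg p q"
proof -
  have K: "rayseg (a *\<^sub>R p) (b *\<^sub>R q) \<subseteq> rayseg p q" if "a > 0" "b > 0" for a b p q
  proof
    fix y assume "y \<in> rayseg (a *\<^sub>R p) (b *\<^sub>R q)"
    then obtain \<alpha> \<beta> where y: "y = sgn (\<alpha> *\<^sub>R a *\<^sub>R p + \<beta> *\<^sub>R b *\<^sub>R q)" "\<alpha> \<ge> 0" "\<beta> \<ge> 0" "\<alpha> + \<beta> > 0"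
      by (auto simp: rayseg_def)
    have "\<alpha> * a + \<beta> * b > 0"
      using y that by (cases "\<alpha> = 0") (auto intro: add_pos_nonneg)
    then show "y \<in> rayseg p q" unfolding rayseg_def using y that
      by (intro CollectI exI[of _ "\<alpha> * a"] exI[of _ "\<beta> * b"]) simp
  qed
  have "rayseg p q = rayseg (inverse a *\<^sub>R a *\<^sub>R p) (inverse b *\<^sub>R b *\<^sub>R q)" using assms by simp
  also have "\<dots> \<subseteq> rayseg (a *\<^sub>R p) (b *\<^sub>R q)" using assms by (intro K) auto
  finally show ?thesis using K[OF assms] by blast
qed

lemma sgn_matrix_sgn_any: "sgn ((A::real^3^3) *v sgn y) = sgn (A *v y)"
  by (cases "y = 0") (simp_all add: sgn_matrix_sgn)

lemma matrix_rayseg: "(\<lambda>x. sgn ((A::real^3^3) *v x)) ` rayseg p q = rayseg (A *v p) (A *v q)"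
proof -
  have "sgn (A *v sgn (\<alpha> *\<^sub>R p + \<beta> *\<^sub>R q)) = sgn (\<alpha> *\<^sub>R (A *v p) + \<beta> *\<^sub>R (A *v q))" for \<alpha> \<beta>
    unfolding sgn_matrix_sgn_any by (simp add: matrix_vector_right_distrib matrix_vector_mult_scaleR)
  then show ?thesis unfolding rayseg_def by (auto simp: image_def) metis+
qed

text \<open>A Gale-type criterion for edges: the relation takes both signs on the remaining
  vertices. If it vanishes identically the polytope is a simplex, where any two vertices are
  joined.\<close>

definition joined :: "'a set \<Rightarrow> ('a \<Rightarrow> real) \<Rightarrow> 'a \<Rightarrow> 'a \<Rightarrow> bool" where
  "joined W L u v \<longleftrightarrow> (\<forall>w\<in>W. L w = 0) \<or> ((\<exists>w\<in>W - {u, v}. L w > 0) \<and> (\<exists>w\<in>W - {u, v}. L w < 0))"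

context polytope3 begin

lemma V_not_empty: "V \<noteq> {}"
  using P_hull interior_P by auto

lemma sum_V_remove_two:
  fixes f :: "real^3 \<Rightarrow> 'b::comm_monoid_add"
  assumes "u \<in> V" "v \<in> V" "u \<noteq> v"
  shows "sum f V = f u + (f v + sum f (V - {u, v}))"
  using sum.remove[OF finite_V assms(1), of f] sum.remove[of "V - {u}" v f] finite_V assms
  by (simp add: Diff_insert2[symmetric] insert_commute)

text \<open>If the line through \<open>u\<close> and \<open>v\<close> met the hull of the other
  vertices, there would be an affine relation of one sign on them. It is a multiple of
  \<open>L\<close>, which takes both signs there or vanishes, so its coefficients on the others are
  all 0, although they sum to -1.\<close>

lemma segment_edge_if_joined:
  assumes L: "generates_relations V L" and uv: "u \<in> V" "v \<in> V" "u \<noteq> v" and j: "joined V L u v"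
  shows "closed_segment u v \<in> E"
proof -
  let ?W = "V - {u, v}"
  note split = sum_V_remove_two[OF uv]
  have "affine hull {u, v} \<inter> convex hull ?W = {}"
  proof (rule ccontr)
    assume "\<not> ?thesis"
    then obtain x where x: "x \<in> affine hull {u, v}" "x \<in> convex hull ?W" by blast
    obtain \<alpha> \<beta> where ab: "x = \<alpha> *\<^sub>R u + \<beta> *\<^sub>R v" "\<alpha> + \<beta> = 1" using x(1) by (auto simp: affine_hull_2)
    obtain \<mu> where \<mu>: "\<And>w. w \<in> ?W \<Longrightarrow> \<mu> w \<ge> 0" "sum \<mu> ?W = 1" "(\<Sum>w\<in>?W. \<mu> w *\<^sub>R w) = x"
      using x(2) finite_V by (auto simp: convex_hull_finite)
    define a where "a w = (if w = u then \<alpha> else if w = v then \<beta> else - \<mu> w)" for w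
    have aW: "a w = - \<mu> w" if "w \<in> ?W" for w using that by (simp add: a_def)
    have "sum a ?W = - 1" using \<mu>(2) aW by (simp add: sum_negf)
    moreover have "(\<Sum>w\<in>?W. a w *\<^sub>R w) = - x" using \<mu>(3) aW by (simp add: sum_negf)
    ultimately have "affine_relation V a"
      using ab uv by (simp add: affine_relation_def split a_def)
    then obtain \<kappa> where \<kappa>: "\<And>w. w \<in> V \<Longrightarrow> a w = \<kappa> * L w"
      using L unfolding generates_relations_def by blast
    then have m: "\<mu> w = - (\<kappa> * L w)" if "w \<in> ?W" for w using aW[OF that] that by fastforce
    have "\<mu> w = 0" if w: "w \<in> ?W" for w
    proof (cases "\<forall>w\<in>V. L w = 0")
      case True then show ?thesis using m w by simp
    next
      case False
      then obtain p q where pq: "p \<in> ?W" "L p > 0" "q \<in> ?W" "L q < 0" using j by (auto simp: joined_def)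
      have "\<kappa> * L p \<le> 0" "\<kappa> * L q \<le> 0" using m[OF pq(1)] m[OF pq(3)] \<mu>(1) pq by force+
      then have "\<kappa> = 0" using pq by (metis mult_le_0_iff not_less order_antisym)
      then show ?thesis using m w by simp
    qed
    then show False using \<mu>(2) by simp
  qed
  then have "convex hull {u, v} face_of convex hull V"
    using uv finite_V by (intro face_of_convex_hulls) auto
  then have "closed_segment u v face_of P" using P_hull by (simp add: segment_convex_hull)
  then show ?thesis using uv by (simp add: E_def edge_of_def segment_convex_hull aff_dim_convex_hull aff_dim_2)
qed

text \<open>If \<open>L\<close> has only one weak sign off \<open>u\<close> and \<open>v\<close>,
  separating the terms of the relation exhibits a point of the line through \<open>u\<close> and
  \<open>v\<close> in the hull of the other vertices. This puts a third vertex on the edge.\<close>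

lemma joined_if_segment_edge:
  assumes L: "generates_relations V L" and uv: "u \<in> V" "v \<in> V" "u \<noteq> v" and e: "closed_segment u v \<in> E"
  shows "joined V L u v"
proof (rule ccontr)
  let ?W = "V - {u, v}"
  assume nj: "\<not> joined V L u v"
  note split = sum_V_remove_two[OF uv]
  obtain K where K: "affine_relation V K" "\<And>w. w \<in> ?W \<Longrightarrow> K w \<le> 0" "\<exists>w\<in>V. K w \<noteq> 0"
  proof (cases "\<exists>w\<in>?W. L w > 0")
    case True
    then have "\<And>w. w \<in> ?W \<Longrightarrow> - L w \<le> 0" "\<exists>w\<in>V. - L w \<noteq> 0" using nj by (auto simp: joined_def not_less)
    then show thesis using that[of "\<lambda>w. - L w"] generates_relations_uminus[OF L] by (auto simp: generates_relations_def)
  next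
    case False
    then have "\<And>w. w \<in> ?W \<Longrightarrow> L w \<le> 0" "\<exists>w\<in>V. L w \<noteq> 0" using nj by (auto simp: joined_def not_less)
    then show thesis using that[of L] L by (auto simp: generates_relations_def)
  qed
  \<comment> \<open>The total weight on the other vertices, used to normalise. It is nonzero because
    a relation supported on two distinct points is trivial.\<close>
  define s where "s = (\<Sum>w\<in>?W. - K w)"
  have s0: "s \<ge> 0" unfolding s_def using K(2) by (intro sum_nonneg) auto
  have sums: "K u + K v = s" "K u *\<^sub>R u + K v *\<^sub>R v = (\<Sum>w\<in>?W. (- K w) *\<^sub>R w)"
    using K(1) unfolding affine_relation_def split s_def
    by (simp_all add: sum_negf eq_neg_iff_add_eq_0 add.assoc)
  have "s \<noteq> 0"
  proof
    assume "s = 0"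
    then have z: "\<And>w. w \<in> ?W \<Longrightarrow> K w = 0"
      using K(2) finite_V by (subst (asm) s_def, subst (asm) sum_nonneg_eq_0_iff) auto
    then have "K u *\<^sub>R u + K v *\<^sub>R v = 0" using sums(2) by simp
    moreover have "K v = - K u" using sums(1) \<open>s = 0\<close> by simp
    ultimately have "K u *\<^sub>R (u - v) = 0" by (simp add: scaleR_diff_right)
    then have "K u = 0" "K v = 0" using uv \<open>K v = - K u\<close> by auto
    then show False using K(3) z by blast
  qed
  then have s: "s > 0" using s0 by simp
  define x where "x = (K u / s) *\<^sub>R u + (K v / s) *\<^sub>R v"
  have "K u / s + K v / s = 1" using sums(1) s by (simp add: add_divide_distrib[symmetric])
  then have "x \<in> affine hull {u, v}" unfolding x_def affine_hull_2 by blast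
  moreover have xW: "x \<in> convex hull ?W"
  proof -
    have "x = (1 / s) *\<^sub>R (K u *\<^sub>R u + K v *\<^sub>R v)" by (simp add: x_def scaleR_add_right)
    also have "\<dots> = (\<Sum>w\<in>?W. (- K w / s) *\<^sub>R w)" unfolding sums(2) by (simp add: scaleR_right.sum)
    finally have "(\<Sum>w\<in>?W. (- K w / s) *\<^sub>R w) = x" ..
    moreover have "(\<Sum>w\<in>?W. - K w / s) = 1" using s unfolding sum_divide_distrib[symmetric] s_def[symmetric] by simp
    moreover have "\<forall>w\<in>?W. - K w / s \<ge> 0" using s K(2) by (auto simp: divide_simps)
    ultimately show ?thesis using finite_V by (auto simp: convex_hull_finite intro!: exI[of _ "\<lambda>w. - K w / s"])
  qed
  let ?e = "closed_segment u v" and ?C = "convex hull ?W"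
  have CP: "?C \<subseteq> P" using P_hull hull_mono[of ?W V convex] by auto
  have fe: "?e face_of P" using e edge_face by blast
  have "?e = affine hull ?e \<inter> P" by (rule face_of_imp_eq_affine_Int[OF convex_P fe])
  moreover have "affine hull ?e = affine hull {u, v}" by (simp add: segment_convex_hull)
  ultimately have "x \<in> ?e" using \<open>x \<in> affine hull {u, v}\<close> xW CP by blast
  \<comment> \<open>The edge meets the hull of the other vertices in a face of that hull, which is
    again the hull of some of them; so a common point yields a common vertex.\<close>
  moreover have "?e \<inter> ?C face_of P \<inter> ?C" by (intro face_of_slice fe convex_convex_hull)
  then have "?e \<inter> ?C face_of ?C" using CP by (simp add: Int_absorb1)
  then obtain S' where S': "S' \<subseteq> ?W" "?e \<inter> ?C = convex hull S'"
    using face_of_convex_hull_subset[of ?W] finite_V finite_imp_compact by (metis finite_Diff)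
  ultimately have "S' \<noteq> {}" using xW by auto
  then obtain w where w: "w \<in> S'" by blast
  then have "w \<in> ?e" using S' hull_inc[of w S' convex] by blast
  moreover have "w \<in> V" "w \<noteq> u" "w \<noteq> v" using w S' by auto
  moreover have "{x \<in> V. x \<in> ?e} = {u, v}"
  proof -
    have "card {x \<in> V. x \<in> ?e} = 2" using card_edge_vertices e by blast
    moreover have "{u, v} \<subseteq> {x \<in> V. x \<in> ?e}" using uv by auto
    ultimately show ?thesis using uv finite_V by (intro card_seteq[symmetric]) auto
  qed
  ultimately show False by blast
qed

lemma edges_joined:
  assumes "generates_relations V L"
  shows "E = {closed_segment u v | u v. u \<in> V \<and> v \<in> V \<and> u \<noteq> v \<and> joined V L u v}"
proof
  show "E \<subseteq> {closed_segment u v | u v. u \<in> V \<and> v \<in> V \<and> u \<noteq> v \<and> joined V L u v}"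
  proof
    fix e assume e: "e \<in> E"
    then obtain u v where uv: "u \<noteq> v" "e = closed_segment u v" "{x \<in> V. x \<in> e} = {u, v}" by (rule edge_vertices)
    then have "u \<in> V" "v \<in> V" by auto
    then show "e \<in> {closed_segment u v | u v. u \<in> V \<and> v \<in> V \<and> u \<noteq> v \<and> joined V L u v}"
      using uv e joined_if_segment_edge[OF assms] by blast
  qed
qed (use segment_edge_if_joined[OF assms] in auto)

lemma ctr_interior: "ctr V L \<in> interior P"
proof -
  let ?s = "sum (wt L) V"
  have s: "?s > 0" using sum_wt_pos[OF finite_V V_not_empty] .
  have "ctr V L \<in> rel_interior (convex hull V)"
  proof (rule subsetD[OF explicit_subset_rel_interior_convex_hull_minimal[OF finite_V]], intro CollectI exI conjI)
    show "\<forall>x\<in>V. 0 < wt L x / ?s" using s by (simp add: wt_pos)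
    show "(\<Sum>v\<in>V. wt L v / ?s) = 1" using s by (simp flip: sum_divide_distrib)
    show "(\<Sum>x\<in>V. (wt L x / ?s) *\<^sub>R x) = ctr V L" by (simp add: ctr_def scaleR_right.sum)
  qed
  then show ?thesis using P_hull rel_interior_nonempty_interior[OF interior_P] by simp
qed

lemma span_rays: "span (ray V L ` V) = UNIV"
proof (rule ccontr)
  assume "span (ray V L ` V) \<noteq> UNIV"
  then obtain a where a: "a \<noteq> 0" "\<And>x. x \<in> span (ray V L ` V) \<Longrightarrow> a \<bullet> x = 0"
    using span_not_univ_subset_hyperplane by blast
  have "a \<bullet> v = a \<bullet> ctr V L" if "v \<in> V" for v
  proof -
    have "a \<bullet> ray V L v = 0" using a(2) that by (simp add: span_base)
    then show ?thesis using wt_pos[of L v] by (simp add: ray_def inner_diff_right)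
  qed
  then have "V \<subseteq> {x. a \<bullet> x = a \<bullet> ctr V L}" by auto
  then have "P \<subseteq> {x. a \<bullet> x = a \<bullet> ctr V L}" using P_hull hull_minimal[of V] convex_hyperplane by metis
  then show False using not_constant_on_P[OF a(1)] by blast
qed

text \<open>Drawn from this centre, the skeleton depends only on the rays and on the signs of
  \<open>L\<close>, so a linear map matching rays and signs carries skeleton to skeleton.\<close>

lemma skeleton_joined:
  assumes "generates_relations V L"
  shows "skeleton_graph (ctr V L) P = SGraph (sgn ` ray V L ` V)
     {rayseg (ray V L u) (ray V L v) | u v. u \<in> V \<and> v \<in> V \<and> u \<noteq> v \<and> joined V L u v}"
proof -
  have "sgn (ray V L v) = proj (ctr V L) v" for v
    using wt_pos[of L v] by (simp add: ray_def proj_def sgn_scaleR)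
  moreover have "proj (ctr V L) ` closed_segment u v = rayseg (ray V L u) (ray V L v)" for u v
    unfolding proj_segment ray_def by (rule rayseg_scale[symmetric]) (rule wt_pos)+
  then have "(`) (proj (ctr V L)) ` E = {rayseg (ray V L u) (ray V L v) | u v. u \<in> V \<and> v \<in> V \<and> u \<noteq> v \<and> joined V L u v}"
    unfolding edges_joined[OF assms] by (auto simp: image_iff) metis+
  ultimately show ?thesis by (simp add: skeleton_gmap gmap_def image_image)
qed

end

lemma gmap_skeleton_joined:
  assumes P: "polytope3 P" "W = {v. v extreme_point_of P}" "generates_relations W L"
    and P': "polytope3 P'" "W' = {v. v extreme_point_of P'}" "generates_relations W' L'"
    and f: "bij_betw f W W'" "\<And>v. v \<in> W \<Longrightarrow> sgn (L' (f v)) = sgn (L v)"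
    and A: "\<And>v. v \<in> W \<Longrightarrow> A *v ray W L v = ray W' L' (f v)"
  shows "gmap (\<lambda>x. sgn (A *v x)) (skeleton_graph (ctr W L) P) = skeleton_graph (ctr W' L') P'"
proof -
  interpret A: polytope3 P by fact
  interpret B: polytope3 P' by fact
  have W: "W = A.V" "W' = B.V" using P P' by (simp_all add: A.V_def B.V_def)
  have fW: "f ` W = W'" and inj: "inj_on f W" using f by (auto simp: bij_betw_def)
  have s: "L' (f v) > 0 \<longleftrightarrow> L v > 0" "L' (f v) < 0 \<longleftrightarrow> L v < 0" "L' (f v) = 0 \<longleftrightarrow> L v = 0" if "v \<in> W" for v
    using f(2)[OF that] by (auto simp: sgn_if split: if_splits)
  have diff: "W' - {f u, f v} = f ` (W - {u, v})" if "u \<in> W" "v \<in> W" for u v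
    using that fW inj by (auto simp: inj_on_def)
  have j: "joined W' L' (f u) (f v) \<longleftrightarrow> joined W L u v" if "u \<in> W" "v \<in> W" for u v
    unfolding joined_def diff[OF that] using s by (auto simp flip: fW)
  have "(\<lambda>x. sgn (A *v x)) ` sgn ` ray W L ` W = sgn ` ray W' L' ` W'"
    using A by (simp add: image_image sgn_matrix_sgn_any flip: fW)
  moreover have "(`) (\<lambda>x. sgn (A *v x)) ` {rayseg (ray W L u) (ray W L v) | u v. u \<in> W \<and> v \<in> W \<and> u \<noteq> v \<and> joined W L u v}
     = {rayseg (ray W' L' u) (ray W' L' v) | u v. u \<in> W' \<and> v \<in> W' \<and> u \<noteq> v \<and> joined W' L' u v}" (is "?X = ?Y")
  proof
    show "?X \<subseteq> ?Y"
    proof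
      fix y assume "y \<in> ?X"
      then obtain u v where uv: "u \<in> W" "v \<in> W" "u \<noteq> v" "joined W L u v" "y = rayseg (ray W' L' (f u)) (ray W' L' (f v))"
        using A by (auto simp: matrix_rayseg)
      moreover have "f u \<in> W'" "f v \<in> W'" "f u \<noteq> f v" using uv fW inj by (auto dest: inj_onD)
      ultimately show "y \<in> ?Y" using j by blast
    qed
    show "?Y \<subseteq> ?X"
    proof
      fix y assume "y \<in> ?Y"
      then obtain u' v' where uv': "u' \<in> W'" "v' \<in> W'" "u' \<noteq> v'" "joined W' L' u' v'" "y = rayseg (ray W' L' u') (ray W' L' v')"
        by blast
      then obtain u v where uv: "u \<in> W" "v \<in> W" "u' = f u" "v' = f v" using fW by blast
      have "y = (\<lambda>x. sgn (A *v x)) ` rayseg (ray W L u) (ray W L v)"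
        using uv uv' A by (simp add: matrix_rayseg)
      then show "y \<in> ?X" using uv uv' j by blast
    qed
  qed
  ultimately show ?thesis
    unfolding A.skeleton_joined[OF P(3)[unfolded W], folded W] B.skeleton_joined[OF P'(3)[unfolded W], folded W]
    by (simp add: gmap_def)
qed

text \<open>By \<open>relation_of_rays\<close> the linear relations between the rays of
  \<open>W\<close> come from two that depend only on signs, and the corresponding rays of
  \<open>W'\<close> satisfy both. The resulting map is onto, since the rays of \<open>W'\<close>
  span the space, and hence invertible.\<close>

lemma exists_matrix_of_rays:
  assumes P: "polytope3 P" "W = {v. v extreme_point_of P}" "generates_relations W L"
    and P': "polytope3 P'" "W' = {v. v extreme_point_of P'}" "generates_relations W' L'"
    and f: "bij_betw f W W'" "\<And>v. v \<in> W \<Longrightarrow> sgn (L' (f v)) = sgn (L v)"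
  obtains A :: "real^3^3" where "det A \<noteq> 0" "\<And>v. v \<in> W \<Longrightarrow> A *v ray W L v = ray W' L' (f v)"
proof -
  interpret A: polytope3 P by fact
  interpret B: polytope3 P' by fact
  have W: "W = A.V" "W' = B.V" using P P' by (simp_all add: A.V_def B.V_def)
  have fin: "finite W" "W \<noteq> {}" "finite W'" "W' \<noteq> {}"
    using A.finite_V A.V_not_empty B.finite_V B.V_not_empty by (simp_all add: W)
  have r1: "(\<Sum>v\<in>W. ray W' L' (f v)) = 0"
    using sum.reindex_bij_betw[OF f(1), of "ray W' L'"] sum_rays[OF fin(3,4)] by simp
  have r2: "(\<Sum>v\<in>W. sgn (L v) *\<^sub>R ray W' L' (f v)) = 0"
  proof -
    have "(\<Sum>v\<in>W. sgn (L v) *\<^sub>R ray W' L' (f v)) = (\<Sum>v\<in>W. sgn (L' (f v)) *\<^sub>R ray W' L' (f v))"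
      using f(2) by (intro sum.cong) auto
    also have "\<dots> = (\<Sum>v\<in>W'. sgn (L' v) *\<^sub>R ray W' L' v)"
      by (rule sum.reindex_bij_betw[OF f(1), of "\<lambda>v. sgn (L' v) *\<^sub>R ray W' L' v"])
    also have "\<dots> = 0" using P'(3) by (intro sum_signed_rays) (simp add: generates_relations_def)
    finally show ?thesis .
  qed
  obtain F where F: "linear F" "\<And>v. v \<in> W \<Longrightarrow> F (ray W L v) = ray W' L' (f v)"
  proof (rule linear_map_of_relations[OF fin(1), of "ray W L" "\<lambda>v. ray W' L' (f v)"])
    fix a assume "(\<Sum>v\<in>W. a v *\<^sub>R ray W L v) = 0"
    then obtain \<alpha> \<beta> where ab: "\<And>v. v \<in> W \<Longrightarrow> a v = \<alpha> + \<beta> * sgn (L v)"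
      using relation_of_rays[OF fin(1,2) P(3)] by blast
    have "(\<Sum>v\<in>W. a v *\<^sub>R ray W' L' (f v)) = \<alpha> *\<^sub>R (\<Sum>v\<in>W. ray W' L' (f v)) + \<beta> *\<^sub>R (\<Sum>v\<in>W. sgn (L v) *\<^sub>R ray W' L' (f v))"
      using ab by (simp add: scaleR_add_left sum.distrib scaleR_right.sum)
    then show "(\<Sum>v\<in>W. a v *\<^sub>R ray W' L' (f v)) = 0" using r1 r2 by simp
  qed (rule that)
  have "ray W' L' ` W' \<subseteq> range F"
  proof
    fix y assume "y \<in> ray W' L' ` W'"
    then obtain v where "v \<in> W" "y = ray W' L' (f v)" using f(1) by (auto simp: bij_betw_def)
    then show "y \<in> range F" using F(2) by (metis rangeI)
  qed
  then have "span (ray W' L' ` W') \<subseteq> range F"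
    using F(1) by (intro span_minimal) (auto intro: linear_subspace_image)
  then have "surj F" using B.span_rays[of L'] W by auto
  then have "inj F" using F(1) linear_surjective_imp_injective by blast
  then have "det (matrix F) \<noteq> 0" using det_nz_iff_inj[OF F(1)] by simp
  moreover have "matrix F *v x = F x" for x using fun_cong[OF matrix_vector_mul(2)[OF F(1)]] .
  ultimately show thesis using that[of "matrix F"] F(2) by simp
qed

text \<open>The matching matrix may reverse orientation, where \<open>isotopic_matrix\<close> does
  not apply. Composing it with the orientation-reversing symmetry \<open>M\<close> of the target
  makes the determinant positive.\<close>

lemma isotopic_of_signs:
  assumes P: "polytope3 P" "W = {v. v extreme_point_of P}" "generates_relations W L"
    and P': "polytope3 P'" "W' = {v. v extreme_point_of P'}" "generates_relations W' L'"
    and f: "bij_betw f W W'" "\<And>v. v \<in> W \<Longrightarrow> sgn (L' (f v)) = sgn (L v)"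
    and M: "det M < 0" "bij_betw \<sigma> W' W'" "\<And>v. v \<in> W' \<Longrightarrow> sgn (L' (\<sigma> v)) = sgn (L' v)"
      "\<And>v. v \<in> W' \<Longrightarrow> M *v ray W' L' v = ray W' L' (\<sigma> v)"
  shows "isotopic (skeleton_graph (ctr W L) P) (skeleton_graph (ctr W' L') P')"
proof -
  interpret A: polytope3 P by fact
  have W: "W = A.V" using P by (simp add: A.V_def)
  have on: "on_sphere (skeleton_graph (ctr W L) P)"
    unfolding W by (rule A.on_sphere_skeleton[OF A.ctr_interior])
  obtain A where A: "det A \<noteq> 0" "\<And>v. v \<in> W \<Longrightarrow> A *v ray W L v = ray W' L' (f v)"
    using exists_matrix_of_rays[OF P P' f] by metis
  show ?thesis
  proof (cases "det A > 0")
    case True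
    then show ?thesis
      using isotopic_matrix[OF True] gmap_skeleton_joined[OF P P' f A(2)] by metis
  next
    case False
    then have "det (M ** A) > 0" using A(1) M(1) by (simp add: det_mul mult_neg_neg)
    moreover have "gmap (\<lambda>x. sgn ((M ** A) *v x)) (skeleton_graph (ctr W L) P) = skeleton_graph (ctr W' L') P'"
    proof (rule gmap_skeleton_joined[OF P P' bij_betw_trans[OF f(1) M(2)]])
      have "f v \<in> W'" if "v \<in> W" for v using f(1) that by (auto simp: bij_betw_def)
      then show "sgn (L' ((\<sigma> \<circ> f) v)) = sgn (L v)" "(M ** A) *v ray W L v = ray W' L' ((\<sigma> \<circ> f) v)" if "v \<in> W" for v
        using that f(2) M(3,4) A(2) by (simp_all flip: matrix_vector_mul_assoc)
    qed
    ultimately show ?thesis using isotopic_matrix by metis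
  qed
qed

section \<open>Polytopes with four or five vertices\<close>

lemma card_by_sign:
  fixes L :: "'a \<Rightarrow> real"
  assumes "finite W"
  shows "card W = card {v \<in> W. L v > 0} + card {v \<in> W. L v < 0} + card {v \<in> W. L v = 0}"
proof -
  let ?P = "{v \<in> W. L v > 0}" and ?N = "{v \<in> W. L v < 0}" and ?Z = "{v \<in> W. L v = 0}"
  have "card ((?P \<union> ?N) \<union> ?Z) = card (?P \<union> ?N) + card ?Z" using assms by (intro card_Un_disjoint) auto
  also have "card (?P \<union> ?N) = card ?P + card ?N" using assms by (intro card_Un_disjoint) auto
  also have "(?P \<union> ?N) \<union> ?Z = W" by auto
  finally show ?thesis .
qed

lemma sign_preserving_bij:
  assumes fin: "finite W" "finite W'"
    and c: "card {v \<in> W. L v > 0} = card {v \<in> W'. L' v > 0}"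
      "card {v \<in> W. L v < 0} = card {v \<in> W'. L' v < 0}" "card W = card W'"
  obtains f where "bij_betw f W W'" "\<And>v. v \<in> W \<Longrightarrow> sgn (L' (f v)) = sgn ((L v)::real)"
proof -
  let ?P = "{v \<in> W. L v > 0}" and ?N = "{v \<in> W. L v < 0}" and ?Z = "{v \<in> W. L v = 0}"
  let ?P' = "{v \<in> W'. L' v > 0}" and ?N' = "{v \<in> W'. L' v < 0}" and ?Z' = "{v \<in> W'. L' v = 0}"
  have cZ: "card ?Z = card ?Z'" using card_by_sign[OF fin(1), of L] card_by_sign[OF fin(2), of L'] c by linarith
  obtain f1 where f1: "bij_betw f1 ?P ?P'" using finite_same_card_bij[OF _ _ c(1)] fin by auto
  obtain f2 where f2: "bij_betw f2 ?N ?N'" using finite_same_card_bij[OF _ _ c(2)] fin by auto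
  obtain f3 where f3: "bij_betw f3 ?Z ?Z'" using finite_same_card_bij[OF _ _ cZ] fin by auto
  define f where "f v = (if L v > 0 then f1 v else if L v < 0 then f2 v else f3 v)" for v
  have g1: "bij_betw f ?P ?P'" using f1 by (subst bij_betw_cong[of _ _ f1]) (auto simp: f_def)
  have g2: "bij_betw f ?N ?N'" using f2 by (subst bij_betw_cong[of _ _ f2]) (auto simp: f_def)
  have g3: "bij_betw f ?Z ?Z'" using f3 by (subst bij_betw_cong[of _ _ f3]) (auto simp: f_def)
  have "bij_betw f ((?P \<union> ?N) \<union> ?Z) ((?P' \<union> ?N') \<union> ?Z')"
    by (intro bij_betw_combine g1 g2 g3) auto
  moreover have "(?P \<union> ?N) \<union> ?Z = W" "(?P' \<union> ?N') \<union> ?Z' = W'" by auto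
  ultimately have "bij_betw f W W'" by simp
  moreover have "sgn (L' (f v)) = sgn (L v)" if "v \<in> W" for v
  proof -
    consider "v \<in> ?P" | "v \<in> ?N" | "v \<in> ?Z" using \<open>v \<in> W\<close> by fastforce
    then show ?thesis
    proof cases
      case 1 then have "f v \<in> ?P'" using g1 bij_betwE by blast then show ?thesis using 1 by simp
    next
      case 2 then have "f v \<in> ?N'" using g2 bij_betwE by blast then show ?thesis using 2 by simp
    next
      case 3 then have "f v \<in> ?Z'" using g3 bij_betwE by blast then show ?thesis using 3 by simp
    qed
  qed
  ultimately show thesis using that by blast
qed

lemma generates_relations_zero:
  fixes W :: "'a::euclidean_space set"
  assumes "\<not> affine_dependent W"
  shows "generates_relations W (\<lambda>_. 0)"
proof -
  have "a v = 0" if "affine_relation W a" "v \<in> W" for a v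
    using that assms affine_dependent_explicit_finite[of W] aff_independent_finite[OF assms]
    by (auto simp: affine_relation_def)
  then show ?thesis by (auto simp: generates_relations_def affine_relation_def)
qed

context polytope3 begin

lemma aff_dim_V: "aff_dim V = 3"
  using aff_dim_P P_hull aff_dim_convex_hull by metis

lemma relations_card4: "card V = 4 \<Longrightarrow> generates_relations V (\<lambda>_. 0)"
  by (intro generates_relations_zero) (simp add: affine_independent_iff_card finite_V aff_dim_V)

text \<open>Four of the vertices form an affine basis \<open>B\<close>, and \<open>w\<close> is the
  fifth. A relation vanishing at \<open>w\<close> lives on \<open>B\<close> and is trivial, so a
  relation is determined by its value at \<open>w\<close>.\<close>

lemma relations_card5:
  assumes "card V = 5"
  obtains L where "generates_relations V L" "\<exists>v\<in>V. L v \<noteq> 0"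
proof -
  have "affine_dependent V"
    using affine_independent_iff_card[of V] assms aff_dim_V by simp
  then obtain L where L: "affine_relation V L" "\<exists>v\<in>V. L v \<noteq> 0"
    using affine_dependent_explicit_finite[OF finite_V] by (auto simp: affine_relation_def)
  obtain B where B: "B \<subseteq> V" "\<not> affine_dependent B" "affine hull V = affine hull B"
    using affine_basis_exists by metis
  have "aff_dim B = 3" using B(3) aff_dim_V aff_dim_affine_hull by metis
  then have "card B = 4" using B(2) affine_independent_iff_card[of B] by simp
  then have "card (V - B) = 1" using assms B finite_V finite_subset by (subst card_Diff_subset) auto
  then obtain w where w: "V - B = {w}" by (rule card_1_singletonE)
  have zero: "\<forall>v\<in>V. a v = 0" if a: "affine_relation V a" "a w = 0" for a
  proof -
    have V: "V = insert w B" "w \<notin> B" using w B by auto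
    have finB: "finite B" using B finite_V finite_subset by blast
    have "affine_relation B a" using a finB V(2) unfolding V(1) by (simp add: affine_relation_def)
    then show ?thesis
      using B(2) affine_dependent_explicit_finite[OF finB] a(2) V by (auto simp: affine_relation_def)
  qed
  have Lw: "L w \<noteq> 0" using zero[OF L(1)] L(2) by blast
  have "\<exists>\<kappa>. \<forall>v\<in>V. a v = \<kappa> * L v" if a: "affine_relation V a" for a
  proof -
    define k where "k = a w / L w"
    have "affine_relation V (\<lambda>v. a v - k * L v)"
      using a L(1)
      by (simp add: affine_relation_def sum_subtractf scaleR_diff_left flip: sum_distrib_left scaleR_scaleR scaleR_right.sum)
    then have "\<forall>v\<in>V. a v - k * L v = 0" using Lw by (intro zero) (simp_all add: k_def)
    then show ?thesis by (intro exI[of _ k]) simp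
  qed
  then show thesis using that[of L] L by (simp add: generates_relations_def)
qed

lemma vertex_not_in_hull: "v \<in> V \<Longrightarrow> v \<notin> convex hull (V - {v})"
proof -
  assume v: "v \<in> V"
  have "convex hull (V - {v}) \<subseteq> P - {v}"
  proof (rule hull_minimal)
    show "convex (P - {v})"
      using v extreme_point_of_stillconvex convex_P unfolding V_def by blast
  qed (use V_subset_P in auto)
  then show ?thesis by blast
qed

text \<open>If only one coefficient were positive, solving the relation for its vertex would write
  that vertex as a convex combination of the others.\<close>

lemma two_positive:
  assumes L: "affine_relation V L" "\<exists>v\<in>V. L v \<noteq> 0"
  shows "card {v \<in> V. L v > 0} \<ge> 2"
proof (rule ccontr)
  assume "\<not> card {v \<in> V. L v > 0} \<ge> 2"
  then consider "card {v \<in> V. L v > 0} = 0" | "card {v \<in> V. L v > 0} = 1" by linarith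
  then show False
  proof cases
    case 1
    then have "{v \<in> V. L v > 0} = {}" using finite_V card_0_eq[of "{v \<in> V. L v > 0}"] by simp
    then have "\<forall>v\<in>V. 0 \<le> - L v" by force
    moreover have "(\<Sum>v\<in>V. - L v) = 0" using L by (simp add: affine_relation_def sum_negf)
    ultimately have "\<forall>v\<in>V. - L v = 0" using finite_V sum_nonneg_eq_0_iff[of V "\<lambda>v. - L v"] by blast
    then show False using L by simp
  next
    case 2
    then obtain v where v: "{v \<in> V. L v > 0} = {v}" by (rule card_1_singletonE)
    then have vV: "v \<in> V" "L v > 0" by auto
    have neg: "L w \<le> 0" if "w \<in> V - {v}" for w using v that by force
    have split: "sum f V = f v + sum f (V - {v})" for f :: "real^3 \<Rightarrow> 'b::comm_monoid_add"
      using sum.remove[OF finite_V vV(1)] .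
    have s1: "(\<Sum>w\<in>V - {v}. - L w) = L v" and s2: "(\<Sum>w\<in>V - {v}. (- L w) *\<^sub>R w) = L v *\<^sub>R v"
      using L(1) unfolding affine_relation_def split by (simp_all add: sum_negf eq_neg_iff_add_eq_0 neg_eq_iff_add_eq_0 add.commute)
    have "v \<in> convex hull (V - {v})"
      unfolding convex_hull_finite[OF finite_Diff[OF finite_V]]
    proof (intro CollectI exI conjI ballI)
      show "0 \<le> - L w / L v" if "w \<in> V - {v}" for w using neg[OF that] vV by (simp add: divide_nonpos_pos)
      show "(\<Sum>w\<in>V - {v}. - L w / L v) = 1" using s1 vV unfolding sum_divide_distrib[symmetric] by simp
      have "(\<Sum>w\<in>V - {v}. (- L w / L v) *\<^sub>R w) = (1 / L v) *\<^sub>R (\<Sum>w\<in>V - {v}. (- L w) *\<^sub>R w)"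
        by (simp add: scaleR_right.sum)
      then show "(\<Sum>w\<in>V - {v}. (- L w / L v) *\<^sub>R w) = v" unfolding s2 using vV by simp
    qed
    then show False using vertex_not_in_hull vV by blast
  qed
qed

lemma two_negative:
  assumes L: "affine_relation V L" "\<exists>v\<in>V. L v \<noteq> 0"
  shows "card {v \<in> V. L v < 0} \<ge> 2"
  using two_positive[of "\<lambda>v. - L v"] L by (simp add: affine_relation_def sum_negf)

text \<open>Both signs occur at least twice among five coefficients. Up to exchanging the signs this
  leaves 2 + 2 with a zero, the pyramid with the zero at its apex, and 2 + 3, the bipyramid.\<close>

lemma relations_card5_signs:
  assumes "card V = 5"
  obtains L where "generates_relations V L" "card {v \<in> V. L v > 0} = 2"
    "card {v \<in> V. L v < 0} = 2 \<or> card {v \<in> V. L v < 0} = 3"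
proof -
  obtain L where L: "generates_relations V L" "\<exists>v\<in>V. L v \<noteq> 0" using relations_card5[OF assms] .
  then have rel: "affine_relation V L" by (simp add: generates_relations_def)
  let ?P = "{v \<in> V. L v > 0}" and ?N = "{v \<in> V. L v < 0}"
  have "card (?P \<union> ?N) = card ?P + card ?N" using finite_V by (intro card_Un_disjoint) auto
  moreover have "card (?P \<union> ?N) \<le> card V" using finite_V by (intro card_mono) auto
  ultimately have "card ?P + card ?N \<le> 5" using assms by simp
  then consider "card ?P = 2" "card ?N = 2 \<or> card ?N = 3" | "card ?N = 2" "card ?P = 3"
    using two_positive[OF rel L(2)] two_negative[OF rel L(2)] by linarith
  then show thesis
  proof cases
    case 1 then show thesis using that L by blast
  next
    case 2 then show thesis using that[of "\<lambda>v. - L v"] generates_relations_uminus[OF L(1)] by simp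
  qed
qed

end

text \<open>A point \<open>a\<close> in the hull of the others gives a relation whose only positive
  coefficient is at \<open>a\<close>. Being a nonzero multiple of \<open>L\<close>, it shows that
  one sign of \<open>L\<close> occurs only once.\<close>

lemma extreme_points_of_relations:
  fixes W :: "'a::euclidean_space set"
  assumes W: "finite W" and L: "generates_relations W L"
    and signs: "(\<forall>v\<in>W. L v = 0) \<or> (card {v \<in> W. L v > 0} \<ge> 2 \<and> card {v \<in> W. L v < 0} \<ge> 2)"
  shows "{v. v extreme_point_of convex hull W} = W"
proof -
  have "a \<notin> convex hull (W - {a})" if a: "a \<in> W" for a
  proof
    assume "a \<in> convex hull (W - {a})"
    then obtain \<mu> where \<mu>: "\<And>w. w \<in> W - {a} \<Longrightarrow> \<mu> w \<ge> 0" "sum \<mu> (W - {a}) = 1" "(\<Sum>w\<in>W - {a}. \<mu> w *\<^sub>R w) = a"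
      using W by (auto simp: convex_hull_finite)
    define b where "b w = (if w = a then 1 else - \<mu> w)" for w
    have bW: "b w = - \<mu> w" if "w \<in> W - {a}" for w using that by (simp add: b_def)
    have "sum b (W - {a}) = - 1" using \<mu>(2) bW by (simp add: sum_negf)
    moreover have "(\<Sum>w\<in>W - {a}. b w *\<^sub>R w) = - a" using \<mu>(3) bW by (simp add: sum_negf)
    ultimately have "affine_relation W b"
      using sum.remove[OF W a, of b] sum.remove[OF W a, of "\<lambda>w. b w *\<^sub>R w"] by (simp add: affine_relation_def b_def)
    then obtain \<kappa> where \<kappa>: "\<And>w. w \<in> W \<Longrightarrow> b w = \<kappa> * L w" using L unfolding generates_relations_def by blast
    have "b a = 1" by (simp add: b_def)
    then have nz: "\<kappa> \<noteq> 0" "L a \<noteq> 0" using \<kappa>[OF a] by auto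
    then have two: "card {v \<in> W. L v > 0} \<ge> 2" "card {v \<in> W. L v < 0} \<ge> 2" using signs a by auto
    have m: "\<kappa> * L w \<le> 0" if "w \<in> W - {a}" for w using \<kappa> bW[OF that] \<mu>(1)[OF that] that by force
    show False
    proof (cases "\<kappa> > 0")
      case True
      then have "{v \<in> W. L v > 0} \<subseteq> {a}" using m by (force simp: mult_le_0_iff)
      then have "card {v \<in> W. L v > 0} \<le> card {a}" by (intro card_mono) auto
      then show False using two by simp
    next
      case False
      then have "{v \<in> W. L v < 0} \<subseteq> {a}" using m nz by (force simp: mult_le_0_iff)
      then have "card {v \<in> W. L v < 0} \<le> card {a}" by (intro card_mono) auto
      then show False using two by simp
    qed
  qed
  then show ?thesis
    using extreme_point_of_convex_hull_convex_independent[OF finite_imp_compact[OF W]] by blast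
qed

text \<open>A linear symmetry of the points and their coefficients fixes the weighted centre and
  therefore permutes the rays.\<close>

lemma ray_matrix_invariant:
  assumes bij: "bij_betw (\<lambda>v. M *v v) W W" and L: "\<And>v. v \<in> W \<Longrightarrow> L (M *v v) = L v" and v: "v \<in> W"
  shows "(M::real^3^3) *v ray W L v = ray W L (M *v v)"
proof -
  have w: "wt L (M *v v) = wt L v" if "v \<in> W" for v using L[OF that] by (simp add: wt_def)
  have "M *v ctr W L = (1 / sum (wt L) W) *\<^sub>R (\<Sum>v\<in>W. wt L v *\<^sub>R (M *v v))"
    by (simp add: ctr_def matrix_vector_mult_scaleR linear_sum[OF matrix_vector_mul_linear] )
  also have "(\<Sum>v\<in>W. wt L v *\<^sub>R (M *v v)) = (\<Sum>v\<in>W. wt L (M *v v) *\<^sub>R (M *v v))"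
    using w by (intro sum.cong) auto
  also have "\<dots> = (\<Sum>v\<in>W. wt L v *\<^sub>R v)"
    by (rule sum.reindex_bij_betw[OF bij, of "\<lambda>v. wt L v *\<^sub>R v"])
  finally have "M *v ctr W L = ctr W L" by (simp add: ctr_def)
  then show ?thesis
    by (simp add: ray_def matrix_vector_mult_scaleR matrix_vector_mult_diff_distrib w[OF v])
qed

lemma bij_betw_involution:
  assumes "\<And>v. v \<in> W \<Longrightarrow> f v \<in> W" "\<And>v. v \<in> W \<Longrightarrow> f (f v) = v"
  shows "bij_betw f W W"
  using assms by (intro bij_betw_byWitness[of W f f W]) auto

lemma isotopic_standard:
  fixes W' :: "(real^3) set"
  assumes P: "polytope3 P" "c \<in> interior P" "W = {v. v extreme_point_of P}" "generates_relations W L"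
    and W': "finite W'" "generates_relations W' L'" "interior (convex hull W') \<noteq> {}" "0 \<in> interior (convex hull W')"
      "{v. v extreme_point_of convex hull W'} = W'"
    and cards: "card {v \<in> W. L v > 0} = card {v \<in> W'. L' v > 0}"
      "card {v \<in> W. L v < 0} = card {v \<in> W'. L' v < 0}" "card W = card W'"
    and M: "det M < 0" "bij_betw (\<lambda>v. M *v v) W' W'" "\<And>v. v \<in> W' \<Longrightarrow> L' (M *v v) = L' v"
  shows "isotopic (skeleton_graph c P) (skeleton_graph 0 (convex hull W'))"
proof -
  have P': "polytope3 (convex hull W')"
    using W' polytope_convex_hull by unfold_locales auto
  interpret A: polytope3 P by fact
  interpret B: polytope3 "convex hull W'" by fact
  have W: "W = A.V" using P by (simp add: A.V_def)
  have B: "W' = B.V" using W' by (simp add: B.V_def)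
  obtain f where f: "bij_betw f W W'" "\<And>v. v \<in> W \<Longrightarrow> sgn (L' (f v)) = sgn (L v)"
    using sign_preserving_bij[OF _ W'(1) cards] A.finite_V W by metis
  have "isotopic (skeleton_graph (ctr W L) P) (skeleton_graph (ctr W' L') (convex hull W'))"
    by (rule isotopic_of_signs[OF P(1,3,4) P' W'(5)[symmetric] W'(2) f M(1,2)])
       (use M(3) ray_matrix_invariant[where L = L', OF M(2,3)] in simp_all)
  moreover have "isotopic (skeleton_graph c P) (skeleton_graph (ctr W L) P)"
    unfolding W by (rule A.isotopic_centre[OF P(2) A.ctr_interior])
  moreover have "isotopic (skeleton_graph (ctr W' L') (convex hull W')) (skeleton_graph 0 (convex hull W'))"
    by (subst B, rule B.isotopic_centre[OF B.ctr_interior W'(4)])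
  ultimately show ?thesis using isotopic_trans by blast
qed

section \<open>The three standard polyhedra\<close>

lemma interior_hull_nonempty:
  fixes W :: "(real^3) set"
  assumes "\<And>a b. W \<subseteq> {x. a \<bullet> x = b} \<Longrightarrow> a = 0"
  shows "interior (convex hull W) \<noteq> {}"
proof
  assume "interior (convex hull W) = {}"
  then obtain a b where "a \<noteq> 0" "convex hull W \<subseteq> {x. a \<bullet> x = b}"
    using empty_interior_subset_hyperplane[OF convex_convex_hull] by metis
  then show False using assms[of a b] hull_subset[of W convex] by blast
qed

lemma zero_interior_hull:
  fixes W :: "(real^3) set"
  assumes "finite W" "interior (convex hull W) \<noteq> {}" "\<And>w. w \<in> W \<Longrightarrow> u w > 0" "sum u W = 1" "(\<Sum>w\<in>W. u w *\<^sub>R w) = 0"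
  shows "0 \<in> interior (convex hull W)"
proof -
  have "0 \<in> rel_interior (convex hull W)"
    using assms by (intro subsetD[OF explicit_subset_rel_interior_convex_hull_minimal[OF assms(1)]]) blast
  then show ?thesis using rel_interior_nonempty_interior[OF assms(2)] by simp
qed

definition tet :: "(real^3) set" where
  "tet = {vector [1, 1, 1], vector [1, -1, -1], vector [-1, 1, -1], vector [-1, -1, 1]}"

definition pyr :: "(real^3) set" where
  "pyr = {vector [1, 0, -1], vector [0, 1, -1], vector [-1, 0, -1], vector [0, -1, -1], vector [0, 0, 1]}"

definition bip :: "(real^3) set" where
  "bip = {vector [1, 0, 0], vector [-1, 1, 0], vector [-1, -1, 0], vector [0, 0, 1], vector [0, 0, -1]}"

lemma vector3_eq: "(vector [a, b, c] :: real^3) = vector [a', b', c'] \<longleftrightarrow> a = a' \<and> b = b' \<and> c = c'"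
  by (simp add: vec_eq_iff forall_3)

lemma inner_vector3: "(a :: real^3) \<bullet> vector [x, y, z] = a$1 * x + a$2 * y + a$3 * z"
  by (simp add: inner_vec_def sum_3)

lemma scaleR_vector3: "r *\<^sub>R (vector [x, y, z] :: real^3) = vector [r * x, r * y, r * z]"
  by (simp add: vec_eq_iff forall_3)

lemma add_vector3: "(vector [x, y, z] :: real^3) + vector [x', y', z'] = vector [x + x', y + y', z + z']"
  by (simp add: vec_eq_iff forall_3)

lemma zero_vector3: "(0 :: real^3) = vector [0, 0, 0]"
  by (simp add: vec_eq_iff forall_3)

lemma finite_std: "finite tet" "finite pyr" "finite bip"
  by (simp_all add: tet_def pyr_def bip_def)

lemma sum_std:
  fixes f :: "real^3 \<Rightarrow> 'b::comm_monoid_add"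
  shows "sum f tet = f (vector [1, 1, 1]) + (f (vector [1, -1, -1]) + (f (vector [-1, 1, -1]) + f (vector [-1, -1, 1])))"
    "sum f pyr = f (vector [1, 0, -1]) + (f (vector [0, 1, -1]) + (f (vector [-1, 0, -1]) + (f (vector [0, -1, -1]) + f (vector [0, 0, 1]))))"
    "sum f bip = f (vector [1, 0, 0]) + (f (vector [-1, 1, 0]) + (f (vector [-1, -1, 0]) + (f (vector [0, 0, 1]) + f (vector [0, 0, -1]))))"
  by (simp_all add: tet_def pyr_def bip_def vector3_eq)

lemma card_std: "card tet = 4" "card pyr = 5" "card bip = 5"
proof -
  show "card tet = 4" unfolding card_eq_sum sum_std by simp
  show "card pyr = 5" unfolding card_eq_sum sum_std by simp
  show "card bip = 5" unfolding card_eq_sum sum_std by simp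
qed

lemma interior_std: "interior (convex hull tet) \<noteq> {}" "interior (convex hull pyr) \<noteq> {}" "interior (convex hull bip) \<noteq> {}"
  by (rule interior_hull_nonempty, simp add: tet_def pyr_def bip_def inner_vector3 vec_eq_iff forall_3)+

lemma zero_interior_std: "0 \<in> interior (convex hull tet)" "0 \<in> interior (convex hull pyr)" "0 \<in> interior (convex hull bip)"
proof -
  show "0 \<in> interior (convex hull tet)"
    by (rule zero_interior_hull[where u = "\<lambda>_. 1/4"]) (simp_all add: finite_std interior_std card_std sum_std scaleR_vector3 add_vector3 zero_vector3)
  \<comment> \<open>Barycentric weights of the origin: 1/2 at the apex and 1/8 at each corner of the
    base.\<close>
  show "0 \<in> interior (convex hull pyr)"
    by (rule zero_interior_hull[where u = "\<lambda>v. if v$3 = 1 then 1/2 else 1/8"]) (simp_all add: finite_std interior_std card_std sum_std scaleR_vector3 add_vector3 zero_vector3)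
  \<comment> \<open>Here the weights are 1/8 at the two vertices with first coordinate -1 and 1/4 at
    the other three.\<close>
  show "0 \<in> interior (convex hull bip)"
    by (rule zero_interior_hull[where u = "\<lambda>v. if v$1 = - 1 then 1/8 else 1/4"]) (simp_all add: finite_std interior_std card_std sum_std scaleR_vector3 add_vector3 zero_vector3)
qed

text \<open>The diagonals of the base bisect each other: coefficients 1 at the ends of one diagonal,
  -1 at those of the other, 0 at the apex. An even polynomial makes the invariance under coordinate
  reflections immediate.\<close>

definition Lpyr :: "real^3 \<Rightarrow> real" where "Lpyr v = (v$1)\<^sup>2 - (v$2)\<^sup>2"
text \<open>Interpolates 2 at the two apexes, -2 at \<open>vector [1, 0, 0]\<close> and -1 at the
  other two base vertices, without using the second coordinate, in which the model is
  reflected.\<close>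

definition Lbip :: "real^3 \<Rightarrow> real" where "Lbip v = (7 * (v$3)\<^sup>2 - 3 - v$1) / 2"

lemma relations_tet: "generates_relations tet (\<lambda>_. 0)"
proof -
  have "\<forall>v\<in>tet. a v = 0" if "affine_relation tet a" for a
  proof -
    have z: "sum a tet = 0" "(\<Sum>v\<in>tet. a v *\<^sub>R v) $ 1 = 0" "(\<Sum>v\<in>tet. a v *\<^sub>R v) $ 2 = 0" "(\<Sum>v\<in>tet. a v *\<^sub>R v) $ 3 = 0"
      using that by (simp_all add: affine_relation_def)
    note eqs = z(1)[unfolded sum_std] z(2-4)[unfolded sum_std, simplified]
    have "a (vector [1, 1, 1]) = 0" "a (vector [1, -1, -1]) = 0" "a (vector [-1, 1, -1]) = 0" "a (vector [-1, -1, 1]) = 0"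
      using eqs by linarith+
    then show ?thesis by (simp add: tet_def)
  qed
  then show ?thesis by (simp add: generates_relations_def affine_relation_def)
qed

lemma relations_pyr: "generates_relations pyr Lpyr"
proof -
  have "\<forall>v\<in>pyr. a v = a (vector [1, 0, -1]) * Lpyr v" if "affine_relation pyr a" for a
  proof -
    have z: "sum a pyr = 0" "(\<Sum>v\<in>pyr. a v *\<^sub>R v) $ 1 = 0" "(\<Sum>v\<in>pyr. a v *\<^sub>R v) $ 2 = 0" "(\<Sum>v\<in>pyr. a v *\<^sub>R v) $ 3 = 0"
      using that by (simp_all add: affine_relation_def)
    note eqs = z(1)[unfolded sum_std] z(2-4)[unfolded sum_std, simplified]
    have "a (vector [-1, 0, -1]) = a (vector [1, 0, -1])" "a (vector [0, 1, -1]) = - a (vector [1, 0, -1])"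
      "a (vector [0, -1, -1]) = - a (vector [1, 0, -1])" "a (vector [0, 0, 1]) = 0"
      using eqs by linarith+
    then show ?thesis by (simp add: pyr_def Lpyr_def)
  qed
  moreover have "affine_relation pyr Lpyr"
    by (simp add: affine_relation_def sum_std scaleR_vector3 add_vector3 zero_vector3 vector3_eq Lpyr_def)
  ultimately show ?thesis unfolding generates_relations_def by blast
qed

lemma relations_bip: "generates_relations bip Lbip"
proof -
  have "\<forall>v\<in>bip. a v = (a (vector [0, 0, 1]) / 2) * Lbip v" if "affine_relation bip a" for a
  proof -
    have z: "sum a bip = 0" "(\<Sum>v\<in>bip. a v *\<^sub>R v) $ 1 = 0" "(\<Sum>v\<in>bip. a v *\<^sub>R v) $ 2 = 0" "(\<Sum>v\<in>bip. a v *\<^sub>R v) $ 3 = 0"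
      using that by (simp_all add: affine_relation_def)
    note eqs = z(1)[unfolded sum_std] z(2-4)[unfolded sum_std, simplified]
    have "a (vector [1, 0, 0]) = - a (vector [0, 0, 1])" "a (vector [-1, 1, 0]) = - a (vector [0, 0, 1]) / 2"
      "a (vector [-1, -1, 0]) = - a (vector [0, 0, 1]) / 2" "a (vector [0, 0, -1]) = a (vector [0, 0, 1])"
      using eqs by linarith+
    then show ?thesis by (simp add: bip_def Lbip_def)
  qed
  moreover have "affine_relation bip Lbip"
    by (simp add: affine_relation_def sum_std scaleR_vector3 add_vector3 zero_vector3 vector3_eq Lbip_def)
  ultimately show ?thesis unfolding generates_relations_def by blast
qed

lemma signs_pyr: "{v \<in> pyr. Lpyr v > 0} = {vector [1, 0, -1], vector [-1, 0, -1]}"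
   "{v \<in> pyr. Lpyr v < 0} = {vector [0, 1, -1], vector [0, -1, -1]}"
  by (auto simp: pyr_def Lpyr_def)

lemma signs_bip: "{v \<in> bip. Lbip v > 0} = {vector [0, 0, 1], vector [0, 0, -1]}"
   "{v \<in> bip. Lbip v < 0} = {vector [1, 0, 0], vector [-1, 1, 0], vector [-1, -1, 0]}"
  by (auto simp: bip_def Lbip_def)

lemma card_signs_std: "card {v \<in> pyr. Lpyr v > 0} = 2" "card {v \<in> pyr. Lpyr v < 0} = 2"
  "card {v \<in> bip. Lbip v > 0} = 2" "card {v \<in> bip. Lbip v < 0} = 3"
  unfolding signs_pyr signs_bip by (simp_all add: vector3_eq)

lemma extreme_std: "{v. v extreme_point_of convex hull tet} = tet" "{v. v extreme_point_of convex hull pyr} = pyr"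
  "{v. v extreme_point_of convex hull bip} = bip"
  using extreme_points_of_relations[OF finite_std(1) relations_tet] extreme_points_of_relations[OF finite_std(2) relations_pyr]
   extreme_points_of_relations[OF finite_std(3) relations_bip] card_signs_std by auto

lemma std_eq: "tetrahedron = skeleton_graph 0 (convex hull tet)" "quadrilateral_pyramid = skeleton_graph 0 (convex hull pyr)"
  "triangular_bipyramid = skeleton_graph 0 (convex hull bip)"
  by (simp_all add: tetrahedron_def quadrilateral_pyramid_def triangular_bipyramid_def tet_def pyr_def bip_def)

lemma polytope3_std: "polytope3 (convex hull tet)" "polytope3 (convex hull pyr)" "polytope3 (convex hull bip)"
  using polytope_convex_hull finite_std interior_std by (unfold_locales; blast)+

lemma diag3_vector: "diag3 a b c *v v = vector [a * v$1, b * v$2, c * v$3]"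
  by (simp add: vec_eq_iff forall_3 matrix_vector_mult_def sum_3)

lemma isotopic_tetrahedron:
  assumes P: "polytope3 P" "c \<in> interior P" and V: "card {v. v extreme_point_of P} = 4"
  shows "isotopic (skeleton_graph c P) tetrahedron"
proof -
  interpret polytope3 P by fact
  \<comment> \<open>Exchanging two coordinates permutes the vertices of the tetrahedron and has
    determinant -1.\<close>
  let ?M = "vector [vector [0, 1, 0], vector [1, 0, 0], vector [0, 0, 1]] :: real^3^3"
  have M: "?M *v v = vector [v$2, v$1, v$3]" for v
    by (simp add: vec_eq_iff forall_3 matrix_vector_mult_def sum_3)
  show ?thesis
    unfolding std_eq
  proof (rule isotopic_standard[OF P refl _ finite_std(1) relations_tet interior_std(1) zero_interior_std(1) extreme_std(1), of "\<lambda>_. 0" ?M])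
    show "generates_relations {v. v extreme_point_of P} (\<lambda>_. 0)" using relations_card4 V unfolding V_def .
    show "det ?M < 0" by (simp add: det_3)
    show "bij_betw (\<lambda>v. ?M *v v) tet tet"
      by (rule bij_betw_involution) (auto simp: M tet_def vec_eq_iff forall_3)
  qed (simp_all add: V card_std)
qed

lemma isotopic_pyramid_or_bipyramid:
  assumes P: "polytope3 P" "c \<in> interior P" and V: "card {v. v extreme_point_of P} = 5"
  shows "isotopic (skeleton_graph c P) quadrilateral_pyramid \<or> isotopic (skeleton_graph c P) triangular_bipyramid"
proof -
  interpret polytope3 P by fact
  let ?W = "{v. v extreme_point_of P}"
  obtain L where L: "generates_relations ?W L" "card {v \<in> ?W. L v > 0} = 2"
    "card {v \<in> ?W. L v < 0} = 2 \<or> card {v \<in> ?W. L v < 0} = 3"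
    using relations_card5_signs[unfolded V_def, OF V] .
  from L(3) show ?thesis
  proof
    assume N: "card {v \<in> ?W. L v < 0} = 2"
    have "isotopic (skeleton_graph c P) quadrilateral_pyramid"
      unfolding std_eq
    proof (rule isotopic_standard[OF P refl L(1) finite_std(2) relations_pyr interior_std(2) zero_interior_std(2) extreme_std(2), of "diag3 (-1) 1 1"])
      show "bij_betw (\<lambda>v. diag3 (-1) 1 1 *v v) pyr pyr"
        by (rule bij_betw_involution) (auto simp: diag3_vector pyr_def vec_eq_iff forall_3)
      show "Lpyr (diag3 (-1) 1 1 *v v) = Lpyr v" for v by (simp add: diag3_vector Lpyr_def)
    qed (use L N V in \<open>simp_all add: card_std card_signs_std det_diag3\<close>)
    then show ?thesis ..
  next
    assume N: "card {v \<in> ?W. L v < 0} = 3"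
    \<comment> \<open>The reflection is in the second coordinate here, since negating the first does
      not preserve \<open>bip\<close>.\<close>
    have "isotopic (skeleton_graph c P) triangular_bipyramid"
      unfolding std_eq
    proof (rule isotopic_standard[OF P refl L(1) finite_std(3) relations_bip interior_std(3) zero_interior_std(3) extreme_std(3), of "diag3 1 (-1) 1"])
      show "bij_betw (\<lambda>v. diag3 1 (-1) 1 *v v) bip bip"
        by (rule bij_betw_involution) (auto simp: diag3_vector bip_def vec_eq_iff forall_3)
      show "Lbip (diag3 1 (-1) 1 *v v) = Lbip v" for v by (simp add: diag3_vector Lbip_def)
    qed (use L N V in \<open>simp_all add: card_std card_signs_std det_diag3\<close>)
    then show ?thesis ..
  qed
qed

section \<open>An invariant that separates the pyramid from the bipyramid\<close>

definition gap :: "sgraph \<Rightarrow> real^3 \<Rightarrow> real^3 \<Rightarrow> bool" where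
  "gap G p q \<longleftrightarrow> (\<forall>e\<in>edges G. \<not> (p \<in> e \<and> q \<in> e))"

text \<open>The base diagonals of the pyramid are two disjoint pairs of non-adjacent vertices; in
  the bipyramid the two apexes are the only non-adjacent pair.\<close>

definition two_gaps :: "sgraph \<Rightarrow> bool" where
  "two_gaps G \<longleftrightarrow> (\<exists>p\<in>verts G. \<exists>q\<in>verts G. \<exists>r\<in>verts G. \<exists>s\<in>verts G. distinct [p, q, r, s] \<and> gap G p q \<and> gap G r s)"

lemma two_gaps_gmap:
  assumes f: "inj_on f S" and G: "verts G \<subseteq> S" "\<And>e. e \<in> edges G \<Longrightarrow> e \<subseteq> S"
  shows "two_gaps (gmap f G) \<longleftrightarrow> two_gaps G"
proof -
  have mem: "f p \<in> f ` e \<longleftrightarrow> p \<in> e" if "p \<in> verts G" "e \<in> edges G" for p e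
    by (rule inj_on_image_mem_iff[OF f]) (use G that in auto)
  have eq: "f p = f q \<longleftrightarrow> p = q" if "p \<in> verts G" "q \<in> verts G" for p q
    by (rule inj_on_eq_iff[OF f]) (use G that in auto)
  have gap: "gap (gmap f G) (f p) (f q) \<longleftrightarrow> gap G p q" if "p \<in> verts G" "q \<in> verts G" for p q
    using that mem by (auto simp: gap_def)
  show ?thesis
    unfolding two_gaps_def gmap_simps bex_simps(7) distinct.simps list.set
    by (intro bex_cong refl) (auto simp: eq gap)
qed

context polytope3 begin

lemma gap_iff_joined:
  assumes L: "generates_relations V L" and uv: "u \<in> V" "v \<in> V" "u \<noteq> v"
  shows "gap (SGraph V E) u v \<longleftrightarrow> \<not> joined V L u v"
proof -
  have "e = closed_segment u v" if e: "e \<in> E" "u \<in> e" "v \<in> e" for e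
  proof -
    obtain x where x: "x \<noteq> u" "e = closed_segment u x" "{y \<in> V. y \<in> e} = {u, x}"
      by (rule other_vertex[OF e(1) uv(1) e(2)]) (use that in blast)
    have "v \<in> {u, x}" unfolding x(3)[symmetric] using uv e by blast
    then show ?thesis using uv x by blast
  qed
  moreover have "closed_segment u v \<in> E \<longleftrightarrow> joined V L u v"
    using segment_edge_if_joined[OF L uv] joined_if_segment_edge[OF L uv] by blast
  ultimately show ?thesis unfolding gap_def by auto
qed

lemma two_gaps_skeleton:
  assumes "c \<in> interior P"
  shows "two_gaps (skeleton_graph c P) \<longleftrightarrow> two_gaps (SGraph V E)"
  unfolding skeleton_gmap using V_frontier E_frontier by (intro two_gaps_gmap[OF inj_proj[OF assms]]) auto

end

lemma isotopic_two_gaps: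
  assumes "isotopic G G'" "on_sphere G"
  shows "two_gaps G' \<longleftrightarrow> two_gaps G"
proof -
  obtain f g where f: "homeomorphism S2 S2 f g" "G' = gmap f G" using isotopic_homeomorphism[OF assms(1)] .
  have "inj_on f S2" using f by (metis homeomorphism_def inj_on_inverseI)
  then show ?thesis unfolding f(2) using assms(2) by (intro two_gaps_gmap) (auto simp: on_sphere_def)
qed

lemma two_gaps_pyramid: "two_gaps quadrilateral_pyramid"
proof -
  interpret polytope3 "convex hull pyr" by (rule polytope3_std)
  have V: "V = pyr" using extreme_std by (simp add: V_def)
  let ?p = "vector [1, 0, -1] :: real^3" and ?q = "vector [-1, 0, -1] :: real^3"
    and ?r = "vector [0, 1, -1] :: real^3" and ?s = "vector [0, -1, -1] :: real^3"
  have m: "?p \<in> V" "?q \<in> V" "?r \<in> V" "?s \<in> V" unfolding V by (simp_all add: pyr_def)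
  have L: "generates_relations V Lpyr" using relations_pyr V by simp
  have "\<not> joined V Lpyr ?p ?q" "\<not> joined V Lpyr ?r ?s"
    unfolding V joined_def by (auto simp: pyr_def Lpyr_def vector3_eq)
  then have "gap (SGraph V E) ?p ?q" "gap (SGraph V E) ?r ?s"
    using gap_iff_joined[OF L] m by (simp_all add: vector3_eq)
  moreover have "distinct [?p, ?q, ?r, ?s]" by (simp add: vector3_eq)
  ultimately have "two_gaps (SGraph V E)" unfolding two_gaps_def using m by (metis sgraph.sel(1))
  then show ?thesis unfolding std_eq two_gaps_skeleton[OF zero_interior_std(2)] .
qed

text \<open>A pair without the apex \<open>vector [0, 0, 1]\<close> leaves this positive vertex and,
  of the three negative ones, at least one; so it is joined. Hence two gaps share the apex and are
  not disjoint.\<close>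

lemma not_two_gaps_bipyramid: "\<not> two_gaps triangular_bipyramid"
proof
  interpret polytope3 "convex hull bip" by (rule polytope3_std)
  have V: "V = bip" using extreme_std by (simp add: V_def)
  have L: "generates_relations V Lbip" using relations_bip V by simp
  assume "two_gaps triangular_bipyramid"
  then have "two_gaps (SGraph V E)" unfolding std_eq two_gaps_skeleton[OF zero_interior_std(3)] .
  then obtain p q r s where pq: "p \<in> V" "q \<in> V" "r \<in> V" "s \<in> V" "distinct [p, q, r, s]"
    "gap (SGraph V E) p q" "gap (SGraph V E) r s" by (auto simp: two_gaps_def)
  then have nj: "\<not> joined V Lbip p q" "\<not> joined V Lbip r s" using gap_iff_joined[OF L] by auto
  have K: "vector [0, 0, 1] \<in> {p, q}" if nj: "\<not> joined V Lbip p q" for p q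
  proof (rule ccontr)
    assume "vector [0, 0, 1] \<notin> {p, q}"
    then have "\<exists>w\<in>V - {p, q}. Lbip w > 0"
      unfolding V by (intro bexI[of _ "vector [0, 0, 1]"]) (auto simp: bip_def Lbip_def)
    moreover have "\<exists>w\<in>V - {p, q}. Lbip w < 0"
    proof (rule ccontr)
      assume "\<not> ?thesis"
      then have "{v \<in> bip. Lbip v < 0} \<subseteq> {p, q}" unfolding V by auto
      then have "card {v \<in> bip. Lbip v < 0} \<le> card {p, q}" by (intro card_mono) auto
      also have "\<dots> \<le> 2" by (simp add: card_insert_if)
      finally show False using card_signs_std by simp
    qed
    ultimately show False using nj by (simp add: joined_def)
  qed
  show False using K[OF nj(1)] K[OF nj(2)] pq(5) by auto
qed

section \<open>Towers with a prescribed number of rigid vertices\<close>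

definition affine_fn :: "(real^3 \<Rightarrow> real) \<Rightarrow> bool" where
  "affine_fn h \<longleftrightarrow> (\<exists>a b. \<forall>x. h x = a \<bullet> x + b)"

lemma affine_fn_add:
  assumes "affine_fn h" "affine_fn k"
  shows "affine_fn (\<lambda>x. h x + k x)"
proof -
  obtain a b a' b' where "\<And>x. h x = a \<bullet> x + b" "\<And>x. k x = a' \<bullet> x + b'" using assms by (auto simp: affine_fn_def)
  then show ?thesis unfolding affine_fn_def
    by (intro exI[of _ "a + a'"] exI[of _ "b + b'"]) (simp add: inner_add_left)
qed

lemma affine_fn_coordinates: "affine_fn (\<lambda>x. p * x$1 + q * x$2 + r * x$3 + s)"
  unfolding affine_fn_def
  by (rule exI[of _ "vector [p, q, r]"], rule exI[of _ s]) (simp add: inner_vec_def sum_3)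

lemma extreme_points_exposed:
  assumes W: "finite W" and h: "\<And>v. v \<in> W \<Longrightarrow> \<exists>h. affine_fn h \<and> (\<forall>w\<in>W. h w \<ge> 0) \<and> (\<forall>w\<in>W. h w = 0 \<longleftrightarrow> w = v)"
  shows "{v. v extreme_point_of convex hull W} = W"
proof -
  have "v \<notin> convex hull (W - {v})" if v: "v \<in> W" for v
  proof
    obtain h where "affine_fn h" and h: "\<forall>w\<in>W. h w \<ge> 0" "\<forall>w\<in>W. h w = 0 \<longleftrightarrow> w = v" using assms(2)[OF v] by blast
    then obtain a b where ab: "\<And>x. h x = a \<bullet> x + b" by (auto simp: affine_fn_def)
    have "convex hull (W - {v}) \<subseteq> {x. a \<bullet> x > - b}"
    proof (rule hull_minimal)
      show "W - {v} \<subseteq> {x. a \<bullet> x > - b}"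
      proof
        fix w assume w: "w \<in> W - {v}"
        then have "h w \<ge> 0" "h w \<noteq> 0" using h by auto
        then show "w \<in> {x. a \<bullet> x > - b}" unfolding ab by simp
      qed
    qed (simp add: convex_halfspace_gt)
    moreover assume "v \<in> convex hull (W - {v})"
    ultimately have "a \<bullet> v > - b" by blast
    moreover have "h v = 0" using h v by blast
    ultimately show False unfolding ab by simp
  qed
  then show ?thesis
    using extreme_point_of_convex_hull_convex_independent[OF finite_imp_compact[OF W]] by blast
qed

context polytope3 begin

text \<open>Three vertices on the supported face exclude dimension at most 1, since an edge contains
  only two.\<close>

lemma facet_of_functional:
  assumes h: "affine_fn h" "\<And>v. v \<in> V \<Longrightarrow> h v \<ge> 0" "\<exists>v\<in>V. h v \<noteq> 0" "card {v \<in> V. h v = 0} \<ge> 3"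
  shows "{x \<in> P. h x = 0} \<in> Fc" "{v \<in> V. v \<in> {x \<in> P. h x = 0}} = {v \<in> V. h v = 0}"
proof -
  obtain a b where ab: "\<And>x. h x = a \<bullet> x + b" using h(1) by (auto simp: affine_fn_def)
  let ?F = "{x \<in> P. h x = 0}"
  show V: "{v \<in> V. v \<in> ?F} = {v \<in> V. h v = 0}" using V_subset_P by auto
  have "V \<subseteq> {x. a \<bullet> x \<ge> - b}"
  proof
    fix v assume "v \<in> V"
    then show "v \<in> {x. a \<bullet> x \<ge> - b}" using h(2)[of v] unfolding ab by simp
  qed
  then have "P \<subseteq> {x. a \<bullet> x \<ge> - b}"
    using P_hull hull_minimal[of V "{x. a \<bullet> x \<ge> - b}" convex] convex_halfspace_ge by metis
  then have "(P \<inter> {x. a \<bullet> x = - b}) face_of P"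
    by (intro face_of_Int_supporting_hyperplane_ge[OF convex_P]) auto
  moreover have "P \<inter> {x. a \<bullet> x = - b} = ?F" unfolding ab by auto
  ultimately have f: "?F face_of P" by simp
  obtain v0 where v0: "v0 \<in> V" "h v0 \<noteq> 0" using h(3) by blast
  then have "?F \<noteq> P" using V_subset_P by auto
  then have "aff_dim ?F < 3" using face_of_aff_dim_lt[OF convex_P f] aff_dim_P by simp
  moreover have "aff_dim ?F \<noteq> 1"
  proof
    assume "aff_dim ?F = 1"
    then have "?F \<in> E" using f by (simp add: E_def edge_of_def)
    then have "card {v \<in> V. v \<in> ?F} = 2" by (rule card_edge_vertices)
    then show False using h(4) unfolding V by simp
  qed
  moreover have "\<not> aff_dim ?F \<le> 0"
  proof
    assume "aff_dim ?F \<le> 0"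
    then have "\<exists>x. ?F \<subseteq> {x}"
    proof (cases "aff_dim ?F = 0")
      case True then show ?thesis by (auto simp: aff_dim_eq_0)
    next
      case False
      then have "aff_dim ?F < 0" using \<open>aff_dim ?F \<le> 0\<close> by linarith
      then have "?F = {}" by (simp only: aff_dim_negative_iff)
      then show ?thesis by (simp only:) simp
    qed
    then obtain x where "{v \<in> V. v \<in> ?F} \<subseteq> {x}" by blast
    then have "card {v \<in> V. v \<in> ?F} \<le> card {x}" by (intro card_mono) auto
    then show False using h(4) unfolding V by simp
  qed
  ultimately have d2: "aff_dim ?F = 2" by linarith
  have "?F \<noteq> {}"
  proof
    assume "?F = {}"
    then have "aff_dim ?F = - 1" by (simp only: aff_dim_empty)
    then show False using d2 by linarith
  qed
  then show "?F \<in> Fc" using f d2 unfolding Fc_def facet_of_def aff_dim_P by simp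
qed

lemma sum_facets_upper: "(\<Sum>F\<in>Fc. int (fsize F) - 2) \<le> 2 * int (card V) - 4"
proof -
  have "(\<Sum>F\<in>Fc. int (fsize F) - 2) = int (\<Sum>F\<in>Fc. fsize F) - 2 * int (card Fc)"
    by (simp add: sum_subtractf)
  then show ?thesis using sum_fsize euler_inequality by simp
qed

text \<open>A completeness test. Every facet adds at least 1 to the sum of
  \<open>fsize F - 2\<close>, which Euler's inequality bounds by \<open>2 * card V - 4\<close>;
  listed facets that already reach the bound leave no room for another.\<close>

lemma all_facets:
  assumes I: "finite I" "inj_on S I"
    and S: "\<And>i. i \<in> I \<Longrightarrow> card (S i) \<ge> 3" "\<And>i. i \<in> I \<Longrightarrow> S i \<subset> V"
    and h: "\<And>i. i \<in> I \<Longrightarrow> affine_fn (h i)" "\<And>i v. i \<in> I \<Longrightarrow> v \<in> V \<Longrightarrow> h i v \<ge> 0"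
      "\<And>i v. i \<in> I \<Longrightarrow> v \<in> V \<Longrightarrow> h i v = 0 \<longleftrightarrow> v \<in> S i"
    and sum: "(\<Sum>i\<in>I. int (card (S i)) - 2) \<ge> 2 * int (card V) - 4"
  shows "v \<in> V \<Longrightarrow> d v = card {i \<in> I. v \<in> S i \<and> card (S i) \<noteq> 3}"
proof -
  define Q where "Q i = {x \<in> P. h i x = 0}" for i
  have SV: "{v \<in> V. h i v = 0} = S i" if "i \<in> I" for i using h(3)[OF that] S(2)[OF that] by blast
  have nz: "\<exists>v\<in>V. h i v \<noteq> 0" if "i \<in> I" for i using h(3)[OF that] S(2)[OF that] by blast
  have Q: "Q i \<in> Fc" "{v \<in> V. v \<in> Q i} = S i" if "i \<in> I" for i
    using facet_of_functional[OF h(1)[OF that] h(2)[OF that] nz[OF that]] S(1)[OF that]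
    unfolding SV[OF that] Q_def by auto
  have fs: "fsize (Q i) = card (S i)" if "i \<in> I" for i using Q(2)[OF that] by (simp add: fsize_def)
  have inj: "inj_on Q I"
  proof (rule inj_onI)
    fix i j assume "i \<in> I" "j \<in> I" "Q i = Q j"
    then have "S i = S j" using Q(2) by metis
    then show "i = j" using I(2) \<open>i \<in> I\<close> \<open>j \<in> I\<close> by (auto dest: inj_onD)
  qed
  have sub: "Q ` I \<subseteq> Fc" using Q by blast
  have "Q ` I = Fc"
  proof (rule ccontr)
    assume "Q ` I \<noteq> Fc"
    then obtain F where F: "F \<in> Fc" "F \<notin> Q ` I" using sub by blast
    have "(\<Sum>F\<in>Q ` I. int (fsize F) - 2) = (\<Sum>i\<in>I. int (card (S i)) - 2)"
      using fs by (simp add: sum.reindex[OF inj])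
    moreover have "(\<Sum>F\<in>insert F (Q ` I). int (fsize F) - 2) \<le> (\<Sum>F\<in>Fc. int (fsize F) - 2)"
      using finite_Fc F sub fsize_ge3 by (intro sum_mono2) force+
    moreover have "(\<Sum>F\<in>insert F (Q ` I). int (fsize F) - 2) = int (fsize F) - 2 + (\<Sum>F\<in>Q ` I. int (fsize F) - 2)"
      using I F by simp
    moreover have "fsize F \<ge> 3" using F fsize_ge3 by blast
    ultimately show False using sum sum_facets_upper by linarith
  qed
  then have "{F \<in> Fc. v \<in> F \<and> fsize F \<noteq> 3} = Q ` {i \<in> I. v \<in> S i \<and> card (S i) \<noteq> 3}" if "v \<in> V" for v
  proof -
    have "v \<in> Q i \<longleftrightarrow> v \<in> S i" if "i \<in> I" for i using Q(2)[OF that] \<open>v \<in> V\<close> by blast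
    then show ?thesis using fs unfolding \<open>Q ` I = Fc\<close>[symmetric] by auto
  qed
  moreover have "inj_on Q {i \<in> I. v \<in> S i \<and> card (S i) \<noteq> 3}" for v by (rule inj_on_subset[OF inj]) auto
  ultimately show "v \<in> V \<Longrightarrow> d v = card {i \<in> I. v \<in> S i \<and> card (S i) \<noteq> 3}"
    by (simp add: d_def card_image)
qed

end

text \<open>No integer lies strictly between 0 and 1. This discrete convexity puts both the points
  on the parabola and the stacked layers in convex position.\<close>

lemma nat_gap_product:
  fixes a b :: nat
  shows "(real a - real b) * (real a - real b - 1) \<ge> 0"
    and "(real a - real b) * (real a - real b - 1) = 0 \<longleftrightarrow> a = b \<or> a = b + 1"
proof -
  consider "a \<le> b" | "a \<ge> b + 1" by linarith
  then show "(real a - real b) * (real a - real b - 1) \<ge> 0"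
    by cases (auto intro: mult_nonpos_nonpos mult_nonneg_nonneg)
  have "real a - real b - 1 = 0 \<longleftrightarrow> real a = real (b + 1)" by auto
  then show "(real a - real b) * (real a - real b - 1) = 0 \<longleftrightarrow> a = b \<or> a = b + 1"
    unfolding mult_eq_0_iff of_nat_eq_iff by simp
qed

text \<open>The towers: \<open>n + 1\<close> scaled copies of an inscribed \<open>m\<close>-gon of the parabola are stacked over the
  point \<open>(1, 3/2)\<close>, the scaling factor at height \<open>k\<close> being \<open>A - k\<^sup>2\<close>. For \<open>A = n\<^sup>2\<close> the top copy
  shrinks to an apex.\<close>

locale tower =
  fixes m n :: nat and A :: real
  assumes m: "m \<ge> 3" and n: "n \<ge> 2" and A: "A \<ge> (real n)\<^sup>2"
begin

definition "r k = A - (real k)\<^sup>2"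

definition pt :: "nat \<Rightarrow> nat \<Rightarrow> real^3" where
  "pt j k = vector [1 + r k * (real j - 1), 3/2 + r k * ((real j)\<^sup>2 - 3/2), real k]"

definition "nxt e = (if e = m - 1 then 0 else e + 1)"

text \<open>For \<open>e < m - 1\<close> the line through the parabola points with parameters
  \<open>e\<close> and \<open>e + 1\<close>; for \<open>e = m - 1\<close> the closing chord from the
  last point to the origin. Signs are such that the polygon is on the nonnegative side.\<close>

definition edge_form :: "nat \<Rightarrow> real \<Rightarrow> real \<Rightarrow> real" where
  "edge_form e x y = (if e = m - 1 then (real m - 1) * x - y else y - (2 * real e + 1) * x + real e * (real e + 1))"

text \<open>A polygon edge scaled by \<open>s\<close> about the centre is the locus where
  \<open>edge_form e x y\<close> equals \<open>1 - s\<close> times its value at the centre. For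
  \<open>s\<close> the form inserts \<open>A - (2 i + 1) z + i (i + 1)\<close>, the chord of the
  concave function \<open>r\<close> between the heights \<open>i\<close> and \<open>i + 1\<close>,
  and so becomes affine.\<close>

definition side :: "nat \<Rightarrow> nat \<Rightarrow> real^3 \<Rightarrow> real" where
  "side e i x = edge_form e (x$1) (x$2) - edge_form e 1 (3/2) * (1 - (A - (2 * real i + 1) * x$3 + real i * (real i + 1)))"

definition "W = (\<lambda>(j, k). pt j k) ` ({..<m} \<times> {..n})"

lemma r_nonneg: "k \<le> n \<Longrightarrow> r k \<ge> 0"
proof -
  assume "k \<le> n"
  then have "(real k)\<^sup>2 \<le> (real n)\<^sup>2" by (intro power_mono) auto
  then show ?thesis using A unfolding r_def by linarith
qed

lemma r_pos: "k < n \<Longrightarrow> r k > 0"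
proof -
  assume "k < n"
  then have "(real k)\<^sup>2 < (real n)\<^sup>2" by (intro power_strict_mono) auto
  then show ?thesis using A unfolding r_def by linarith
qed

text \<open>The value is \<open>e (e - 1) + 1/2\<close> for \<open>e < m - 1\<close> and
  \<open>m - 5/2\<close> for the closing chord; so the centre lies inside every polygon with at
  least three corners.\<close>

lemma edge_form_centre_pos: "e < m \<Longrightarrow> edge_form e 1 (3/2) > 0"
proof -
  assume e: "e < m"
  show ?thesis
  proof (cases "e = m - 1")
    case True then show ?thesis using m by (simp add: edge_form_def)
  next
    case False
    have "(real e - real 0) * (real e - real 0 - 1) \<ge> 0" by (rule nat_gap_product)
    then show ?thesis using False by (simp add: edge_form_def algebra_simps)
  qed
qed

lemma edge_form_vertex:
  assumes "e < m" "j < m"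
  shows "edge_form e (real j) ((real j)\<^sup>2) \<ge> 0" "edge_form e (real j) ((real j)\<^sup>2) = 0 \<longleftrightarrow> j = e \<or> j = nxt e"
proof -
  have *: "edge_form e (real j) ((real j)\<^sup>2) = (if e = m - 1 then real j * (real m - 1 - real j) else (real j - real e) * (real j - real e - 1))"
    by (simp add: edge_form_def algebra_simps power2_eq_square)
  show "edge_form e (real j) ((real j)\<^sup>2) \<ge> 0"
    unfolding * using nat_gap_product(1)[of j e] assms by (auto intro!: mult_nonneg_nonneg)
  show "edge_form e (real j) ((real j)\<^sup>2) = 0 \<longleftrightarrow> j = e \<or> j = nxt e"
    unfolding * using nat_gap_product(2)[of j e] assms m by (auto simp: nxt_def)
qed

text \<open>The value splits into a horizontal part, from the polygon edge, and a vertical part,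
  from the gap between \<open>r\<close> and its chord. Both are nonnegative, so the zeros can be
  found separately.\<close>

lemma side_pt:
  "side e i (pt j k) = r k * edge_form e (real j) ((real j)\<^sup>2) + edge_form e 1 (3/2) * ((real k - real i) * (real k - real i - 1))"
  by (simp add: side_def pt_def edge_form_def r_def field_simps power2_eq_square)

lemma side_nonneg:
  assumes "e < m" "j < m" "k \<le> n"
  shows "side e i (pt j k) \<ge> 0"
  unfolding side_pt
  by (rule add_nonneg_nonneg[OF mult_nonneg_nonneg[OF r_nonneg[OF assms(3)] edge_form_vertex(1)[OF assms(1,2)]]
      mult_nonneg_nonneg[OF less_imp_le[OF edge_form_centre_pos[OF assms(1)]] nat_gap_product(1)]])

lemma side_eq_0:
  assumes "e < m" "j < m" "k \<le> n"
  shows "side e i (pt j k) = 0 \<longleftrightarrow> (k = i \<or> k = i + 1) \<and> (r k = 0 \<or> j = e \<or> j = nxt e)"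
proof -
  have 1: "r k * edge_form e (real j) ((real j)\<^sup>2) \<ge> 0"
    by (rule mult_nonneg_nonneg[OF r_nonneg[OF assms(3)] edge_form_vertex(1)[OF assms(1,2)]])
  have 2: "edge_form e 1 (3/2) * ((real k - real i) * (real k - real i - 1)) \<ge> 0"
    by (rule mult_nonneg_nonneg[OF less_imp_le[OF edge_form_centre_pos[OF assms(1)]] nat_gap_product(1)])
  have "side e i (pt j k) = 0 \<longleftrightarrow> r k * edge_form e (real j) ((real j)\<^sup>2) = 0 \<and> edge_form e 1 (3/2) * ((real k - real i) * (real k - real i - 1)) = 0"
    unfolding side_pt using 1 2 by (rule add_nonneg_eq_0_iff)
  also have "\<dots> \<longleftrightarrow> (r k = 0 \<or> j = e \<or> j = nxt e) \<and> (k = i \<or> k = i + 1)"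
    using edge_form_centre_pos[OF assms(1)] edge_form_vertex(2)[OF assms(1,2)] nat_gap_product(2)[of k i] by auto
  finally show ?thesis by blast
qed

lemma affine_fn_side: "affine_fn (side e i)"
proof -
  let ?G = "edge_form e 1 (3/2)"
  have eq: "side e i = (\<lambda>x. (if e = m - 1 then real m - 1 else - (2 * real e + 1)) * x$1 + (if e = m - 1 then - 1 else 1) * x$2
     + (- ?G * (2 * real i + 1)) * x$3 + ((if e = m - 1 then 0 else real e * (real e + 1)) - ?G * (1 - A - real i * (real i + 1))))"
    by (rule ext) (simp add: side_def edge_form_def algebra_simps)
  show ?thesis unfolding eq by (rule affine_fn_coordinates)
qed

lemma pt_3: "pt j k $ 3 = real k" and pt_1: "pt j k $ 1 = 1 + r k * (real j - 1)"
  by (simp_all add: pt_def)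

lemma pt_eq: "pt j k = pt j' k' \<longleftrightarrow> k = k' \<and> (r k = 0 \<or> j = j')"
proof
  assume eq: "pt j k = pt j' k'"
  have "k = k'" using arg_cong[OF eq, of "\<lambda>v. v$3"] by (simp add: pt_3)
  moreover have "r k = 0 \<or> j = j'" using arg_cong[OF eq, of "\<lambda>v. v$1"] \<open>k = k'\<close> by (simp add: pt_1)
  ultimately show "k = k' \<and> (r k = 0 \<or> j = j')" by blast
qed (auto simp: pt_def)

lemma W_iff: "w \<in> W \<longleftrightarrow> (\<exists>j k. j < m \<and> k \<le> n \<and> w = pt j k)"
  by (auto simp: W_def)

lemma pt_W: "j < m \<Longrightarrow> k \<le> n \<Longrightarrow> pt j k \<in> W"
  by (auto simp: W_iff)

lemma finite_W: "finite W"
  by (simp add: W_def)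

definition "prv j = (if j = 0 then m - 1 else j - 1)"

lemma nxt_lt: "e < m \<Longrightarrow> nxt e < m" and prv_lt: "e < m \<Longrightarrow> prv e < m"
  and nxt_prv: "e < m \<Longrightarrow> nxt (prv e) = e" and prv_nxt: "e < m \<Longrightarrow> prv (nxt e) = e"
  and nxt_neq: "e < m \<Longrightarrow> nxt e \<noteq> e" and nxt_neq_prv: "e < m \<Longrightarrow> nxt e \<noteq> prv e"
  using m by (auto simp: nxt_def prv_def split: if_splits)

text \<open>A sum of three supporting forms that vanish together only at \<open>v\<close>: the sides
  over both polygon edges at corner \<open>j\<close> in one storey fix the column, up to the
  coincidence of all columns at an apex, and \<open>l\<close> fixes the height.\<close>

lemma extreme_W: "{v. v extreme_point_of convex hull W} = W"
proof (rule extreme_points_exposed[OF finite_W])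
  fix v assume "v \<in> W"
  then obtain j k where v: "j < m" "k \<le> n" "v = pt j k" by (auto simp: W_iff)
  \<comment> \<open>A storey touching height \<open>k\<close>; above the top there is none, so the
    top uses the last one.\<close>
  define i where "i = (if k < n then k else n - 1)"
  define l :: "real^3 \<Rightarrow> real" where "l = (if k = 0 then (\<lambda>x. x$3) else if k = n then (\<lambda>x. real n - x$3) else side j (k - 1))"
  have l: "affine_fn l"
    using affine_fn_coordinates[of 0 0 1 0] affine_fn_coordinates[of 0 0 "-1" "real n"] affine_fn_side
    by (simp add: l_def)
  have l0: "l (pt j' k') \<ge> 0" if "j' < m" "k' \<le> n" for j' k'
    using side_nonneg that v by (auto simp: l_def pt_3)
  let ?h = "\<lambda>x. side j i x + side (prv j) i x + l x"
  have "affine_fn ?h" by (intro affine_fn_add affine_fn_side l)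
  moreover have "?h w \<ge> 0" if "w \<in> W" for w
    using that side_nonneg l0 v prv_lt by (auto simp: W_iff intro!: add_nonneg_nonneg)
  moreover have "?h w = 0 \<longleftrightarrow> w = v" if wW: "w \<in> W" for w
  proof -
    obtain j' k' where w: "j' < m" "k' \<le> n" "w = pt j' k'" using wW by (auto simp: W_iff)
    have p: "prv j < m" using v prv_lt by blast
    have nn: "side j i w \<ge> 0" "side (prv j) i w \<ge> 0" "l w \<ge> 0"
      using side_nonneg v w p l0 by simp_all
    have "?h w = 0 \<longleftrightarrow> side j i w = 0 \<and> side (prv j) i w = 0 \<and> l w = 0"
      using nn by linarith
    also have "side j i w = 0 \<longleftrightarrow> (k' = i \<or> k' = i + 1) \<and> (r k' = 0 \<or> j' = j \<or> j' = nxt j)"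
      unfolding w(3) by (rule side_eq_0[OF v(1) w(1,2)])
    also have "side (prv j) i w = 0 \<longleftrightarrow> (k' = i \<or> k' = i + 1) \<and> (r k' = 0 \<or> j' = prv j \<or> j' = j)"
      unfolding w(3) side_eq_0[OF p w(1,2)] nxt_prv[OF v(1)] ..
    also have "l w = 0 \<longleftrightarrow> (if k = 0 then k' = 0 else if k = n then k' = n else (k' = k - 1 \<or> k' = k) \<and> (r k' = 0 \<or> j' = j \<or> j' = nxt j))"
      using side_eq_0[OF v(1) w(1,2), of "k - 1"] by (auto simp: l_def w(3) pt_3)
    also have "((k' = i \<or> k' = i + 1) \<and> (r k' = 0 \<or> j' = j \<or> j' = nxt j)) \<and>
       ((k' = i \<or> k' = i + 1) \<and> (r k' = 0 \<or> j' = prv j \<or> j' = j)) \<and>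
       (if k = 0 then k' = 0 else if k = n then k' = n else (k' = k - 1 \<or> k' = k) \<and> (r k' = 0 \<or> j' = j \<or> j' = nxt j)) \<longleftrightarrow>
       k' = k \<and> (r k' = 0 \<or> j' = j)"
      using nxt_neq_prv[OF v(1)] v(2) n by (auto simp: i_def split: if_splits)
    also have "\<dots> \<longleftrightarrow> w = v" unfolding w(3) v(3) pt_eq by auto
    finally show ?thesis .
  qed
  ultimately show "\<exists>h. affine_fn h \<and> (\<forall>w\<in>W. h w \<ge> 0) \<and> (\<forall>w\<in>W. h w = 0 \<longleftrightarrow> w = v)"
    by (intro exI[of _ ?h]) blast
qed

lemma polytope3_tower: "polytope3 (convex hull W)"
proof
  show "polytope (convex hull W)" using finite_W polytope_convex_hull by blast
  show "interior (convex hull W) \<noteq> {}"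
  proof (rule interior_hull_nonempty)
    fix a :: "real^3" and b assume ab: "W \<subseteq> {x. a \<bullet> x = b}"
    have in_ab: "a$1 * (1 + r k * (real j - 1)) + a$2 * (3/2 + r k * ((real j)\<^sup>2 - 3/2)) + a$3 * real k = b"
      if "j < m" "k \<le> n" for j k
    proof -
      have "a \<bullet> pt j k = b" using pt_W[OF that] ab by blast
      then show ?thesis by (simp add: pt_def inner_vector3)
    qed
    have e0: "a$1 * (1 - r 0) + a$2 * (3/2 - r 0 * (3/2)) = b" using in_ab[of 0 0] m by simp
    have e1: "a$1 + a$2 * (3/2 + r 0 * (- 1/2)) = b" using in_ab[of 1 0] m by simp
    have e2: "a$1 * (1 + r 0) + a$2 * (3/2 + r 0 * (5/2)) = b" using in_ab[of 2 0] m by simp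
    have "r 0 * (a$1 + a$2) = 0" "r 0 * (a$1 + 3 * a$2) = 0"
      using e0 e1 e2 by (simp_all add: algebra_simps)
    then have "a$1 + a$2 = 0" "a$1 + 3 * a$2 = 0" using r_pos[of 0] n by simp_all
    then have a12: "a$1 = 0" "a$2 = 0" by linarith+
    then have "a$3 = 0" using in_ab[of 0 0] in_ab[of 0 1] m n by simp
    then show "a = 0" using a12 by (simp add: vec_eq_iff forall_3)
  qed
qed

section \<open>Layers and facets of a tower\<close>

definition "layer k = (\<lambda>j. pt j k) ` {..<m}"

lemma card_layer: "card (layer k) = (if r k = 0 then 1 else m)"
proof (cases "r k = 0")
  case True
  have "layer k = {pt 0 k}" using True m by (auto simp: layer_def pt_eq image_iff intro!: exI[of _ 0])
  then show ?thesis using True by simp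
next
  case False
  then have "inj_on (\<lambda>j. pt j k) {..<m}" by (auto simp: inj_on_def pt_eq)
  then show ?thesis using False by (simp add: layer_def card_image)
qed

lemma layer_iff: "j < m \<Longrightarrow> pt j k \<in> layer k' \<longleftrightarrow> k = k'"
  by (auto simp: layer_def pt_eq)

lemma W_layers: "W = (\<Union>k\<in>{..n}. layer k)"
  by (simp add: set_eq_iff W_iff layer_def image_iff) blast

lemma layer_W: "k \<le> n \<Longrightarrow> layer k \<subseteq> W"
  by (auto simp: layer_def intro: pt_W)

lemma layers_disjoint: "k \<noteq> k' \<Longrightarrow> layer k \<inter> layer k' = {}"
  by (auto simp: layer_def pt_eq)

lemma finite_layer: "finite (layer k)"
  by (simp add: layer_def)

lemma card_W: "card W = m * n + card (layer n)"
proof -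
  have "card W = (\<Sum>k\<in>{..n}. card (layer k))"
    unfolding W_layers by (rule card_UN_disjoint) (use layers_disjoint finite_layer in auto)
  also have "{..n} = insert n {..<n}" by auto
  also have "(\<Sum>k\<in>insert n {..<n}. card (layer k)) = card (layer n) + (\<Sum>k<n. card (layer k))" by simp
  also have "(\<Sum>k<n. card (layer k)) = (\<Sum>k<n. m)"
    using r_pos card_layer by (intro sum.cong refl) (metis lessThan_iff less_irrefl)
  finally show ?thesis by simp
qed

text \<open>The facets are indexed by pairs: \<open>(e, i)\<close> with \<open>e < m\<close> is a side over the edge \<open>e\<close> of the polygon,
  between the heights \<open>i\<close> and \<open>i + 1\<close>; \<open>(m, 0)\<close> and \<open>(m, 1)\<close> are the bottom and the top.\<close>

definition "idx = {..<m} \<times> {..<n} \<union> {(m, 0)} \<union> (if r n = 0 then {} else {(m, 1)})"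

definition "facet_form = (\<lambda>(e, i). if e < m then side e i else if i = 0 then (\<lambda>x. x$3) else (\<lambda>x. real n - x$3))"

definition "fverts = (\<lambda>(e, i). if e < m then {pt e i, pt (nxt e) i, pt e (i + 1), pt (nxt e) (i + 1)}
   else if i = 0 then layer 0 else layer n)"

lemma finite_idx: "finite idx"
  by (simp add: idx_def)

lemma pt_side:
  assumes "e < m" "i < n" "j < m" "k \<le> n"
  shows "pt j k \<in> fverts (e, i) \<longleftrightarrow> (k = i \<or> k = i + 1) \<and> (r k = 0 \<or> j = e \<or> j = nxt e)"
  using assms by (auto simp: fverts_def pt_eq)

lemma card_side:
  assumes "e < m" "i < n"
  shows "card (fverts (e, i)) = (if r (Suc i) = 0 then 3 else 4)"
  using assms nxt_neq[OF assms(1)] r_pos[OF assms(2)] by (auto simp: fverts_def pt_eq card_insert_if)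

lemma r_1_eq_0: "i < n \<Longrightarrow> r (Suc i) = 0 \<longleftrightarrow> r n = 0 \<and> i = n - 1"
proof -
  assume i: "i < n"
  show ?thesis
  proof (cases "i = n - 1")
    case True then show ?thesis using i by simp
  next
    case False
    then have "Suc i < n" using i by linarith
    then show ?thesis using r_pos[of "Suc i"] False by simp
  qed
qed

lemma fverts_W: "x \<in> idx \<Longrightarrow> fverts x \<subseteq> W"
  using nxt_lt layer_W[of 0] layer_W[of n] by (auto simp: idx_def fverts_def intro!: pt_W split: if_splits)

lemma facet_form_fverts:
  assumes "x \<in> idx" "v \<in> W"
  shows "facet_form x v \<ge> 0" "facet_form x v = 0 \<longleftrightarrow> v \<in> fverts x"
proof -
  obtain j k where v: "j < m" "k \<le> n" "v = pt j k" using assms by (auto simp: W_iff)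
  obtain e i where x: "x = (e, i)" by force
  have ei: "(e < m \<and> i < n) \<or> (e = m \<and> i = 0) \<or> (e = m \<and> i = 1)" using assms x by (auto simp: idx_def split: if_splits)
  show "facet_form x v \<ge> 0" using ei side_nonneg v by (auto simp: x facet_form_def pt_3)
  show "facet_form x v = 0 \<longleftrightarrow> v \<in> fverts x"
  proof (cases "e < m")
    case True
    then have "i < n" using ei by auto
    then show ?thesis using True side_eq_0 pt_side v by (simp add: x facet_form_def)
  next
    case False
    then show ?thesis using ei v by (auto simp: x facet_form_def fverts_def pt_3 layer_iff)
  qed
qed

lemma affine_fn_facet_form: "affine_fn (facet_form x)"
  using affine_fn_coordinates[of 0 0 1 0] affine_fn_coordinates[of 0 0 "-1" "real n"] affine_fn_side
  by (auto simp: facet_form_def split: prod.split)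

lemma card_fverts_ge3: "x \<in> idx \<Longrightarrow> card (fverts x) \<ge> 3"
  using card_side m r_pos[of 0] n by (auto simp: idx_def fverts_def card_layer split: if_splits)

text \<open>The heights that occur tell sides from bottom and top and give the storey; the columns
  at the lower height, where \<open>r\<close> is positive, give the polygon edge.\<close>

lemma inj_fverts: "inj_on fverts idx"
proof (rule inj_onI)
  fix x y assume xy: "x \<in> idx" "y \<in> idx" "fverts x = fverts y"
  obtain e i where x: "x = (e, i)" by force
  obtain e' i' where y: "y = (e', i')" by force
  have lev: "(\<exists>v\<in>fverts (e, i). v$3 = real k) \<longleftrightarrow> (if e < m then k = i \<or> k = i + 1 else if i = 0 then k = 0 else k = n)" for e i k
    using m by (auto simp: fverts_def layer_def pt_3 intro: exI[of _ 0])
  have eq: "(if e < m then k = i \<or> k = i + 1 else if i = 0 then k = 0 else k = n) \<longleftrightarrow>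
    (if e' < m then k = i' \<or> k = i' + 1 else if i' = 0 then k = 0 else k = n)" for k
    using lev[of e i k] lev[of e' i' k] xy(3) unfolding x y by simp
  have ei: "(e < m \<and> i < n) \<or> (e = m \<and> i = 0) \<or> (e = m \<and> i = 1)" using xy x by (auto simp: idx_def split: if_splits)
  have ei': "(e' < m \<and> i' < n) \<or> (e' = m \<and> i' = 0) \<or> (e' = m \<and> i' = 1)" using xy y by (auto simp: idx_def split: if_splits)
  have "e < m \<longleftrightarrow> e' < m"
    using eq[of i] eq[of "i + 1"] eq[of i'] eq[of "i' + 1"] ei ei' by (auto split: if_splits)
  then consider "e < m" "e' < m" | "\<not> e < m" "\<not> e' < m" by blast
  then show "x = y"
  proof cases
    case 1
    have "i = i'" using eq[of i] eq[of "i + 1"] eq[of i'] eq[of "i' + 1"] 1 by (auto split: if_splits)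
    have i: "i < n" using ei 1 by auto
    have "r i \<noteq> 0" using r_pos[OF i] by simp
    have "(j = e \<or> j = nxt e) \<longleftrightarrow> (j = e' \<or> j = nxt e')" if "j < m" for j
      using pt_side[OF 1(1) i that, of i] pt_side[OF 1(2) i that, of i] xy(3) i \<open>r i \<noteq> 0\<close> \<open>i = i'\<close> unfolding x y by simp
    from this[of e] this[of "nxt e"] this[of e'] have "e = e'"
      using 1 nxt_lt nxt_neq prv_nxt nxt_neq_prv by metis
    then show ?thesis using x y \<open>i = i'\<close> by simp
  next
    case 2
    then have "i = i'" using eq[of 0] ei ei' n by (auto split: if_splits)
    then show ?thesis using 2 ei ei' x y by auto
  qed
qed

text \<open>Quadrilateral sides count 2, triangles below an apex 1, the bottom and a non-collapsed
  top \<open>m - 2\<close> each. The total is exactly the bound of \<open>sum_facets_upper\<close>,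
  as \<open>all_facets\<close> demands.\<close>

lemma sum_idx: "(\<Sum>x\<in>idx. int (card (fverts x)) - 2) = 2 * int (card W) - 4"
proof -
  have I: "idx = ({..<m} \<times> {..<n}) \<union> ({(m, 0)} \<union> (if r n = 0 then {} else {(m, 1)}))" by (auto simp: idx_def)
  have "(\<Sum>x\<in>idx. int (card (fverts x)) - 2) = (\<Sum>x\<in>{..<m} \<times> {..<n}. int (card (fverts x)) - 2)
     + (\<Sum>x\<in>{(m, 0)} \<union> (if r n = 0 then {} else {(m, 1)}). int (card (fverts x)) - 2)"
    unfolding I by (rule sum.union_disjoint) auto
  also have "(\<Sum>x\<in>{..<m} \<times> {..<n}. int (card (fverts x)) - 2) = (\<Sum>e<m. \<Sum>i<n. int (card (fverts (e, i))) - 2)"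
    by (simp add: sum.cartesian_product split_def)
  also have "\<dots> = (\<Sum>e<m. \<Sum>i<n. 2 - of_bool (r n = 0 \<and> i = n - 1))"
    by (intro sum.cong refl) (auto simp: card_side r_1_eq_0)
  also have "(\<Sum>i<n. 2 - of_bool (r n = 0 \<and> i = n - 1) :: int) = 2 * int n - of_bool (r n = 0)"
    using n by (cases "r n = 0") (simp_all add: sum_subtractf)
  also have "(\<Sum>x\<in>{(m, 0)} \<union> (if r n = 0 then {} else {(m, 1)}). int (card (fverts x)) - 2) = (if r n = 0 then int m - 2 else 2 * (int m - 2))"
    using r_pos[of 0] n by (auto simp: fverts_def card_layer)
  finally show ?thesis
    by (cases "r n = 0") (simp_all add: card_W card_layer algebra_simps)
qed

lemma vertices_tower: "polytope3.V (convex hull W) = W"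
  using polytope3.V_def[OF polytope3_tower] extreme_W by simp

lemma d_tower:
  assumes "v \<in> W"
  shows "polytope3.d (convex hull W) v = card {x \<in> idx. v \<in> fverts x \<and> card (fverts x) \<noteq> 3}"
proof (rule polytope3.all_facets[where h = facet_form, OF polytope3_tower finite_idx inj_fverts, unfolded vertices_tower])
  show "fverts x \<subset> W" if x: "x \<in> idx" for x
  proof -
    obtain e i where ei: "x = (e, i)" by force
    \<comment> \<open>A height that the facet does not reach, so that \<open>pt 0 k\<close>
      witnesses properness. The lowest sides end at height 1, which is below \<open>n\<close>
      because \<open>n\<close> is at least 2.\<close>
    define k where "k = (if e < m then (if i = 0 then n else 0) else if i = 0 then n else 0)"
    have "pt 0 k \<notin> fverts x"
      using n m x by (auto simp: ei k_def fverts_def layer_def idx_def pt_eq split: if_splits)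
    moreover have "pt 0 k \<in> W" using m by (intro pt_W) (auto simp: k_def)
    ultimately show ?thesis using fverts_W[OF x] by blast
  qed
qed (simp_all add: affine_fn_facet_form facet_form_fverts card_fverts_ge3 sum_idx assms)

lemma idx_at:
  assumes "j < m" "k \<le> n" "r k \<noteq> 0"
  shows "{x \<in> idx. pt j k \<in> fverts x} = {j, prv j} \<times> {i. i < n \<and> (k = i \<or> k = i + 1)}
     \<union> (if k = 0 then {(m, 0)} else {}) \<union> (if k = n then {(m, 1)} else {})" (is "?L = ?R")
proof (rule set_eqI)
  fix x :: "nat \<times> nat"
  obtain e i where x: "x = (e, i)" by force
  show "x \<in> ?L \<longleftrightarrow> x \<in> ?R"
  proof (cases "e < m")
    case True
    have "j = nxt e \<longleftrightarrow> e = prv j" using True assms prv_nxt nxt_prv by metis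
    then show ?thesis
      using True assms pt_side[of e i j k] by (auto simp: x idx_def)
  next
    case False
    then show ?thesis
      using assms n prv_lt[of j] by (auto simp: x idx_def fverts_def layer_iff split: if_splits)
  qed
qed

text \<open>A corner at an inner height lies on four sides, all of them quadrilaterals unless an
  apex is directly above, when two are triangles. Corners of the bottom and of a non-collapsed top
  lie on three facets only, and an apex on triangles only.\<close>

lemma rigid_tower:
  assumes "j < m" "k \<le> n"
  shows "pt j k \<in> polytope3.R (convex hull W) \<longleftrightarrow> k = 0 \<or> k = n \<or> (r n = 0 \<and> k = n - 1)"
proof -
  let ?D = "{x \<in> idx. pt j k \<in> fverts x \<and> card (fverts x) \<noteq> 3}"
  have R: "pt j k \<in> polytope3.R (convex hull W) \<longleftrightarrow> card ?D \<le> 3"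
    using pt_W[OF assms] d_tower polytope3.R_def[OF polytope3_tower] vertices_tower by auto
  have sub: "?D \<subseteq> {x \<in> idx. pt j k \<in> fverts x}" by auto
  have pj: "prv j < m" "prv j \<noteq> j" using assms prv_lt nxt_prv nxt_neq by metis+
  consider "r k = 0" | "r k \<noteq> 0" "k = 0 \<or> k = n" | "r k \<noteq> 0" "r n = 0" "k = n - 1" | "r k \<noteq> 0" "0 < k" "k < n" "\<not> (r n = 0 \<and> k = n - 1)"
    using assms by linarith
  then show ?thesis
  proof cases
    case 1
    then have k: "k = n" "r n = 0" using r_pos assms by (metis le_neq_implies_less less_irrefl)+
    have "?D = {}"
      using k n r_pos r_1_eq_0 card_side
      by (auto simp: idx_def fverts_def layer_iff assms pt_eq split: if_splits)
    then have "card ?D = 0" by (simp only: card.empty)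
    then show ?thesis using R k by simp
  next
    case 2
    have "{i. i < n \<and> (k = i \<or> k = i + 1)} = {if k = 0 then 0 else n - 1}" using 2 n by auto
    then have "{x \<in> idx. pt j k \<in> fverts x} \<subseteq> {(j, if k = 0 then 0 else n - 1), (prv j, if k = 0 then 0 else n - 1), (m, if k = 0 then 0 else 1)}"
      using idx_at[OF assms 2(1)] 2 n by auto
    then have "card ?D \<le> card {(j, if k = 0 then 0 else n - 1), (prv j, if k = 0 then 0 else n - 1), (m, if k = 0 then 0 else 1)}"
      using sub by (intro card_mono) auto
    also have "\<dots> \<le> 3" by (simp add: card_insert_if)
    finally show ?thesis using R 2 by blast
  next
    case 3
    have k0: "k \<noteq> 0" "k \<noteq> n" using 3 n by auto
    have "?D \<subseteq> {(j, n - 2), (prv j, n - 2)}"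
    proof
      fix x assume x: "x \<in> ?D"
      then have "x \<in> {x \<in> idx. pt j k \<in> fverts x}" by simp
      then have "x \<in> {j, prv j} \<times> {i. i < n \<and> (k = i \<or> k = i + 1)}"
        unfolding idx_at[OF assms 3(1)] using k0 by simp
      then obtain e i where ei: "x = (e, i)" "e = j \<or> e = prv j" "i < n" "k = i \<or> k = i + 1" by auto
      have "e < m" using ei assms pj by auto
      have "i \<noteq> n - 1"
      proof
        assume "i = n - 1"
        then have "card (fverts x) = 3" using card_side[OF \<open>e < m\<close> ei(3)] r_1_eq_0[OF ei(3)] 3 ei by simp
        then show False using x by simp
      qed
      then have "i = n - 2" using ei 3 by auto
      then show "x \<in> {(j, n - 2), (prv j, n - 2)}" using ei by auto
    qed
    then have "card ?D \<le> card {(j, n - 2), (prv j, n - 2)}" by (intro card_mono) auto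
    also have "\<dots> \<le> 3" by (simp add: card_insert_if)
    finally show ?thesis using R 3 by blast
  next
    case 4
    have "{j, prv j} \<times> {k - 1, k} \<subseteq> ?D"
    proof
      fix x assume "x \<in> {j, prv j} \<times> {k - 1, k}"
      then obtain e i where ei: "x = (e, i)" "e = j \<or> e = prv j" "i = k - 1 \<or> i = k" by auto
      have em: "e < m" using ei assms pj by auto
      have i: "i < n" using ei 4 by auto
      have "r (i + 1) \<noteq> 0" using r_1_eq_0[OF i] ei 4 by auto
      then have "card (fverts x) \<noteq> 3" using card_side[OF em i] ei by simp
      moreover have "x \<in> {x \<in> idx. pt j k \<in> fverts x}"
        unfolding idx_at[OF assms 4(1)] using ei i 4 by auto
      ultimately show "x \<in> ?D" by simp
    qed
    then have "card ({j, prv j} \<times> {k - 1, k}) \<le> card ?D" using finite_idx by (intro card_mono) auto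
    moreover have "card ({j, prv j} \<times> {k - 1, k}) = 4"
      using pj 4 by (simp add: card_cartesian_product card_insert_if)
    ultimately show ?thesis using R 4 by linarith
  qed
qed

lemma card_rigid_tower: "card (polytope3.R (convex hull W)) = (if r n = 0 then 2 * m + 1 else 2 * m)"
proof -
  have RW: "polytope3.R (convex hull W) \<subseteq> W"
    using polytope3.R_V[OF polytope3_tower] vertices_tower by simp
  have R: "polytope3.R (convex hull W) = (if r n = 0 then layer 0 \<union> layer (n - 1) \<union> layer n else layer 0 \<union> layer n)" (is "_ = ?X")
  proof (rule set_eqI)
    fix v
    show "v \<in> polytope3.R (convex hull W) \<longleftrightarrow> v \<in> ?X"
    proof (cases "v \<in> W")
      case True
      then obtain j k where v: "j < m" "k \<le> n" "v = pt j k" by (auto simp: W_iff)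
      show ?thesis unfolding v(3) rigid_tower[OF v(1,2)] using layer_iff[OF v(1)] by auto
    next
      case False
      moreover have "?X \<subseteq> W" using layer_W[of 0] layer_W[of n] layer_W[of "n - 1"] by auto
      ultimately show ?thesis using RW by blast
    qed
  qed
  have r0: "r 0 \<noteq> 0" "r (n - 1) \<noteq> 0" using r_pos[of 0] r_pos[of "n - 1"] n by auto
  have d: "layer 0 \<inter> layer n = {}" "layer 0 \<inter> layer (n - 1) = {}" "layer (n - 1) \<inter> layer n = {}"
    using n by (intro layers_disjoint; simp)+
  show ?thesis
    unfolding R using finite_layer r0 d
    by (simp add: card_Un_disjoint Int_Un_distrib2 card_layer)
qed

end

lemma exists_polytope_rigid:
  assumes "k \<ge> 6"
  obtains P where "polytope3 P" "card (polytope3.R P) = k" "card (polytope3.V P) > N"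
proof -
  define m where "m = k div 2"
  define n where "n = N + 2"
  \<comment> \<open>For even \<open>k\<close> the extra 1 keeps a top polygon, giving
    \<open>2 * m\<close> rigid vertices; for odd \<open>k\<close> the top collapses to an apex,
    which adds one. The height \<open>N + 2\<close> forces more than \<open>N\<close> vertices in
    either case.\<close>
  define A where "A = (real n)\<^sup>2 + (if even k then 1 else 0)"
  interpret tower m n A
    by unfold_locales (use assms in \<open>auto simp: m_def n_def A_def\<close>)
  have "A - (real n)\<^sup>2 = (if even k then 1 else 0)" by (simp add: A_def)
  then have rn: "r n = 0 \<longleftrightarrow> odd k" unfolding r_def by simp
  have "card (polytope3.R (convex hull W)) = (if r n = 0 then 2 * m + 1 else 2 * m)"
    by (rule card_rigid_tower)
  also have "\<dots> = k" unfolding rn unfolding m_def by auto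
  finally have "card (polytope3.R (convex hull W)) = k" .
  moreover have "card (polytope3.V (convex hull W)) > N"
  proof -
    have "1 * n \<le> m * n" using m by (intro mult_right_mono) auto
    then show ?thesis unfolding vertices_tower card_W by (simp add: n_def)
  qed
  ultimately show thesis using that polytope3_tower by blast
qed

section \<open>Isotopy classes with a given number of rigid vertices\<close>

lemma polyhedral_graphE:
  assumes "polyhedral_graph G"
  obtains P c where "polytope3 P" "c \<in> interior P" "isotopic (skeleton_graph c P) G"
    "on_sphere (skeleton_graph c P)" "on_sphere G" "card (rigid_vertices G) = card (polytope3.R P)"
    "card (verts G) = card (polytope3.V P)"
proof -
  obtain P c where P: "polytope P" "c \<in> interior P" "isotopic (skeleton_graph c P) G"
    using assms by (auto simp: polyhedral_graph_def)
  interpret polytope3 P using P by unfold_locales auto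
  have on: "on_sphere (skeleton_graph c P)" using on_sphere_skeleton[OF P(2)] .
  show thesis
    using that[of P c] P on isotopic_on_sphere[OF P(3) on] polytope3_axioms
      isotopic_card_rigid[OF P(3) on] card_rigid_skeleton[OF P(2)]
      isotopic_card_verts[OF P(3) on] card_verts_skeleton[OF P(2)]
    by simp
qed

lemma polyhedral_skeleton:
  assumes "polytope3 P" "c \<in> interior P"
  shows "polyhedral_graph (skeleton_graph c P)" "on_sphere (skeleton_graph c P)"
    "card (rigid_vertices (skeleton_graph c P)) = card (polytope3.R P)"
    "card (verts (skeleton_graph c P)) = card (polytope3.V P)"
proof -
  interpret polytope3 P by fact
  show "polyhedral_graph (skeleton_graph c P)"
    using polytope_P assms(2) isotopic_refl unfolding polyhedral_graph_def by blast
qed (use assms in \<open>simp_all add: polytope3.on_sphere_skeleton polytope3.card_rigid_skeleton polytope3.card_verts_skeleton\<close>)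

lemma polyhedral_classes_iff:
  "X \<in> polyhedral_classes k \<longleftrightarrow> (\<exists>G. polyhedral_graph G \<and> card (rigid_vertices G) = k \<and> X = isotopy_class G)"
  by (auto simp: polyhedral_classes_def quotient_def isotopy_class_def)

lemma polyhedral_class_of_small:
  assumes G: "polyhedral_graph G" "card (rigid_vertices G) \<le> 5"
  obtains P c where "polytope3 P" "c \<in> interior P" "isotopy_class G = isotopy_class (skeleton_graph c P)"
    "card {v. v extreme_point_of P} = card (rigid_vertices G)" "on_sphere (skeleton_graph c P)"
proof -
  obtain P c where P: "polytope3 P" "c \<in> interior P" "isotopic (skeleton_graph c P) G"
    "on_sphere (skeleton_graph c P)" "card (rigid_vertices G) = card (polytope3.R P)"
    by (rule polyhedral_graphE[OF G(1)]) (use that in blast)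
  have "polytope3.V P = polytope3.R P"
    using polytope3.rigid_4_or_5[OF P(1)] P(5) G(2) by simp
  then have "card {v. v extreme_point_of P} = card (rigid_vertices G)"
    using P(5) polytope3.V_def[OF P(1)] by simp
  then show thesis using that[OF P(1,2)] isotopy_class_eq[OF P(4,3)] P(4) by simp
qed

lemma std_classes:
  shows "isotopy_class tetrahedron \<in> polyhedral_classes 4"
    and "isotopy_class quadrilateral_pyramid \<in> polyhedral_classes 5"
    and "isotopy_class triangular_bipyramid \<in> polyhedral_classes 5"
proof -
  have K: "isotopy_class (skeleton_graph 0 (convex hull X)) \<in> polyhedral_classes k"
    if X: "polytope3 (convex hull X)" "0 \<in> interior (convex hull X)" "{v. v extreme_point_of convex hull X} = X"
      "card X = k" "k = 4 \<or> k = 5" for X k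
  proof -
    have V: "polytope3.V (convex hull X) = X" using polytope3.V_def[OF X(1)] X(3) by simp
    then have "card (polytope3.R (convex hull X)) = k"
      using polytope3.card_R_V[OF X(1)] X(4,5) by simp
    then show ?thesis
      unfolding polyhedral_classes_iff using polyhedral_skeleton[OF X(1,2)] by blast
  qed
  show "isotopy_class tetrahedron \<in> polyhedral_classes 4"
    unfolding std_eq by (rule K[OF polytope3_std(1) zero_interior_std(1) extreme_std(1) card_std(1)]) simp
  show "isotopy_class quadrilateral_pyramid \<in> polyhedral_classes 5"
    unfolding std_eq by (rule K[OF polytope3_std(2) zero_interior_std(2) extreme_std(2) card_std(2)]) simp
  show "isotopy_class triangular_bipyramid \<in> polyhedral_classes 5"
    unfolding std_eq by (rule K[OF polytope3_std(3) zero_interior_std(3) extreme_std(3) card_std(3)]) simp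
qed

lemma pyramid_neq_bipyramid: "isotopy_class quadrilateral_pyramid \<noteq> isotopy_class triangular_bipyramid"
proof
  assume "isotopy_class quadrilateral_pyramid = isotopy_class triangular_bipyramid"
  then have "isotopic quadrilateral_pyramid triangular_bipyramid"
    using isotopic_refl by (metis mem_isotopy_class)
  moreover have "on_sphere quadrilateral_pyramid"
    unfolding std_eq by (rule polyhedral_skeleton(2)[OF polytope3_std(2) zero_interior_std(2)])
  ultimately show False using isotopic_two_gaps two_gaps_pyramid not_two_gaps_bipyramid by blast
qed

text \<open>The number of vertices is an isotopy invariant, so \<open>size\<close> does not depend
  on the chosen representative, and the towers make it unbounded among the classes with
  \<open>k\<close> rigid vertices.\<close>

lemma infinite_polyhedral_classes:
  assumes "k \<ge> 6"
  shows "infinite (polyhedral_classes k)"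
proof
  assume fin: "finite (polyhedral_classes k)"
  define size where "size X = card (verts (SOME G. G \<in> X))" for X :: "sgraph set"
  have K: "\<exists>X\<in>polyhedral_classes k. size X > N" for N
  proof -
    obtain P where P: "polytope3 P" "card (polytope3.R P) = k" "card (polytope3.V P) > N"
      using exists_polytope_rigid[OF assms] .
    obtain c where c: "c \<in> interior P" using polytope3.interior_P[OF P(1)] by blast
    let ?G = "skeleton_graph c P"
    note G = polyhedral_skeleton[OF P(1) c]
    have "?G \<in> isotopy_class ?G" using isotopic_refl by (simp add: mem_isotopy_class)
    then have "(SOME H. H \<in> isotopy_class ?G) \<in> isotopy_class ?G" by (rule someI)
    then have "size (isotopy_class ?G) = card (verts ?G)"
      using isotopic_card_verts[OF _ G(2)] by (simp add: size_def mem_isotopy_class)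
    moreover have "isotopy_class ?G \<in> polyhedral_classes k"
      using G P(2) by (auto simp: polyhedral_classes_iff)
    ultimately show ?thesis using G(4) P(3) by force
  qed
  obtain X where X: "X \<in> polyhedral_classes k" "size X > Max (size ` polyhedral_classes k)" using K by blast
  have "size X \<le> Max (size ` polyhedral_classes k)" by (rule Max_ge) (use fin X in auto)
  then show False using X by simp
qed

theorem theorem1p1:
  shows "(\<forall>k\<le>3. polyhedral_classes k = {}) \<and>
         polyhedral_classes 4 = {isotopy_class tetrahedron} \<and>
         (polyhedral_classes 5 =
            {isotopy_class quadrilateral_pyramid, isotopy_class triangular_bipyramid} \<and>
          isotopy_class quadrilateral_pyramid \<noteq> isotopy_class triangular_bipyramid) \<and>
         (\<forall>k\<ge>6. infinite (polyhedral_classes k))"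
proof (intro conjI allI impI)
  show "polyhedral_classes k = {}" if "k \<le> 3" for k
  proof -
    have "card (rigid_vertices G) \<ge> 4" if "polyhedral_graph G" for G
      using polyhedral_graphE[OF that] polytope3.rigid_ge4 by metis
    then show ?thesis using \<open>k \<le> 3\<close> polyhedral_classes_iff[of _ k] by force
  qed
  show "polyhedral_classes 4 = {isotopy_class tetrahedron}"
  proof
    show "polyhedral_classes 4 \<subseteq> {isotopy_class tetrahedron}"
    proof
      fix X assume "X \<in> polyhedral_classes 4"
      then obtain G where G: "polyhedral_graph G" "card (rigid_vertices G) = 4" "X = isotopy_class G"
        by (auto simp: polyhedral_classes_iff)
      obtain P c where P: "polytope3 P" "c \<in> interior P" "isotopy_class G = isotopy_class (skeleton_graph c P)"
        "card {v. v extreme_point_of P} = 4" "on_sphere (skeleton_graph c P)"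
        by (rule polyhedral_class_of_small[OF G(1)]) (use G(2) that in auto)
      then show "X \<in> {isotopy_class tetrahedron}"
        using isotopic_tetrahedron[OF P(1,2,4)] isotopy_class_eq G(3) by simp
    qed
  qed (use std_classes in simp)
  show "polyhedral_classes 5 = {isotopy_class quadrilateral_pyramid, isotopy_class triangular_bipyramid}"
  proof
    show "polyhedral_classes 5 \<subseteq> {isotopy_class quadrilateral_pyramid, isotopy_class triangular_bipyramid}"
    proof
      fix X assume "X \<in> polyhedral_classes 5"
      then obtain G where G: "polyhedral_graph G" "card (rigid_vertices G) = 5" "X = isotopy_class G"
        by (auto simp: polyhedral_classes_iff)
      obtain P c where P: "polytope3 P" "c \<in> interior P" "isotopy_class G = isotopy_class (skeleton_graph c P)"
        "card {v. v extreme_point_of P} = 5" "on_sphere (skeleton_graph c P)"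
        by (rule polyhedral_class_of_small[OF G(1)]) (use G(2) that in auto)
      then show "X \<in> {isotopy_class quadrilateral_pyramid, isotopy_class triangular_bipyramid}"
        using isotopic_pyramid_or_bipyramid[OF P(1,2,4)] isotopy_class_eq[OF P(5)] G(3) by auto
    qed
  qed (use std_classes in simp)
  show "isotopy_class quadrilateral_pyramid \<noteq> isotopy_class triangular_bipyramid"
    by (rule pyramid_neq_bipyramid)
  show "infinite (polyhedral_classes k)" if "k \<ge> 6" for k
    by (rule infinite_polyhedral_classes[OF that])
qed

end
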